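(* Let $G=\mathrm{SO}(2)\times \mathsf{G}_2$. For each odd integer $k$, the $G$-manifolds $\mathbb{S}^{13}_k$ and $M^{13}_k$ are $G$-equivariantly diffeomorphic, and so are the quotient $G$-manifolds $P^{13}_k=\mathbb{S}^{13}_k/T$ and $N^{13}_k=M^{13}_k/I$.
   Context: Octonions. $\mathbb{O}$ denotes the octonions with orthonormal basis $e_0=1,e_1,\dots,e_7$, $e_1,\dots,e_7$ anticommuting with squares $-1$ and, together with their cyclic permutations, $e_1e_2=e_3$, $e_1e_4=e_5$, $e_1e_7=e_6$, $e_2e_4=e_6$, $e_2e_5=e_7$, $e_3e_4=e_7$, $e_3e_6=e_5$. $\mathsf{G}_2=\mathrm{Aut}(\mathbb{O})$ acts on $\mathrm{Im}\,\mathbb{O}=\mathbb{R}^7$ (basis $e_1,\dots,e_7$), so $\mathsf{G}_2\subset\mathrm{SO}(7)$. $\mathbb{S}^7\subset\mathbb{O}$ is the unit sphere. Shimada spheres. For odd $k$ put $m=\frac{k+1}{2}$, $n=\frac{-k+1}{2}$. $\Sigma^{15}_k$ is obtained by gluing two copies of $\mathbb{O}\times\mathbb{S}^7$, with coordinates $(u,v)$ and $(u',v')$, along $(\mathbb{O}\setminus\{0\})\times\mathbb{S}^7$ via $(u',v')=\left(\frac{u}{|u|^2},\frac{u^m}{|u|^m}v\frac{u^n}{|u|^n}\right)$. The sphere $\mathbb{S}^{13}_k\subset\Sigma^{15}_k$ is given by $\mathrm{Re}\,v=\mathrm{Re}(uv)=0$ in the first chart and $\mathrm{Re}\,v'=\mathrm{Re}(u'(v')^{-1})=0$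 in the second. $T$ is the involution $(u,v)\mapsto(u,-v)$, $(u',v')\mapsto(u',-v')$. Davis action of $G$ on $\Sigma^{15}_k$: $g\in\mathsf{G}_2$ acts by $(u,v)\mapsto(g(u),g(v))$, $(u',v')\mapsto(g(u'),g(v'))$; $\gamma=\gamma(a,b)=\begin{pmatrix}a&b\\-b&a\end{pmatrix}\in\mathrm{SO}(2)$ acts by $$\gamma\star u=(au+b)(-bu+a)^{-1},\quad \gamma\star v=\frac{(-bu+a)^m v(-bu+a)^n}{|-bu+a|^{m+n}},$$ $$\gamma\star u'=(-b+au')(a+bu')^{-1},\quad \gamma\star v'=\frac{(a+b\bar u')^m v'(a+b\bar u')^n}{|a+b\bar u'|^{m+n}}$$ (interpreted via the gluing when a point leaves a chart). The action preserves $\mathbb{S}^{13}_k$ and commutes with $T$, so $G$ acts on $\mathbb{S}^{13}_k$ and $P^{13}_k$. The element $e^{i\theta}\in\mathrm{SO}(2)$ is identified with $\gamma(\cos\theta,-\sin\theta)$. Brieskorn varieties. For odd $d\ge1$, $M^{13}_d\subset\mathbb{C}^8$ is defined by $z_0^d+z_1^2+\cdots+z_7^2=0$ and $|z_0|^2+\cdots+|z_7|^2=1$, with $G$-action $(e^{i\theta},A)(z_0,Z)=(e^{-2i\theta}z_0,e^{-id\theta}AZ)$, where $Z=(z_1,\dots,z_7)^t$, $A\in\mathsf{G}_2\subset\mathrm{SO}(7)$. For negative odd $k$, $M^{13}_k$ means $M^{13}_{|k|}$. $I$ is the free involution $(z_0,z_1,\dots,z_7)\mapsto(z_0,-z_1,\dots,-z_7)$,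 which commutes with the $G$-action, so $G$ acts on $N^{13}_k$. *)

theory Defs
  imports "HOL-Analysis.Analysis"
begin

section \<open>Smooth maps and smooth structures\<close>

text \<open>
  \<open>Ck_on n f S\<close> is meant for open \<open>S\<close> and finite-dimensional spaces: all iterated directional
  derivatives up to order \<open>n\<close> exist as Frechet derivatives and are continuous.
\<close>

primrec Ck_on :: "nat \<Rightarrow> ('e::euclidean_space \<Rightarrow> 'f::euclidean_space) \<Rightarrow> 'e set \<Rightarrow> bool" where
  "Ck_on 0 f S \<longleftrightarrow> continuous_on S f"
| "Ck_on (Suc n) f S \<longleftrightarrow>
     (\<forall>x\<in>S. f differentiable (at x)) \<and> (\<forall>v. Ck_on n (\<lambda>x. frechet_derivative f (at x) v) S)"

definition smooth_on :: "('e::euclidean_space \<Rightarrow> 'f::euclidean_space) \<Rightarrow> 'e set \<Rightarrow> bool" where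
  "smooth_on f S \<longleftrightarrow> (\<forall>n. Ck_on n f S)"

text \<open>
  A chart is a domain together with an injection of it into a Euclidean space. The image need not
  be open: it is an embedded submanifold of the Euclidean space, such as
  \<open>\<real>\<^sup>8 \<times> S\<^sup>7 \<subseteq> \<real>\<^sup>1\<^sup>6\<close> or a Brieskorn variety in \<open>\<complex>\<^sup>8\<close>, carrying its usual smooth structure: a
  function on a subset of a Euclidean space is smooth iff it extends, locally around each point of
  the subset, to a smooth function on an open subset of the Euclidean space.
\<close>

type_synonym ('a, 'e) atlas = "('a set \<times> ('a \<Rightarrow> 'e)) set"

definition atlas_carrier :: "('a, 'e) atlas \<Rightarrow> 'a set" where
  "atlas_carrier A = (\<Union>(U, \<phi>)\<in>A. U)"

text \<open>The inclusion \<open>f y \<in> V\<close> in the following definition makes smooth maps continuous.\<close>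

definition smooth_map ::
  "('a, 'e::euclidean_space) atlas \<Rightarrow> ('b, 'f::euclidean_space) atlas \<Rightarrow> ('a \<Rightarrow> 'b) \<Rightarrow> bool" where
  "smooth_map A B f \<longleftrightarrow>
     (\<forall>x\<in>atlas_carrier A. \<exists>(U, \<phi>)\<in>A. \<exists>(V, \<psi>)\<in>B. x \<in> U \<and> f x \<in> V \<and>
        (\<exists>W F. open W \<and> \<phi> x \<in> W \<and> smooth_on F W \<and>
           (\<forall>y\<in>U. \<phi> y \<in> W \<longrightarrow> f y \<in> V \<and> \<psi> (f y) = F (\<phi> y))))"

definition diffeomorphism ::
  "('a, 'e::euclidean_space) atlas \<Rightarrow> ('b, 'f::euclidean_space) atlas \<Rightarrow> ('a \<Rightarrow> 'b) \<Rightarrow> bool" where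
  "diffeomorphism A B f \<longleftrightarrow> bij_betw f (atlas_carrier A) (atlas_carrier B) \<and>
     smooth_map A B f \<and> smooth_map B A (inv_into (atlas_carrier A) f)"

definition equivariantly_diffeomorphic ::
  "'g set \<Rightarrow> ('a, 'e::euclidean_space) atlas \<Rightarrow> ('g \<Rightarrow> 'a \<Rightarrow> 'a)
     \<Rightarrow> ('b, 'f::euclidean_space) atlas \<Rightarrow> ('g \<Rightarrow> 'b \<Rightarrow> 'b) \<Rightarrow> bool" where
  "equivariantly_diffeomorphic G A \<alpha> B \<beta> \<longleftrightarrow>
     (\<exists>f. diffeomorphism A B f \<and>
        (\<forall>h\<in>G. \<forall>x\<in>atlas_carrier A. \<alpha> h x \<in> atlas_carrier A \<and> f (\<alpha> h x) = \<beta> h (f x)))"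

definition subspace_atlas :: "'a set \<Rightarrow> ('a, 'e) atlas \<Rightarrow> ('a, 'e) atlas" where
  "subspace_atlas S A = (\<lambda>(U, \<phi>). (U \<inter> S, \<phi>)) ` A"

text \<open>
  The quotient by a free involution \<open>\<tau>\<close> has the orbits \<open>{x, \<tau> x}\<close> as its points. Its charts are the
  charts of the original space on open sets \<open>V\<close> disjoint from \<open>\<tau> ` V\<close>, transported along the
  projection, which is injective on \<open>V\<close>.
\<close>

definition quotient_atlas ::
  "('a \<Rightarrow> 'a) \<Rightarrow> ('a, 'e::euclidean_space) atlas \<Rightarrow> ('a set, 'e) atlas" where
  "quotient_atlas \<tau> A =
     {((\<lambda>x. {x, \<tau> x}) ` V, \<lambda>q. \<phi> (the_elem (q \<inter> V))) | V \<phi>.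
        \<exists>U W. (U, \<phi>) \<in> A \<and> open W \<and> V = {x \<in> U. \<phi> x \<in> W} \<and> V \<inter> \<tau> ` V = {}}"

definition quotient_action :: "('g \<Rightarrow> 'a \<Rightarrow> 'a) \<Rightarrow> 'g \<Rightarrow> 'a set \<Rightarrow> 'a set" where
  "quotient_action \<alpha> h q = \<alpha> h ` q"


section \<open>Octonions\<close>

text \<open>
  The basis vector \<open>e\<^sub>i\<close> is \<open>axis i 1\<close>. The index type \<open>8\<close> consists of the residues modulo 8, so its
  elements are \<open>0, 1, \<dots>, 7\<close>. Componentwise multiplication \<open>*\<close> of vectors is not octonion
  multiplication, which is \<open>omul\<close>.
\<close>

type_synonym octonion = "real ^ 8"

definition oct_lines :: "(8 \<times> 8 \<times> 8) set" where
  "oct_lines = {(1,2,3), (1,4,5), (1,7,6), (2,4,6), (2,5,7), (3,4,7), (3,6,5)}"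

definition oct_triples :: "(8 \<times> 8 \<times> 8) set" where
  "oct_triples = {(i, j, k). (i, j, k) \<in> oct_lines \<or> (j, k, i) \<in> oct_lines \<or> (k, i, j) \<in> oct_lines}"

definition basis_mul :: "8 \<Rightarrow> 8 \<Rightarrow> octonion" where
  "basis_mul i j =
     (if i = 0 then axis j 1
      else if j = 0 then axis i 1
      else if i = j then - axis 0 1
      else (\<Sum>k\<in>UNIV. if (i, j, k) \<in> oct_triples then axis k 1
                      else if (j, i, k) \<in> oct_triples then - axis k 1
                      else 0))"

definition omul :: "octonion \<Rightarrow> octonion \<Rightarrow> octonion" (infixl "\<odot>" 70) where
  "x \<odot> y = (\<Sum>i\<in>UNIV. \<Sum>j\<in>UNIV. (x $ i * y $ j) *\<^sub>R basis_mul i j)"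

definition oone :: octonion where
  "oone = axis 0 1"

definition ore :: "octonion \<Rightarrow> real" where
  "ore x = x $ 0"

definition ocnj :: "octonion \<Rightarrow> octonion" where
  "ocnj x = (\<chi> i. if i = 0 then x $ 0 else - x $ i)"

definition oinv :: "octonion \<Rightarrow> octonion" where
  "oinv x = (1 / (norm x)\<^sup>2) *\<^sub>R ocnj x"

definition opowi :: "octonion \<Rightarrow> int \<Rightarrow> octonion" where
  "opowi x i = (if 0 \<le> i then ((\<odot>) x ^^ nat i) oone else ((\<odot>) (oinv x) ^^ nat (- i)) oone)"

definition G2 :: "(octonion \<Rightarrow> octonion) set" where
  "G2 = {g. linear g \<and> bij g \<and> (\<forall>x y. g (x \<odot> y) = g x \<odot> g y)}"

text \<open>
  \<open>\<gamma>(a, b)\<close> is the matrix with rows \<open>(a, b)\<close> and \<open>(-b, a)\<close>; every element of \<open>SO(2)\<close> has this form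
  with \<open>a = \<gamma> $ 1 $ 1\<close> and \<open>b = \<gamma> $ 1 $ 2\<close>.
\<close>

definition SO2 :: "(real ^ 2 ^ 2) set" where
  "SO2 = {\<gamma>. rotation_matrix \<gamma>}"

definition SO2_G2 :: "((real ^ 2 ^ 2) \<times> (octonion \<Rightarrow> octonion)) set" where
  "SO2_G2 = SO2 \<times> G2"


section \<open>Shimada spheres\<close>

text \<open>
  \<open>twist k x v\<close> is \<open>x\<^sup>m v x\<^sup>n / |x|\<^bsup>m+n\<^esup>\<close> with \<open>m = (k + 1) / 2\<close> and \<open>n = (- k + 1) / 2\<close>; the
  divisions are exact for odd \<open>k\<close>.
\<close>

definition twist :: "int \<Rightarrow> octonion \<Rightarrow> octonion \<Rightarrow> octonion" where
  "twist k x v =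
     (let m = (k + 1) div 2; n = (- k + 1) div 2
      in (1 / norm x powi (m + n)) *\<^sub>R (opowi x m \<odot> v \<odot> opowi x n))"

type_synonym oct_pair = "octonion \<times> octonion"

definition oct_bundle :: "oct_pair set" where
  "oct_bundle = UNIV \<times> sphere 0 1"

definition transition :: "int \<Rightarrow> oct_pair \<Rightarrow> oct_pair" where
  "transition k = (\<lambda>(u, v). ((1 / (norm u)\<^sup>2) *\<^sub>R u, twist k u v))"

text \<open>The \<open>Inl\<close> copy carries the coordinates \<open>(u, v)\<close>, the \<open>Inr\<close> copy \<open>(u', v')\<close>.\<close>

definition gluing :: "int \<Rightarrow> ((oct_pair + oct_pair) \<times> (oct_pair + oct_pair)) set" where
  "gluing k =
     (let R = {(Inl x, Inr (transition k x)) | x. x \<in> oct_bundle \<and> fst x \<noteq> 0}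
      in Id_on (oct_bundle <+> oct_bundle) \<union> R \<union> R\<inverse>)"

type_synonym shimada_point = "(oct_pair + oct_pair) set"

definition pt1 :: "int \<Rightarrow> oct_pair \<Rightarrow> shimada_point" where
  "pt1 k x = gluing k `` {Inl x}"

definition pt2 :: "int \<Rightarrow> oct_pair \<Rightarrow> shimada_point" where
  "pt2 k x = gluing k `` {Inr x}"

definition shimada_sphere :: "int \<Rightarrow> shimada_point set" where
  "shimada_sphere k = (oct_bundle <+> oct_bundle) // gluing k"

definition shimada_atlas :: "int \<Rightarrow> (shimada_point, oct_pair) atlas" where
  "shimada_atlas k =
     {(pt1 k ` oct_bundle, inv_into oct_bundle (pt1 k)),
      (pt2 k ` oct_bundle, inv_into oct_bundle (pt2 k))}"

definition S13 :: "int \<Rightarrow> shimada_point set" where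
  "S13 k = {p \<in> shimada_sphere k.
     (\<forall>(u, v)\<in>oct_bundle. Inl (u, v) \<in> p \<longrightarrow> ore v = 0 \<and> ore (u \<odot> v) = 0) \<and>
     (\<forall>(u', v')\<in>oct_bundle. Inr (u', v') \<in> p \<longrightarrow> ore v' = 0 \<and> ore (u' \<odot> oinv v') = 0)}"

definition S13_atlas :: "int \<Rightarrow> (shimada_point, oct_pair) atlas" where
  "S13_atlas k = subspace_atlas (S13 k) (shimada_atlas k)"

definition T_involution :: "shimada_point \<Rightarrow> shimada_point" where
  "T_involution p = map_sum (\<lambda>(u, v). (u, - v)) (\<lambda>(u', v'). (u', - v')) ` p"

definition G2_act :: "(octonion \<Rightarrow> octonion) \<Rightarrow> shimada_point \<Rightarrow> shimada_point" where
  "G2_act g p = map_sum (\<lambda>(u, v). (g u, g v)) (\<lambda>(u', v'). (g u', g v')) ` p"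

text \<open>
  The \<open>SO(2)\<close>-action in the two charts. Write \<open>p = - b u + a\<close> and \<open>q = a u + b\<close>. If \<open>p \<noteq> 0\<close>, the
  image of \<open>(u, v)\<close> has the first coordinates \<open>(q p\<^sup>-\<^sup>1, p\<^sup>m v p\<^sup>n / |p|\<^bsup>m+n\<^esup>)\<close>. If also \<open>q \<noteq> 0\<close>, then
  by the gluing, since \<open>u\<close> and \<open>v\<close> generate an associative subalgebra, its second coordinates are the
  inverse conjugate of \<open>q p\<^sup>-\<^sup>1\<close> and \<open>q\<^sup>m v q\<^sup>n / |q|\<^bsup>m+n\<^esup>\<close>. Where \<open>p = 0\<close> the image leaves the first
  chart, and these second coordinates extend to \<open>(0, q\<^sup>m v q\<^sup>n / |q|\<^bsup>m+n\<^esup>)\<close>. The second chart is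
  treated in the same way, with \<open>r = a + b u'\<close> and \<open>s = - b + a u'\<close>.
\<close>

definition SO2_act1 :: "int \<Rightarrow> real ^ 2 ^ 2 \<Rightarrow> oct_pair \<Rightarrow> shimada_point" where
  "SO2_act1 k \<gamma> = (\<lambda>(u, v).
     let a = \<gamma> $ 1 $ 1; b = \<gamma> $ 1 $ 2;
         p = - b *\<^sub>R u + a *\<^sub>R oone; q = a *\<^sub>R u + b *\<^sub>R oone
     in if p \<noteq> 0 then pt1 k (q \<odot> oinv p, twist k p v) else pt2 k (0, twist k q v))"

definition SO2_act2 :: "int \<Rightarrow> real ^ 2 ^ 2 \<Rightarrow> oct_pair \<Rightarrow> shimada_point" where
  "SO2_act2 k \<gamma> = (\<lambda>(u', v').
     let a = \<gamma> $ 1 $ 1; b = \<gamma> $ 1 $ 2;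
         r = a *\<^sub>R oone + b *\<^sub>R u'; s = - b *\<^sub>R oone + a *\<^sub>R u'
     in if r \<noteq> 0 then pt2 k (s \<odot> oinv r, twist k (a *\<^sub>R oone + b *\<^sub>R ocnj u') v')
        else pt1 k (0, twist k (- b *\<^sub>R oone + a *\<^sub>R ocnj u') v'))"

text \<open>The two descriptions agree on the overlap of the charts.\<close>

definition SO2_act :: "int \<Rightarrow> real ^ 2 ^ 2 \<Rightarrow> shimada_point \<Rightarrow> shimada_point" where
  "SO2_act k \<gamma> p =
     (if p \<in> pt1 k ` oct_bundle then SO2_act1 k \<gamma> (inv_into oct_bundle (pt1 k) p)
      else SO2_act2 k \<gamma> (inv_into oct_bundle (pt2 k) p))"

definition davis_action ::
  "int \<Rightarrow> (real ^ 2 ^ 2) \<times> (octonion \<Rightarrow> octonion) \<Rightarrow> shimada_point \<Rightarrow> shimada_point" where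
  "davis_action k = (\<lambda>(\<gamma>, g) p. SO2_act k \<gamma> (G2_act g p))"

definition P13_atlas :: "int \<Rightarrow> (shimada_point set, oct_pair) atlas" where
  "P13_atlas k = quotient_atlas T_involution (S13_atlas k)"


section \<open>Brieskorn varieties\<close>

text \<open>The coordinates \<open>z\<^sub>0, \<dots>, z\<^sub>7\<close> are indexed by the type \<open>8\<close>, as for octonions.\<close>

definition brieskorn :: "nat \<Rightarrow> (complex ^ 8) set" where
  "brieskorn d = {z. (z $ 0) ^ d + (\<Sum>i\<in>-{0}. (z $ i)\<^sup>2) = 0 \<and> (\<Sum>i\<in>UNIV. (cmod (z $ i))\<^sup>2) = 1}"

definition M13_atlas :: "int \<Rightarrow> (complex ^ 8, complex ^ 8) atlas" where
  "M13_atlas k = {(brieskorn (nat \<bar>k\<bar>), \<lambda>z. z)}"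

text \<open>
  Under the identification of \<open>e\<^bsup>i\<theta>\<^esup>\<close> with \<open>\<gamma>(cos \<theta>, - sin \<theta>)\<close>, the matrix \<open>\<gamma>(a, b)\<close> corresponds to
  \<open>a - i b\<close>. The matrix \<open>A \<in> SO(7)\<close> of an element \<open>g\<close> of \<open>G2\<close> has the entries \<open>g e\<^sub>j $ i\<close> for nonzero
  \<open>i\<close> and \<open>j\<close>.
\<close>

definition brieskorn_action ::
  "nat \<Rightarrow> (real ^ 2 ^ 2) \<times> (octonion \<Rightarrow> octonion) \<Rightarrow> complex ^ 8 \<Rightarrow> complex ^ 8" where
  "brieskorn_action d = (\<lambda>(\<gamma>, g) z.
     let \<zeta> = Complex (\<gamma> $ 1 $ 1) (- \<gamma> $ 1 $ 2)
     in (\<chi> i. if i = 0 then \<zeta> powi (- 2) * z $ 0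
              else \<zeta> powi (- int d) * (\<Sum>j\<in>-{0}. complex_of_real (g (axis j 1) $ i) * z $ j)))"

definition M13_action ::
  "int \<Rightarrow> (real ^ 2 ^ 2) \<times> (octonion \<Rightarrow> octonion) \<Rightarrow> complex ^ 8 \<Rightarrow> complex ^ 8" where
  "M13_action k = brieskorn_action (nat \<bar>k\<bar>)"

definition I_involution :: "complex ^ 8 \<Rightarrow> complex ^ 8" where
  "I_involution z = (\<chi> i. if i = 0 then z $ 0 else - z $ i)"

definition N13_atlas :: "int \<Rightarrow> ((complex ^ 8) set, complex ^ 8) atlas" where
  "N13_atlas k = quotient_atlas I_involution (M13_atlas k)"

end

theory Submission
  imports Defs
begin

text \<open>
  On the locus \<open>Re v = Re (u v) = 0\<close>, the vector \<open>v\<close> anticommutes with \<open>Im u\<close>, so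
  \<open>u\<^sup>m v u\<^sup>n / |u|\<^bsup>m+n\<^esup>\<close> becomes \<open>(u / |u|)\<^sup>k v\<close>, and conjugating \<open>u\<close> replaces \<open>k\<close> by \<open>- k\<close>; put \<open>d = |k|\<close>.
  In \<open>\<complex> \<otimes> \<O>\<close> the element \<open>1 + i u\<close> satisfies
  \<open>1 + i (\<gamma> \<star> u) = (a + i b) (1 + i u) (a - b u)\<^sup>-\<^sup>1\<close>, whence
  \<open>z\<^sub>0 = - N(1 + i u) / (1 + |u|\<^sup>2)\<close>, \<open>Z = (1 + i u)\<^sup>d v / (1 + |u|\<^sup>2)\<^bsup>d/2\<^esup>\<close> is an equivariant map to the
  affine variety \<open>z\<^sub>0\<^sup>d + Z \<bullet> Z = 0\<close>, where \<open>N\<close> is the complex bilinear norm. The weighted dilation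
  \<open>(\<mu> z\<^sub>0, \<mu>\<^bsup>d/2\<^esup> Z)\<close> moves its image onto the unit sphere; \<open>\<mu>\<close> depends only on the orbit parameter
  \<open>t = 4 |Im u|\<^sup>2 / (1 + |u|\<^sup>2)\<^sup>2\<close>. The map is inverted explicitly: \<open>z\<^sub>0\<close> determines \<open>Re u\<close> and \<open>|u|\<close>,
  the real and imaginary parts of \<open>Z\<close> span the same plane as \<open>v\<close> and \<open>(Im u) v\<close>, and
  \<open>((Im u) v) v = - Im u\<close>. In the second chart the same formula holds with \<open>- u'\<close> conjugated, followed
  by the action of \<open>\<gamma>(0, 1)\<close>.
\<close>

text \<open>The form 1 + i u is an eigenform of the rotation in homogeneous coordinates: with q = a
  u + b and p = a - b u one has p + i q = (a + i b)(1 + i u), and division by p gives the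
  transformation law. Two degenerate places dictate how the map is inverted. Where Re u = 0 and |u|
  = 1, that is t = 1, N(1 + i u) vanishes, so 1 + i u is a zero divisor and Z cannot be divided by
  its d-th power. Writing (1 + i u)^d v = E v + i F (Im u) v with complex scalars E and F gives
  instead a real linear system for v and (Im u) v, whose determinant Re (E cnj F) is a positive
  multiple of \<open>od 1 t d\<close> and never vanishes. Where Im u = 0, that is t = 0, there is no
  unit vector along Im u, so (Im u) v is recovered as a whole and |Im u| is never a divisor. As both
  ends of [0, 1] are attained, the profile functions have to be smooth beyond them. That the real
  vectors found in this way have the right lengths and angle is not built into the formulas; it is
  what the two equations of the variety say.\<close>

section \<open>Octonions\<close>

lemma UNIV_8: "(UNIV :: 8 set) = {0, 1, 2, 3, 4, 5, 6, 7}"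
proof -
  have "card {0, 1, 2, 3, 4, 5, 6, 7 :: 8} = CARD(8)"
    by simp
  then show ?thesis
    by (metis card_subset_eq finite_code subset_UNIV)
qed

lemma sum_8: "sum f (UNIV :: 8 set) = f 0 + f 1 + f 2 + f 3 + f 4 + f 5 + f 6 + f 7"
  unfolding UNIV_8 by (simp add: add.assoc)

lemma forall_8: "(\<forall>i::8. P i) \<longleftrightarrow> P 0 \<and> P 1 \<and> P 2 \<and> P 3 \<and> P 4 \<and> P 5 \<and> P 6 \<and> P 7"
  by (metis UNIV_8 UNIV_I insert_iff empty_iff)

lemma axis_nth_if: "axis i (c::real) $ j = (if j = i then c else 0)"
  by (simp add: axis_def)

text \<open>With the multiplication table in coordinates, the basic identities below become
  polynomial identities for \<open>algebra_simps\<close>.\<close>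

lemma omul_nth:
  fixes x y :: octonion
  shows
  "(x \<odot> y) $ 0 = x$0 * y$0 - x$1 * y$1 - x$2 * y$2 - x$3 * y$3 - x$4 * y$4 - x$5 * y$5 - x$6 * y$6 - x$7 * y$7"
  "(x \<odot> y) $ 1 = x$0 * y$1 + x$1 * y$0 + x$2 * y$3 - x$3 * y$2 + x$4 * y$5 - x$5 * y$4 - x$6 * y$7 + x$7 * y$6"
  "(x \<odot> y) $ 2 = x$0 * y$2 - x$1 * y$3 + x$2 * y$0 + x$3 * y$1 + x$4 * y$6 + x$5 * y$7 - x$6 * y$4 - x$7 * y$5"
  "(x \<odot> y) $ 3 = x$0 * y$3 + x$1 * y$2 - x$2 * y$1 + x$3 * y$0 + x$4 * y$7 - x$5 * y$6 + x$6 * y$5 - x$7 * y$4"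
  "(x \<odot> y) $ 4 = x$0 * y$4 - x$1 * y$5 - x$2 * y$6 - x$3 * y$7 + x$4 * y$0 + x$5 * y$1 + x$6 * y$2 + x$7 * y$3"
  "(x \<odot> y) $ 5 = x$0 * y$5 + x$1 * y$4 - x$2 * y$7 + x$3 * y$6 - x$4 * y$1 + x$5 * y$0 - x$6 * y$3 + x$7 * y$2"
  "(x \<odot> y) $ 6 = x$0 * y$6 + x$1 * y$7 + x$2 * y$4 - x$3 * y$5 - x$4 * y$2 + x$5 * y$3 + x$6 * y$0 - x$7 * y$1"
  "(x \<odot> y) $ 7 = x$0 * y$7 - x$1 * y$6 + x$2 * y$5 + x$3 * y$4 - x$4 * y$3 - x$5 * y$2 + x$6 * y$1 + x$7 * y$0"
  unfolding omul_def by (simp_all add: sum_8 basis_mul_def oct_triples_def oct_lines_def axis_nth_if)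

lemma oct_eq_iff:
  fixes x y :: "'a ^ 8"
  shows "x = y \<longleftrightarrow> x$0 = y$0 \<and> x$1 = y$1 \<and> x$2 = y$2 \<and> x$3 = y$3 \<and> x$4 = y$4 \<and> x$5 = y$5
      \<and> x$6 = y$6 \<and> x$7 = y$7"
  by (simp add: vec_eq_iff forall_8)

lemma inner_8:
  fixes x y :: octonion
  shows "x \<bullet> y = x$0 * y$0 + x$1 * y$1 + x$2 * y$2 + x$3 * y$3 + x$4 * y$4 + x$5 * y$5 + x$6 * y$6 + x$7 * y$7"
  by (simp add: inner_vec_def sum_8)

lemma ocnj_nth: "ocnj x $ i = (if i = 0 then x $ 0 else - x $ i)"
  by (simp add: ocnj_def)

lemma oone_nth: "oone $ i = (if i = 0 then 1 else 0)"
  by (simp add: oone_def axis_def)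

lemma omul_linear:
  "(x + x') \<odot> y = x \<odot> y + x' \<odot> y" "x \<odot> (y + y') = x \<odot> y + x \<odot> y'"
  "(c *\<^sub>R x) \<odot> y = c *\<^sub>R (x \<odot> y)" "x \<odot> (c *\<^sub>R y) = c *\<^sub>R (x \<odot> y)"
  by (simp_all add: oct_eq_iff omul_nth algebra_simps)

lemma bounded_bilinear_omul: "bounded_bilinear (\<odot>)"
  unfolding bilinear_conv_bounded_bilinear[symmetric] bilinear_def
  by (auto intro!: linearI simp: omul_linear)

interpretation omul: bounded_bilinear "(\<odot>)"
  by (rule bounded_bilinear_omul)

lemma omul_one [simp]: "oone \<odot> x = x" "x \<odot> oone = x"
  by (simp_all add: oct_eq_iff omul_nth oone_nth)

text \<open>The alternative laws in cancellation form; they stand in for the missing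
  associativity.\<close>

lemma omul_ocnj_cancel:
  "ocnj x \<odot> (x \<odot> y) = (norm x)\<^sup>2 *\<^sub>R y" "(y \<odot> x) \<odot> ocnj x = (norm x)\<^sup>2 *\<^sub>R y"
  by (simp_all add: oct_eq_iff omul_nth ocnj_nth power2_norm_eq_inner inner_8 algebra_simps)

lemma omul_adjoint:
  "(x \<odot> y) \<bullet> z = y \<bullet> (ocnj x \<odot> z)" "(x \<odot> y) \<bullet> z = x \<bullet> (z \<odot> ocnj y)"
  by (simp_all add: omul_nth ocnj_nth inner_8 algebra_simps)

lemma ocnj_ocnj [simp]: "ocnj (ocnj x) = x"
  by (simp add: vec_eq_iff ocnj_nth)

lemma ocnj_linear: "ocnj (x + y) = ocnj x + ocnj y" "ocnj (c *\<^sub>R x) = c *\<^sub>R ocnj x"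
  "ocnj (- x) = - ocnj x" "ocnj (x - y) = ocnj x - ocnj y" "ocnj 0 = 0" "ocnj oone = oone"
  by (simp_all add: vec_eq_iff ocnj_nth oone_nth)

lemma norm_ocnj [simp]: "norm (ocnj x) = norm x"
  by (simp add: norm_eq_sqrt_inner inner_8 ocnj_nth)

lemma norm_omul: "norm (x \<odot> y) = norm x * norm y"
proof -
  have "(norm (x \<odot> y))\<^sup>2 = (norm x * norm y)\<^sup>2"
    by (simp add: power2_norm_eq_inner[of "x \<odot> y"] omul_adjoint(1) omul_ocnj_cancel power_mult_distrib)
       (simp add: power2_norm_eq_inner)
  then show ?thesis by (simp add: power2_eq_iff_nonneg)
qed

lemma ore_omul_ocnj: "ore (x \<odot> ocnj y) = x \<bullet> y"
  by (simp add: ore_def omul_nth inner_8 ocnj_nth)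

lemma omul_self: "x \<odot> x = (2 * x $ 0) *\<^sub>R x - (norm x)\<^sup>2 *\<^sub>R oone"
  by (simp add: oct_eq_iff omul_nth oone_nth power2_norm_eq_inner inner_8 algebra_simps)

lemma ocnj_omul: "ocnj (x \<odot> y) = ocnj y \<odot> ocnj x"
  by (simp add: oct_eq_iff omul_nth ocnj_nth algebra_simps)

definition oim :: "octonion \<Rightarrow> octonion" where
  "oim x = x - (x $ 0) *\<^sub>R oone"

lemma oim_nth: "oim x $ i = (if i = 0 then 0 else x $ i)"
  by (simp add: oim_def oone_nth)

lemma ocnj_eq: "ocnj x = (x $ 0) *\<^sub>R oone - oim x"
  by (simp add: vec_eq_iff ocnj_nth oone_nth oim_nth)

lemma norm2_oim: "(norm x)\<^sup>2 = (x $ 0)\<^sup>2 + (norm (oim x))\<^sup>2"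
  by (simp add: power2_norm_eq_inner inner_8 oim_nth) (simp add: power2_eq_square)

lemma ocnj_imag: "x $ 0 = 0 \<Longrightarrow> ocnj x = - x"
  by (simp add: vec_eq_iff ocnj_nth)

text \<open>Left multiplication by w is thus a complex structure up to the scale |w|. This makes all
  powers of 1 + i w computable with two scalar coefficients.\<close>

lemma imag_omul_imag:
  assumes "w $ 0 = 0"
  shows "w \<odot> (w \<odot> v) = - ((norm w)\<^sup>2 *\<^sub>R v)" "(v \<odot> w) \<odot> w = - ((norm w)\<^sup>2 *\<^sub>R v)"
  using omul_ocnj_cancel(1)[of w v] omul_ocnj_cancel(2)[of v w] assms
  by (simp_all add: ocnj_imag omul.minus_left omul.minus_right) (metis minus_minus)+

lemma imag_anticommute:
  assumes "w $ 0 = 0" "v $ 0 = 0" "w \<bullet> v = 0"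
  shows "v \<odot> w = - (w \<odot> v)"
proof -
  have "v \<odot> w + w \<odot> v = - 2 * (w \<bullet> v) *\<^sub>R oone"
    using assms(1,2) by (simp add: oct_eq_iff omul_nth oone_nth inner_8)
  with assms(3) show ?thesis by (simp add: eq_neg_iff_add_eq_0)
qed

text \<open>Moving a factor across the inner product leaves the square of an imaginary octonion,
  which is real, paired with an imaginary one.\<close>

lemma imag_omul_orth:
  assumes "w $ 0 = 0" "v $ 0 = 0" "w \<bullet> v = 0"
  shows "(w \<odot> v) $ 0 = 0" "(w \<odot> v) \<bullet> v = 0" "(w \<odot> v) \<bullet> w = 0"
proof -
  show "(w \<odot> v) $ 0 = 0"
    using assms by (simp add: omul_nth inner_8)
  show "(w \<odot> v) \<bullet> v = 0"
    by (simp add: omul_adjoint(2) ocnj_imag assms omul.minus_right omul_self)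
       (simp add: inner_8 oone_nth assms)
  show "(w \<odot> v) \<bullet> w = 0"
    by (simp add: omul_adjoint(1) ocnj_imag assms omul.minus_left omul_self)
       (simp add: inner_8 oone_nth assms)
qed

section \<open>Calculus of smooth maps\<close>

text \<open>Openness matters: derivatives are taken in the whole space, so the functions must agree
  on a neighbourhood of each point.\<close>

lemma Ck_on_cong:
  assumes "open S" "\<And>x. x \<in> S \<Longrightarrow> f x = g x"
  shows "Ck_on n f S \<longleftrightarrow> Ck_on n g S"
  using assms(2)
proof (induction n arbitrary: f g)
  case 0
  then show ?case by (simp cong: continuous_on_cong)
next
  case (Suc n)
  have der: "(f has_derivative D) (at x) \<longleftrightarrow> (g has_derivative D) (at x)" if "x \<in> S" for x D
    using has_derivative_transform_within_open[OF _ assms(1) that, of f D UNIV g]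
      has_derivative_transform_within_open[OF _ assms(1) that, of g D UNIV f] Suc.prems by auto
  then have "f differentiable (at x) \<longleftrightarrow> g differentiable (at x)" if "x \<in> S" for x
    using that by (simp add: differentiable_def)
  moreover have "frechet_derivative f (at x) v = frechet_derivative g (at x) v" if "x \<in> S" for x v
    using der[OF that] by (simp add: frechet_derivative_def)
  then have "Ck_on n (\<lambda>x. frechet_derivative f (at x) v) S \<longleftrightarrow> Ck_on n (\<lambda>x. frechet_derivative g (at x) v) S" for v
    by (intro Suc.IH) simp
  ultimately show ?case by simp
qed

text \<open>Replaces \<open>frechet_derivative\<close> by any explicit formula valid on the open
  set. The closure properties below are inductions on the order through this rule.\<close>

lemma Ck_on_SucI:
  assumes "open S" "\<And>x. x \<in> S \<Longrightarrow> (f has_derivative (\<lambda>v. f' v x)) (at x)"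
    "\<And>v. Ck_on n (f' v) S"
  shows "Ck_on (Suc n) f S"
proof -
  have "frechet_derivative f (at x) v = f' v x" if "x \<in> S" for x v
    using frechet_derivative_at[OF assms(2)[OF that]] by (metis)
  then have "Ck_on n (\<lambda>x. frechet_derivative f (at x) v) S" for v
    using Ck_on_cong[OF assms(1), of "\<lambda>x. frechet_derivative f (at x) v" "f' v"] assms(3) by simp
  then show ?thesis
    using assms(2) by (auto simp: differentiable_def)
qed

lemma Ck_on_has_derivative:
  "Ck_on (Suc n) f S \<Longrightarrow> x \<in> S \<Longrightarrow> (f has_derivative (\<lambda>v. frechet_derivative f (at x) v)) (at x)"
  by (simp add: frechet_derivative_works[symmetric])

lemma Ck_on_derivative: "Ck_on (Suc n) f S \<Longrightarrow> Ck_on n (\<lambda>x. frechet_derivative f (at x) v) S"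
  by simp

text \<open>The product rule leaves one factor undifferentiated, so its order has to drop by one
  before an induction hypothesis applies.\<close>

lemma Ck_on_lower: "Ck_on (Suc n) f S \<Longrightarrow> Ck_on n f S"
proof (induction n arbitrary: f)
  case 0
  then show ?case
    by (auto intro!: continuous_at_imp_continuous_on differentiable_imp_continuous_within)
qed auto

lemma Ck_on_imp_continuous_on: "Ck_on n f S \<Longrightarrow> continuous_on S f"
  by (induction n) (auto intro!: continuous_at_imp_continuous_on differentiable_imp_continuous_within)

lemma Ck_on_subset: "Ck_on n f S \<Longrightarrow> T \<subseteq> S \<Longrightarrow> Ck_on n f T"
  by (induction n arbitrary: f) (auto intro: continuous_on_subset)

lemma Ck_on_const: "open S \<Longrightarrow> Ck_on n (\<lambda>x. c) S"
proof (induction n arbitrary: c)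
  case (Suc n)
  then show ?case by (intro Ck_on_SucI[where f' = "\<lambda>v x. 0"]) auto
qed simp

lemma Ck_on_linear:
  assumes "bounded_linear L" "open S"
  shows "Ck_on n L S"
proof (cases n)
  case 0
  then show ?thesis using assms by (simp add: linear_continuous_on)
next
  case (Suc m)
  show ?thesis unfolding Suc
    by (rule Ck_on_SucI[where f' = "\<lambda>v x. L v"])
      (use assms in \<open>auto intro: bounded_linear_imp_has_derivative Ck_on_const\<close>)
qed

lemma Ck_on_linear_compose:
  assumes "bounded_linear L" "open S" "Ck_on n f S"
  shows "Ck_on n (\<lambda>x. L (f x)) S"
  using assms(3)
proof (induction n arbitrary: f)
  case 0
  then show ?case using assms(1)
    by (simp add: bounded_linear.continuous_on)
next
  case (Suc n)
  show ?case
    by (rule Ck_on_SucI[where f' = "\<lambda>v x. L (frechet_derivative f (at x) v)"])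
      (use assms(1,2) Suc in \<open>auto intro!: bounded_linear.has_derivative[OF assms(1)] Ck_on_has_derivative simp del: Ck_on.simps dest: Ck_on_derivative\<close>)
qed

lemma Ck_on_add:
  assumes "open S" "Ck_on n f S" "Ck_on n g S"
  shows "Ck_on n (\<lambda>x. f x + g x) S"
  using assms(2,3)
proof (induction n arbitrary: f g)
  case 0
  then show ?case by (simp add: continuous_on_add)
next
  case (Suc n)
  show ?case
    by (rule Ck_on_SucI[where f' = "\<lambda>v x. frechet_derivative f (at x) v + frechet_derivative g (at x) v"])
      (use assms(1) Suc in \<open>auto intro!: has_derivative_add Ck_on_has_derivative simp del: Ck_on.simps dest: Ck_on_derivative\<close>)
qed

lemma Ck_on_bilinear:
  assumes "bounded_bilinear pr" "open S" "Ck_on n f S" "Ck_on n g S"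
  shows "Ck_on n (\<lambda>x. pr (f x) (g x)) S"
  using assms(3,4)
proof (induction n arbitrary: f g)
  case 0
  then show ?case using assms(1)
    by (simp add: bounded_bilinear.continuous_on)
next
  case (Suc n)
  show ?case
  proof (rule Ck_on_SucI[where f' = "\<lambda>v x. pr (f x) (frechet_derivative g (at x) v) + pr (frechet_derivative f (at x) v) (g x)"])
    fix x assume "x \<in> S"
    then show "((\<lambda>x. pr (f x) (g x)) has_derivative
        (\<lambda>v. pr (f x) (frechet_derivative g (at x) v) + pr (frechet_derivative f (at x) v) (g x))) (at x)"
      using Suc.prems by (intro bounded_bilinear.FDERIV[OF assms(1)] Ck_on_has_derivative)
  next
    fix v
    show "Ck_on n (\<lambda>x. pr (f x) (frechet_derivative g (at x) v) + pr (frechet_derivative f (at x) v) (g x)) S"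
      by (intro Ck_on_add[OF assms(2)] Suc.IH Ck_on_lower[OF Suc.prems(1)] Ck_on_lower[OF Suc.prems(2)]
          Ck_on_derivative[OF Suc.prems(1)] Ck_on_derivative[OF Suc.prems(2)])
  qed (rule assms(2))
qed

text \<open>For a real inner function the chain rule is a product of two scalars, one of which is
  again a composition with \<open>f\<close>; so the induction varies only \<open>h\<close>.\<close>

lemma Ck_on_compose_real:
  fixes h :: "real \<Rightarrow> real"
  assumes "open S" "open I" "Ck_on n h I" "Ck_on n f S" "f ` S \<subseteq> I"
  shows "Ck_on n (\<lambda>x. h (f x)) S"
  using assms(3,4)
proof (induction n arbitrary: h)
  case 0
  then show ?case using assms(5) by (simp add: continuous_on_compose2)
next
  case (Suc n)
  have lin: "frechet_derivative h (at y) w = w * frechet_derivative h (at y) 1" if "y \<in> I" for y w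
  proof -
    interpret linear "frechet_derivative h (at y)"
      using Ck_on_has_derivative[OF Suc.prems(1) that] by (auto dest: has_derivative_linear)
    show ?thesis using scale[of w 1] by simp
  qed
  show ?case
  proof (rule Ck_on_SucI[where f' = "\<lambda>v x. frechet_derivative f (at x) v * frechet_derivative h (at (f x)) 1"])
    fix x assume x: "x \<in> S"
    then have "f x \<in> I" using assms(5) by auto
    show "((\<lambda>x. h (f x)) has_derivative (\<lambda>v. frechet_derivative f (at x) v * frechet_derivative h (at (f x)) 1)) (at x)"
      using has_derivative_compose[OF Ck_on_has_derivative[OF Suc.prems(2) x] Ck_on_has_derivative[OF Suc.prems(1) \<open>f x \<in> I\<close>]]
      by (subst (asm) lin[OF \<open>f x \<in> I\<close>])
  next
    fix v
    show "Ck_on n (\<lambda>x. frechet_derivative f (at x) v * frechet_derivative h (at (f x)) 1) S"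
      by (rule Ck_on_bilinear[OF bounded_bilinear_mult assms(1) Ck_on_derivative[OF Suc.prems(2)]
            Suc.IH[OF Ck_on_derivative[OF Suc.prems(1)] Ck_on_lower[OF Suc.prems(2)]]])
  qed (rule assms(1))
qed

lemma Ck_on_inverse: "Ck_on n (inverse :: real \<Rightarrow> real) (- {0})"
proof (induction n)
  case 0
  then show ?case by (auto intro!: continuous_intros)
next
  case (Suc n)
  have op: "open (- {0::real})" by auto
  show ?case
  proof (rule Ck_on_SucI[where f' = "\<lambda>v x. (- v) * (inverse x * inverse x)"])
    fix x :: real assume "x \<in> - {0}"
    then show "(inverse has_derivative (\<lambda>v. - v * (inverse x * inverse x))) (at x)"
      using has_derivative_inverse'[of x UNIV] by (simp add: algebra_simps)
  next
    fix v :: real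
    show "Ck_on n (\<lambda>x. - v * (inverse x * inverse x)) (- {0})"
      by (intro Ck_on_bilinear[OF bounded_bilinear_mult] op Suc Ck_on_const)
  qed (rule op)
qed

text \<open>Each derivative lowers the exponent, hence the induction for all \<open>a\<close> at
  once.\<close>

lemma Ck_on_powr: "Ck_on n (\<lambda>x::real. x powr a) {0<..}"
proof (induction n arbitrary: a)
  case 0
  then show ?case by (auto intro!: continuous_intros)
next
  case (Suc n)
  have op: "open {0::real <..}" by auto
  show ?case
  proof (rule Ck_on_SucI[where f' = "\<lambda>v x. (v * a) * x powr (a - 1)"])
    fix x :: real assume "x \<in> {0<..}"
    then have "((\<lambda>x. x powr a) has_field_derivative a * x powr (a - 1)) (at x)"
      by (auto intro!: has_real_derivative_powr)
    then show "((\<lambda>x. x powr a) has_derivative (\<lambda>v. v * a * x powr (a - 1))) (at x)"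
      by (rule has_derivative_eq_rhs[OF has_field_derivative_imp_has_derivative]) (simp add: fun_eq_iff)
  next
    fix v :: real
    show "Ck_on n (\<lambda>x. v * a * x powr (a - 1)) {0<..}"
      by (intro Ck_on_bilinear[OF bounded_bilinear_mult] op Suc Ck_on_const)
  qed (rule op)
qed

section \<open>Closure properties of smooth functions\<close>

lemma smooth_on_imp_continuous_on: "smooth_on f S \<Longrightarrow> continuous_on S f"
  unfolding smooth_on_def using Ck_on_imp_continuous_on by blast

lemma smooth_on_subset: "smooth_on f S \<Longrightarrow> T \<subseteq> S \<Longrightarrow> smooth_on f T"
  unfolding smooth_on_def using Ck_on_subset by blast

lemma smooth_on_const: "open S \<Longrightarrow> smooth_on (\<lambda>x. c) S"
  unfolding smooth_on_def by (simp add: Ck_on_const)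

lemma smooth_on_linear: "bounded_linear L \<Longrightarrow> open S \<Longrightarrow> smooth_on L S"
  unfolding smooth_on_def by (simp add: Ck_on_linear)

lemma smooth_on_linear_compose:
  "bounded_linear L \<Longrightarrow> open S \<Longrightarrow> smooth_on f S \<Longrightarrow> smooth_on (\<lambda>x. L (f x)) S"
  unfolding smooth_on_def by (simp add: Ck_on_linear_compose)

lemma smooth_on_add: "open S \<Longrightarrow> smooth_on f S \<Longrightarrow> smooth_on g S \<Longrightarrow> smooth_on (\<lambda>x. f x + g x) S"
  unfolding smooth_on_def by (simp add: Ck_on_add)

lemma smooth_on_minus: "open S \<Longrightarrow> smooth_on f S \<Longrightarrow> smooth_on (\<lambda>x. - f x) S"
  by (rule smooth_on_linear_compose[OF bounded_linear_minus[OF bounded_linear_ident]])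

lemma smooth_on_diff: "open S \<Longrightarrow> smooth_on f S \<Longrightarrow> smooth_on g S \<Longrightarrow> smooth_on (\<lambda>x. f x - g x) S"
  using smooth_on_add[of S f "\<lambda>x. - g x"] by (simp add: smooth_on_minus)

lemma smooth_on_sum:
  assumes "open S" "\<And>i. i \<in> I \<Longrightarrow> smooth_on (f i) S"
  shows "smooth_on (\<lambda>x. \<Sum>i\<in>I. f i x) S"
  using assms(2) by (induction I rule: infinite_finite_induct)
    (auto intro: smooth_on_const smooth_on_add assms(1))

lemma smooth_on_bilinear:
  "bounded_bilinear pr \<Longrightarrow> open S \<Longrightarrow> smooth_on f S \<Longrightarrow> smooth_on g S
    \<Longrightarrow> smooth_on (\<lambda>x. pr (f x) (g x)) S"
  unfolding smooth_on_def by (simp add: Ck_on_bilinear)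

lemmas smooth_on_mult = smooth_on_bilinear[OF bounded_bilinear_mult]
lemmas smooth_on_scaleR = smooth_on_bilinear[OF bounded_bilinear_scaleR]
lemmas smooth_on_inner = smooth_on_bilinear[OF bounded_bilinear_inner]

lemma smooth_on_power:
  fixes f :: "'e::euclidean_space \<Rightarrow> 'b::{euclidean_space, real_normed_algebra_1}"
  shows "open S \<Longrightarrow> smooth_on f S \<Longrightarrow> smooth_on (\<lambda>x. f x ^ n) S"
  by (induction n) (auto intro: smooth_on_const smooth_on_mult)

lemma smooth_on_compose_real:
  fixes h :: "real \<Rightarrow> real"
  shows "open S \<Longrightarrow> open I \<Longrightarrow> smooth_on h I \<Longrightarrow> smooth_on f S \<Longrightarrow> f ` S \<subseteq> I \<Longrightarrow> smooth_on (\<lambda>x. h (f x)) S"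
  unfolding smooth_on_def by (simp add: Ck_on_compose_real)

lemma smooth_on_inverse:
  fixes f :: "'e::euclidean_space \<Rightarrow> real"
  assumes "open S" "smooth_on f S" "\<And>x. x \<in> S \<Longrightarrow> f x \<noteq> 0"
  shows "smooth_on (\<lambda>x. inverse (f x)) S"
  by (rule smooth_on_compose_real[where I = "- {0}"])
    (use assms in \<open>auto simp: smooth_on_def Ck_on_inverse\<close>)

lemma smooth_on_divide:
  fixes f :: "'e::euclidean_space \<Rightarrow> real"
  assumes "open S" "smooth_on f S" "smooth_on g S" "\<And>x. x \<in> S \<Longrightarrow> g x \<noteq> 0"
  shows "smooth_on (\<lambda>x. f x / g x) S"
  unfolding divide_inverse by (intro smooth_on_mult smooth_on_inverse assms)

lemma smooth_on_powr:
  fixes f :: "'e::euclidean_space \<Rightarrow> real"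
  assumes "open S" "smooth_on f S" "\<And>x. x \<in> S \<Longrightarrow> f x > 0"
  shows "smooth_on (\<lambda>x. f x powr a) S"
  by (rule smooth_on_compose_real[where I = "{0<..}" and h = "\<lambda>x. x powr a"])
    (use assms in \<open>auto simp: smooth_on_def Ck_on_powr\<close>)

lemma smooth_on_componentwise:
  fixes f :: "'e::euclidean_space \<Rightarrow> 'f::euclidean_space"
  assumes "open S" "\<And>b. b \<in> Basis \<Longrightarrow> smooth_on (\<lambda>x. f x \<bullet> b) S"
  shows "smooth_on f S"
proof -
  have "smooth_on (\<lambda>x. \<Sum>b\<in>Basis. (f x \<bullet> b) *\<^sub>R b) S"
    by (intro smooth_on_sum smooth_on_scaleR smooth_on_const assms)
  then show ?thesis by (simp add: euclidean_representation)
qed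

lemma smooth_on_Pair:
  assumes "open S" "smooth_on f S" "smooth_on g S"
  shows "smooth_on (\<lambda>x. (f x, g x)) S"
proof -
  have "smooth_on (\<lambda>x. (f x, 0) + (0, g x)) S"
    by (intro smooth_on_add smooth_on_linear_compose[of "\<lambda>y. (y, 0)"] smooth_on_linear_compose[of "\<lambda>y. (0, y)"] assms)
      (auto intro!: bounded_linear_Pair bounded_linear_ident bounded_linear_zero)
  then show ?thesis by simp
qed

lemma smooth_on_vec:
  fixes f :: "'e::euclidean_space \<Rightarrow> 'b::euclidean_space ^ 'n"
  assumes "open S" "\<And>i. smooth_on (\<lambda>x. f x $ i) S"
  shows "smooth_on f S"
proof (rule smooth_on_componentwise[OF assms(1)])
  fix b :: "'b ^ 'n" assume "b \<in> Basis"
  then obtain i u where b: "b = axis i u" by (auto simp: Basis_vec_def)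
  show "smooth_on (\<lambda>x. f x \<bullet> b) S"
    unfolding b inner_axis by (intro smooth_on_inner smooth_on_const assms)
qed

lemma smooth_on_complex:
  fixes f :: "'e::euclidean_space \<Rightarrow> complex"
  assumes "open S" "smooth_on (\<lambda>x. Re (f x)) S" "smooth_on (\<lambda>x. Im (f x)) S"
  shows "smooth_on f S"
  by (rule smooth_on_componentwise) (use assms in \<open>auto simp: Basis_complex_def\<close>)

text \<open>Bootstrapping: the derivative of the inverse g is 1 / (f' o g), so g of order n makes
  its derivative of order n, and g of order n + 1. Openness of the image comes from invariance of
  domain.\<close>

lemma smooth_on_inverse_function:
  fixes f :: "real \<Rightarrow> real"
  assumes I: "open I" "is_interval I" and f: "smooth_on f I"
    and der: "\<And>x. x \<in> I \<Longrightarrow> (f has_real_derivative f' x) (at x)" "\<And>x. x \<in> I \<Longrightarrow> f' x \<noteq> 0"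
    and inj: "inj_on f I"
  shows "open (f ` I)" "smooth_on (inv_into I f) (f ` I)"
proof -
  define g where "g = inv_into I f"
  have cont: "continuous_on I f" by (rule smooth_on_imp_continuous_on[OF f])
  show op: "open (f ` I)" by (rule invariance_of_domain[OF cont I(1) inj])
  have gf: "g (f x) = x" if "x \<in> I" for x using that inj by (simp add: g_def)
  have frech: "frechet_derivative f (at x) 1 = f' x" if "x \<in> I" for x
    using frechet_derivative_at[OF der(1)[OF that, unfolded has_field_derivative_def]] by (metis mult.right_neutral)
  have smf': "Ck_on n (\<lambda>x. frechet_derivative f (at x) 1) I" for n
    using f unfolding smooth_on_def by (metis Ck_on_derivative)
  have derg: "(g has_derivative (\<lambda>v. v * inverse (frechet_derivative f (at (g y)) 1))) (at y)" if y: "y \<in> f ` I" for y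
  proof -
    obtain x where x: "x \<in> I" "y = f x" using y by blast
    have "(g has_derivative (\<lambda>v. v * inverse (f' x))) (at (f x))"
      by (rule has_derivative_inverse_strong[where f' = "\<lambda>v. f' x * v", OF I(1) x(1) cont gf])
        (use der x in \<open>auto simp: has_field_derivative_def fun_eq_iff\<close>)
    with x frech gf show ?thesis by simp
  qed
  have "Ck_on n g (f ` I)" for n
  proof (induction n)
    case 0
    have "continuous_on (f ` I) g"
      by (rule continuous_at_imp_continuous_on) (blast intro: has_derivative_continuous[OF derg])
    then show ?case by simp
  next
    case (Suc n)
    have gI: "g ` f ` I \<subseteq> I" using gf by auto
    show ?case
    proof (rule Ck_on_SucI[where f' = "\<lambda>v y. v * inverse (frechet_derivative f (at (g y)) 1)", OF op derg])
      fix v :: real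
      have "Ck_on n (\<lambda>y. frechet_derivative f (at (g y)) 1) (f ` I)"
        by (rule Ck_on_compose_real[OF op I(1) smf' Suc gI])
      then have "Ck_on n (\<lambda>y. inverse (frechet_derivative f (at (g y)) 1)) (f ` I)"
        by (rule Ck_on_compose_real[OF op open_delete[OF open_UNIV, of 0, folded Compl_eq_Diff_UNIV] Ck_on_inverse]) (use gI der(2) frech in \<open>auto simp: gf\<close>)
      then show "Ck_on n (\<lambda>y. v * inverse (frechet_derivative f (at (g y)) 1)) (f ` I)"
        by (intro Ck_on_bilinear[OF bounded_bilinear_mult] op Ck_on_const)
    qed
  qed
  then show "smooth_on (inv_into I f) (f ` I)" by (simp add: smooth_on_def g_def)
qed

section \<open>The normalizing profile functions\<close>

text \<open>In the ring obtained by adjoining \<open>X\<close> with \<open>X\<^sup>2 = w\<close>, the pair \<open>eo s w n = (e, o)\<close> records \<open>(s + X)\<^sup>n = e + o X\<close>.\<close>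

primrec eo :: "'a::comm_ring_1 \<Rightarrow> 'a \<Rightarrow> nat \<Rightarrow> 'a \<times> 'a" where
  "eo s w 0 = (1, 0)"
| "eo s w (Suc n) = (s * fst (eo s w n) + w * snd (eo s w n), fst (eo s w n) + s * snd (eo s w n))"

abbreviation "ev s w n \<equiv> fst (eo s w n)"
abbreviation "od s w n \<equiv> snd (eo s w n)"

text \<open>The norm (e + o X)(e - o X) of the quadratic extension is multiplicative.\<close>

lemma ev_od_norm: "(ev s w n)\<^sup>2 - w * (od s w n)\<^sup>2 = (s\<^sup>2 - w) ^ n"
proof (induction n)
  case (Suc n)
  have "(ev s w (Suc n))\<^sup>2 - w * (od s w (Suc n))\<^sup>2 = (s\<^sup>2 - w) * ((ev s w n)\<^sup>2 - w * (od s w n)\<^sup>2)"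
    by (simp add: power2_eq_square algebra_simps)
  then show ?case using Suc by simp
qed simp

text \<open>Both are polynomials in t with nonnegative integer coefficients. The last bound is what
  later keeps the determinant \<open>D0\<close> away from 0.\<close>

lemma ev_od_real_pos:
  assumes "t \<ge> (0::real)"
  shows "ev 1 t n \<ge> 1" "od 1 t n \<ge> 0" "n > 0 \<Longrightarrow> od 1 t n \<ge> 1"
proof -
  have *: "ev 1 t n \<ge> 1 \<and> od 1 t n \<ge> 0 \<and> (n > 0 \<longrightarrow> od 1 t n \<ge> 1)"
  proof (induction n)
    case (Suc n)
    then have "t * od 1 t n \<ge> 0" using assms by simp
    then show ?case using Suc by auto
  qed simp
  then show "ev 1 t n \<ge> 1" "od 1 t n \<ge> 0" "n > 0 \<Longrightarrow> od 1 t n \<ge> 1" by auto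
qed

text \<open>The derivatives stay hidden behind the existential, as only their continuity and their
  sign matter later. The two sequences are treated together because the recursion mixes
  them.\<close>

lemma ev_od_derivative:
  "\<exists>a b :: real \<Rightarrow> real. continuous_on UNIV a \<and> continuous_on UNIV b \<and>
     (\<forall>t. ((\<lambda>t. ev 1 t n) has_real_derivative a t) (at t) \<and> ((\<lambda>t. od 1 t n) has_real_derivative b t) (at t)) \<and>
     (\<forall>t\<ge>0. a t \<ge> 0 \<and> b t \<ge> 0)"
proof (induction n)
  case 0
  show ?case by (intro exI[of _ "\<lambda>_. 0"]) auto
next
  case (Suc n)
  then obtain a b where ab: "continuous_on UNIV a" "continuous_on UNIV b"
    "\<And>t. ((\<lambda>t. ev 1 t n) has_real_derivative a t) (at t)" "\<And>t. ((\<lambda>t. od 1 t n) has_real_derivative b t) (at t)"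
    "\<And>t. t \<ge> 0 \<Longrightarrow> a t \<ge> 0" "\<And>t. t \<ge> 0 \<Longrightarrow> b t \<ge> 0" by blast
  have "continuous_on UNIV (\<lambda>t::real. od 1 t n)"
    using ab(4) by (intro continuous_at_imp_continuous_on ballI DERIV_isCont) blast
  then show ?case
    using ab ev_od_real_pos(2)[of _ n]
    by (intro exI[of _ "\<lambda>t. a t + (od 1 t n + t * b t)"] exI[of _ "\<lambda>t. a t + b t"])
      (auto intro!: continuous_intros derivative_eq_intros)
qed

lemma smooth_on_ev_od:
  fixes s w :: "'e::euclidean_space \<Rightarrow> 'b::{euclidean_space, real_normed_field}"
  assumes "open S" "smooth_on s S" "smooth_on w S"
  shows "smooth_on (\<lambda>x. ev (s x) (w x) n) S" "smooth_on (\<lambda>x. od (s x) (w x) n) S"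
proof -
  have "smooth_on (\<lambda>x. ev (s x) (w x) n) S \<and> smooth_on (\<lambda>x. od (s x) (w x) n) S"
    by (induction n) (auto intro!: smooth_on_const smooth_on_add smooth_on_mult assms)
  then show "smooth_on (\<lambda>x. ev (s x) (w x) n) S" "smooth_on (\<lambda>x. od (s x) (w x) n) S" by auto
qed

lemma derivative_pos_imp_less:
  fixes f :: "real \<Rightarrow> real"
  assumes "is_interval I" "\<And>x. x \<in> I \<Longrightarrow> (f has_real_derivative f' x) (at x)" "\<And>x. x \<in> I \<Longrightarrow> f' x > 0"
    "x \<in> I" "y \<in> I" "x < y"
  shows "f x < f y"
proof (rule DERIV_pos_imp_increasing[OF assms(6)])
  fix z assume "x \<le> z" "z \<le> y"
  then have "z \<in> I" using assms(1,4,5) by (meson mem_is_interval_1_I)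
  then show "\<exists>m. (f has_real_derivative m) (at z) \<and> 0 < m" using assms(2,3) by blast
qed

text \<open>With P = \<open>ev 1 t n\<close>, the expression P + c (1 - t) P' is, up to a positive
  factor, minus the derivative of (1 - t) P^(-c). It is positive on [0, 1], hence on a slightly
  larger open interval; room is needed at both ends because the orbit parameter attains 0 and
  1.\<close>

lemma ev_pos_interval:
  fixes c :: real
  assumes "c > 0"
  obtains p' :: "real \<Rightarrow> real" and l r where "l < 0" "1 < r"
    "\<And>t. ((\<lambda>t. ev 1 t n) has_real_derivative p' t) (at t)"
    "\<And>t. l < t \<Longrightarrow> t < r \<Longrightarrow> ev 1 t n > 0 \<and> ev 1 t n + c * (1 - t) * p' t > 0"
proof -
  obtain p' :: "real \<Rightarrow> real" where p': "continuous_on UNIV p'"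
    "\<And>t. ((\<lambda>t. ev 1 t n) has_real_derivative p' t) (at t)" "\<And>t. t \<ge> 0 \<Longrightarrow> p' t \<ge> 0"
    using ev_od_derivative[of n] by blast
  have cont: "continuous_on UNIV (\<lambda>t::real. ev 1 t n)"
    using p'(2) by (intro continuous_at_imp_continuous_on ballI DERIV_isCont) blast
  define U where "U = {t::real. ev 1 t n > 0} \<inter> {t. ev 1 t n + c * (1 - t) * p' t > 0}"
  have "open U"
    unfolding U_def by (intro open_Int open_Collect_less continuous_intros cont p'(1))
  have sub: "t \<in> U" if "0 \<le> t" "t \<le> 1" for t
  proof -
    have "c * (1 - t) * p' t \<ge> 0" using that p'(3)[of t] assms by simp
    then show ?thesis using ev_od_real_pos(1)[OF that(1), of n] by (auto simp: U_def)
  qed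
  obtain e0 where e0: "e0 > 0" "ball 0 e0 \<subseteq> U" using \<open>open U\<close> sub[of 0] by (auto simp: open_contains_ball)
  obtain e1 where e1: "e1 > 0" "ball 1 e1 \<subseteq> U" using \<open>open U\<close> sub[of 1] by (auto simp: open_contains_ball)
  show ?thesis
  proof (rule that[of "- e0" "1 + e1" p'])
    fix t assume t: "- e0 < t" "t < 1 + e1"
    have "t \<in> U"
    proof (cases "t < 0 \<or> t > 1")
      case True
      then have "t \<in> ball 0 e0 \<or> t \<in> ball 1 e1" using t by (auto simp: dist_real_def)
      then show ?thesis using e0(2) e1(2) by blast
    qed (use sub in auto)
    then show "ev 1 t n > 0 \<and> ev 1 t n + c * (1 - t) * p' t > 0" by (simp add: U_def)
  qed (use e0 e1 p' in auto)
qed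

text \<open>
  With \<open>P = ev 1 t d\<close>, the equation \<open>m\<^sup>2 (1 - t) + m\<^sup>d P = 1\<close> is solved in terms of \<open>A = m\<^sup>2 (1 - t)\<close>:
  eliminating \<open>m\<close> leaves \<open>A (1 - A)\<^bsup>-2/d\<^esup> = (1 - t) P\<^bsup>-2/d\<^esup>\<close>, where both sides are strictly monotone
  functions of one variable, so only inverse functions in one variable are needed.
\<close>

lemma profile_exists:
  assumes d: "d > (0::nat)"
  obtains m n s :: "real \<Rightarrow> real" and T X where "open T" "{0..1} \<subseteq> T" "smooth_on m T" "\<And>t. t \<in> T \<Longrightarrow> m t > 0"
    "open X" "smooth_on n X" "\<And>A. A \<in> X \<Longrightarrow> n A > 0"
    "\<And>t. 0 \<le> t \<Longrightarrow> t \<le> 1 \<Longrightarrow> (m t)\<^sup>2 * (1 - t) + m t ^ d * ev 1 t d = 1"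
    "\<And>t. 0 \<le> t \<Longrightarrow> t \<le> 1 \<Longrightarrow> (m t)\<^sup>2 * (1 - t) \<in> X \<and> n ((m t)\<^sup>2 * (1 - t)) = m t"
    "\<And>A. 0 \<le> A \<Longrightarrow> A < 1 \<Longrightarrow> A ^ d \<le> (1 - A)\<^sup>2 \<Longrightarrow>
       A \<in> X \<and> 0 \<le> s A \<and> s A \<le> 1 \<and> m (s A) = n A \<and> (n A)\<^sup>2 * (1 - s A) = A \<and> n A ^ d * ev 1 (s A) d = 1 - A"
proof -
  define P where "P = (\<lambda>t::real. ev 1 t d)"
  obtain p' l r where lr: "l < 0" "1 < r" and p': "\<And>t. (P has_real_derivative p' t) (at t)"
    and pos: "\<And>t. l < t \<Longrightarrow> t < r \<Longrightarrow> P t > 0 \<and> P t + 2 / d * (1 - t) * p' t > 0"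
    using ev_pos_interval[of "2 / d" d] d unfolding P_def by (metis divide_pos_pos of_nat_0_less_iff zero_less_numeral)
  have smP: "smooth_on P S" if "open S" for S
    unfolding P_def using that by (intro smooth_on_ev_od smooth_on_const smooth_on_linear bounded_linear_ident)
  define I where "I = {l<..<r}"
  \<comment> \<open>The left end -1 keeps the factor 1 - A (1 - 2/d) of \<open>j'\<close> positive
    even for d = 1, where it is 1 + A. The point 0 has to be interior because A = 0 at t =
    1.\<close>
  define J where "J = {-1<..<1::real}"
  define f where "f = (\<lambda>t. (1 - t) * P t powr (- 2 / d))"
  define j where "j = (\<lambda>A::real. A * (1 - A) powr (- 2 / d))"
  have IJ: "open I" "is_interval I" "open J" "is_interval J" by (auto simp: I_def J_def is_interval_oo)
  have Ppos: "P t > 0" if "t \<in> I" for t using pos that by (auto simp: I_def)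
  have Pnz: "P t \<noteq> 0" if "t \<in> I" for t using Ppos[OF that] by simp
  have smf: "smooth_on f I"
    unfolding f_def
    by (intro smooth_on_mult smooth_on_diff smooth_on_powr smP smooth_on_const smooth_on_linear bounded_linear_ident IJ)
      (rule Ppos)
  have smj: "smooth_on j J"
    unfolding j_def
    by (intro smooth_on_mult smooth_on_diff smooth_on_powr smooth_on_const smooth_on_linear bounded_linear_ident IJ)
      (auto simp: J_def)
  define f' where "f' = (\<lambda>t. - (P t powr (- 2 / d - 1) * (P t + 2 / d * (1 - t) * p' t)))"
  define j' where "j' = (\<lambda>A::real. (1 - A) powr (- 2 / d - 1) * (1 - A * (1 - 2 / d)))"
  have derf: "(f has_real_derivative f' t) (at t)" if "t \<in> I" for t
  proof -
    have "P t powr (- 2 / d) = P t powr (- 2 / d - 1) * P t"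
      using Ppos[OF that] by (simp add: powr_diff)
    then show ?thesis
      unfolding f_def f'_def using Ppos[OF that]
      by (auto intro!: derivative_eq_intros p' simp: algebra_simps diff_divide_distrib)
  qed
  have derj: "(j has_real_derivative j' A) (at A)" if "A \<in> J" for A
  proof -
    have "1 - A > 0" using that by (simp add: J_def)
    then have "(1 - A) powr (- 2 / d) = (1 - A) powr (- 2 / d - 1) * (1 - A)"
      by (simp add: powr_diff)
    then show ?thesis
      unfolding j_def j'_def using \<open>1 - A > 0\<close>
      by (auto intro!: derivative_eq_intros simp: algebra_simps diff_divide_distrib)
  qed
  have f'neg: "f' t < 0" if "t \<in> I" for t
    unfolding f'_def using pos[of t] that by (auto simp: I_def)
  have j'pos: "j' A > 0" if "A \<in> J" for A
  proof -
    have "\<bar>1 - 2 / real d\<bar> \<le> 1" using d by (auto simp: abs_le_iff field_simps)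
    then have "\<bar>A * (1 - 2 / real d)\<bar> \<le> \<bar>A\<bar>" by (simp add: abs_mult mult_left_le)
    then have "1 - A * (1 - 2 / real d) > 0" using that by (auto simp: J_def abs_if split: if_splits)
    then show ?thesis using that by (auto simp: j'_def J_def)
  qed
  have monf: "f y < f x" if "x \<in> I" "y \<in> I" "x < y" for x y
    using derivative_pos_imp_less[of I "\<lambda>t. - f t" "\<lambda>t. - f' t" x y] IJ derf f'neg that
    by (auto intro: derivative_intros)
  have monj: "j x < j y" if "x \<in> J" "y \<in> J" "x < y" for x y
    using derivative_pos_imp_less[of J j j' x y] IJ derj j'pos that by auto
  have injf: "inj_on f I" by (rule linorder_inj_onI) (use monf in force)+
  have injj: "inj_on j J" by (rule linorder_inj_onI) (use monj in force)+
  have opf: "open (f ` I)" and smfi: "smooth_on (inv_into I f) (f ` I)"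
    using smooth_on_inverse_function[OF IJ(1,2) smf derf _ injf] f'neg by force+
  have opj: "open (j ` J)" and smji: "smooth_on (inv_into J j) (j ` J)"
    using smooth_on_inverse_function[OF IJ(3,4) smj derj _ injj] j'pos by force+
  have contf: "continuous_on I f" by (rule smooth_on_imp_continuous_on[OF smf])
  have contj: "continuous_on J j" by (rule smooth_on_imp_continuous_on[OF smj])
  \<comment> \<open>On \<open>T\<close> the equation \<open>j A = f t\<close> is solved for A by
    \<open>a\<close>, on \<open>X\<close> it is solved for t by \<open>s\<close>.\<close>
  define T where "T = {t \<in> I. f t \<in> j ` J}"
  define X where "X = {A \<in> J. j A \<in> f ` I}"
  define a where "a = (\<lambda>t. inv_into J j (f t))"
  define s where "s = (\<lambda>A. inv_into I f (j A))"
  define m where "m = (\<lambda>t. ((1 - a t) / P t) powr (1 / d))"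
  define n where "n = (\<lambda>A. ((1 - A) / P (s A)) powr (1 / d))"
  have T: "open T" unfolding T_def
    using continuous_open_preimage[OF contf IJ(1) opj] by (simp add: Int_def vimage_def)
  have X: "open X" unfolding X_def
    using continuous_open_preimage[OF contj IJ(3) opf] by (simp add: Int_def vimage_def)
  have sma: "smooth_on a T" unfolding a_def
    by (rule smooth_on_compose_real[OF T opj smji]) (auto intro: smooth_on_subset[OF smf] simp: T_def)
  have sms: "smooth_on s X" unfolding s_def
    by (rule smooth_on_compose_real[OF X opf smfi]) (auto intro: smooth_on_subset[OF smj] simp: X_def)
  have aJ: "a t \<in> J" "j (a t) = f t" if "t \<in> T" for t
    using that by (auto simp: a_def T_def inv_into_into f_inv_into_f)
  have sI: "s A \<in> I" "f (s A) = j A" if "A \<in> X" for A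
    using that by (auto simp: s_def X_def inv_into_into f_inv_into_f)
  have quot_pos: "(1 - a t) / P t > 0" if "t \<in> T" for t
    using aJ[OF that] Ppos[of t] that by (auto simp: J_def T_def)
  have quot_pos': "(1 - A) / P (s A) > 0" if "A \<in> X" for A
    using sI[OF that] Ppos[of "s A"] that by (auto simp: J_def X_def)
  have mpos: "m t > 0" if "t \<in> T" for t unfolding m_def powr_gt_zero using quot_pos[OF that] by (metis less_irrefl)
  have npos: "n A > 0" if "A \<in> X" for A unfolding n_def powr_gt_zero using quot_pos'[OF that] by (metis less_irrefl)
  have smm: "smooth_on m T" unfolding m_def
    by (intro smooth_on_powr T smooth_on_divide smooth_on_diff smooth_on_const sma smP)
      (use quot_pos Pnz in \<open>auto simp: T_def\<close>)
  have smPs: "smooth_on (\<lambda>A. P (s A)) X"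
    by (rule smooth_on_compose_real[OF X open_UNIV smP sms]) auto
  have smn: "smooth_on n X" unfolding n_def
    by (intro smooth_on_powr X smooth_on_divide smooth_on_diff smooth_on_const smooth_on_linear bounded_linear_ident smPs)
      (use quot_pos' Pnz sI in \<open>auto\<close>)
  \<comment> \<open>The choice of M gives M^d P = 1 - A at once. Then M^2 (1 - t) = (1 - A)^(2/d)
    \<open>f t\<close>, and replacing \<open>f t\<close> by \<open>j A\<close> leaves A.\<close>
  have key: "M ^ d * P t = 1 - A \<and> M\<^sup>2 * (1 - t) = A"
    if "A < 1" "P t > 0" "j A = f t" and M: "M = ((1 - A) / P t) powr (1 / d)" for A t M
  proof
    have "M ^ d = (1 - A) / P t"
      unfolding M using that d by (simp add: powr_power)
    then show "M ^ d * P t = 1 - A" using that by simp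
    have "M\<^sup>2 = (1 - A) powr (2 / d) * P t powr (- 2 / d)"
    proof -
      have "M\<^sup>2 = ((1 - A) / P t) powr (2 / d)"
        unfolding M using that d by (simp add: powr_power)
      also have "\<dots> = (1 - A) powr (2 / d) / P t powr (2 / d)"
        using that by (simp add: powr_divide)
      finally show ?thesis by (simp add: powr_minus_divide)
    qed
    then have "M\<^sup>2 * (1 - t) = (1 - A) powr (2 / d) * f t" by (simp add: f_def)
    also have "\<dots> = A" using that by (simp add: j_def powr_minus flip: that(3))
    finally show "M\<^sup>2 * (1 - t) = A" .
  qed
  have f01: "f 0 = 1" "f 1 = 0"
    using ev_od_norm[of "1::real" 0 d] ev_od_real_pos(1)[of 0 d]
    by (auto simp: f_def P_def power2_eq_1_iff)
  have j0: "j 0 = 0" by (simp add: j_def)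
  have subI: "{0..1} \<subseteq> I" using lr by (auto simp: I_def)
  have frange: "0 \<le> f t \<and> f t \<le> 1" if "0 \<le> t" "t \<le> 1" for t
  proof -
    have "0 \<in> I" "1 \<in> I" "t \<in> I" using subI that by auto
    then show ?thesis using monf[of 0 t] monf[of t 1] f01 that by (cases "t = 0"; cases "t = 1") auto
  qed
  have surj_j: "\<exists>A\<in>J. 0 \<le> A \<and> j A = y" if "0 \<le> y" "y \<le> 1" for y
  proof -
    \<comment> \<open>With 1 - B = 4^(-d) the power (1 - B)^(-2/d) is 16, so \<open>j B\<close> = 16
      B is at least 12 and the intermediate value theorem reaches every y in [0, 1].\<close>
    define B where "B = 1 - (1 / 4 :: real) ^ d"
    have B: "3 / 4 \<le> B" "B < 1" using power_decreasing[of 1 d "1 / 4 :: real"] d by (auto simp: B_def)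
    have "(1 - B) powr (- 2 / d) = (1 / 4) powr (real d * (- 2 / d))"
      by (simp add: B_def powr_powr flip: powr_realpow)
    also have "\<dots> = 16" using d by (simp add: powr_minus power2_eq_square)
    finally have "j B \<ge> 1" using B by (simp add: j_def)
    then have "\<exists>A\<ge>0. A \<le> B \<and> j A = y"
      using that j0 B by (intro IVT') (auto intro!: continuous_on_subset[OF contj] simp: J_def)
    with B have "\<exists>A\<ge>0. A < 1 \<and> j A = y" by force
    then show ?thesis by (force simp: J_def)
  qed
  have T01: "{0..1} \<subseteq> T"
  proof
    fix t :: real assume "t \<in> {0..1}"
    then show "t \<in> T" using subI frange[of t] surj_j[of "f t"] unfolding T_def by force
  qed
  have fwd: "m t ^ d * P t = 1 - a t \<and> (m t)\<^sup>2 * (1 - t) = a t" if "t \<in> T" for t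
    by (rule key) (use aJ[OF that] Ppos that in \<open>auto simp: m_def J_def T_def\<close>)
  have aX: "a t \<in> X \<and> s (a t) = t \<and> n (a t) = m t" if "t \<in> T" for t
  proof -
    have tI: "t \<in> I" using that by (simp add: T_def)
    then have "s (a t) = t" using aJ[OF that] injf by (simp add: s_def)
    then show ?thesis using aJ[OF that] tI by (auto simp: X_def n_def m_def)
  qed
  show ?thesis
  proof (rule that[of T m X n s, OF T T01 smm mpos X smn npos])
    fix t :: real assume "0 \<le> t" "t \<le> 1"
    then have t: "t \<in> T" using T01 by auto
    show "(m t)\<^sup>2 * (1 - t) + m t ^ d * ev 1 t d = 1"
      using fwd[OF t] by (simp add: P_def)
    show "(m t)\<^sup>2 * (1 - t) \<in> X \<and> n ((m t)\<^sup>2 * (1 - t)) = m t"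
      using fwd[OF t] aX[OF t] by simp
  next
    fix A :: real assume A: "0 \<le> A" "A < 1" "A ^ d \<le> (1 - A)\<^sup>2"
    have AJ: "A \<in> J" using A by (simp add: J_def)
    have "0 \<le> j A" using A by (simp add: j_def)
    \<comment> \<open>Taking d-th roots in the assumption gives A \<le> (1 - A)^(2/d), which says
      that \<open>j A\<close> does not exceed 1 = \<open>f 0\<close>.\<close>
    have "j A \<le> 1"
    proof -
      have "(A ^ d) powr (1 / d) \<le> ((1 - A)\<^sup>2) powr (1 / d)"
        using A by (intro powr_mono2) auto
      moreover have "(A ^ d) powr (1 / d) = A"
      proof (cases "A = 0")
        case False
        then have "A ^ d = A powr real d" using A by (simp add: powr_realpow)
        then show ?thesis using A d by (simp add: powr_powr)
      qed (use d in simp)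
      moreover have "((1 - A)\<^sup>2) powr (1 / d) = (1 - A) powr (2 / d)"
      proof -
        have "(1 - A)\<^sup>2 = (1 - A) powr 2" using A by simp
        then show ?thesis by (simp only: powr_powr) simp
      qed
      ultimately show ?thesis using A by (simp add: j_def powr_minus field_simps)
    qed
    obtain t where t: "0 \<le> t" "t \<le> 1" "f t = j A"
      using IVT2'[of f 1 "j A" 0] f01 \<open>0 \<le> j A\<close> \<open>j A \<le> 1\<close> continuous_on_subset[OF contf subI] by auto
    then have tI: "t \<in> I" using subI by auto
    have sA: "s A = t" using injf tI t(3) by (simp add: s_def flip: t(3))
    have AX: "A \<in> X" using AJ tI t(3) by (force simp: X_def)
    have tT: "t \<in> T" using t T01 by auto
    have "a t = A" using t(3) AJ injj by (simp add: a_def)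
    then show "A \<in> X \<and> 0 \<le> s A \<and> s A \<le> 1 \<and> m (s A) = n A \<and> (n A)\<^sup>2 * (1 - s A) = A \<and> n A ^ d * ev 1 (s A) d = 1 - A"
      using AX fwd[OF tT] aX[OF tT] t sA by (simp add: P_def)
  qed
qed

section \<open>Powers of complexified left multiplication\<close>

definition cspan2 :: "complex \<Rightarrow> complex \<Rightarrow> octonion \<Rightarrow> octonion \<Rightarrow> complex ^ 8" where
  "cspan2 a b p q = (\<chi> i. a * of_real (p $ i) + b * of_real (q $ i))"

lemma sum_cspan2_square:
  "(\<Sum>i\<in>UNIV. (cspan2 a b p q $ i)\<^sup>2) = a\<^sup>2 * of_real (p \<bullet> p) + 2 * a * b * of_real (p \<bullet> q) + b\<^sup>2 * of_real (q \<bullet> q)"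
  by (simp add: cspan2_def inner_vec_def power2_eq_square algebra_simps sum.distrib sum_distrib_left)

lemma sum_cspan2_cmod:
  "(\<Sum>i\<in>UNIV. (cmod (cspan2 a b p q $ i))\<^sup>2) =
     (cmod a)\<^sup>2 * (p \<bullet> p) + 2 * Re (a * cnj b) * (p \<bullet> q) + (cmod b)\<^sup>2 * (q \<bullet> q)"
proof -
  have "(cmod (cspan2 a b p q $ i))\<^sup>2 = (cmod a)\<^sup>2 * (p $ i * p $ i) + 2 * Re (a * cnj b) * (p $ i * q $ i) + (cmod b)\<^sup>2 * (q $ i * q $ i)" for i
    unfolding cmod_power2 by (simp add: cspan2_def power2_eq_square algebra_simps)
  then show ?thesis
    by (simp add: inner_vec_def sum.distrib sum_distrib_left)
qed

text \<open>Let conjugation fix X. Then (s + X)(cnj s + X) = Q + 2 X = Q (1 + Y), where Y = 2 X / Q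
  has square t = 4 w / Q^2. Comparing coefficients in the n-th powers gives both formulas; the
  recursions for \<open>H\<close> and \<open>R\<close> carry this out.\<close>

lemma ev_od_hermitian:
  fixes s :: complex and w :: real
  assumes s: "Re s = 1" and Q: "Q = (cmod s)\<^sup>2 + w" "Q \<noteq> 0"
  shows "(cmod (ev s (of_real w) n))\<^sup>2 + w * (cmod (od s (of_real w) n))\<^sup>2 = Q ^ n * ev 1 (4 * w / Q\<^sup>2) n"
    "Q * Re (ev s (of_real w) n * cnj (od s (of_real w) n)) = Q ^ n * od 1 (4 * w / Q\<^sup>2) n"
proof -
  define t where "t = 4 * w / Q\<^sup>2"
  define E where "E = (\<lambda>n. ev s (of_real w) n)"
  define O' where "O' = (\<lambda>n. od s (of_real w) n)"
  define H where "H = (\<lambda>n. (cmod (E n))\<^sup>2 + w * (cmod (O' n))\<^sup>2)"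
  define R where "R = (\<lambda>n. Re (E n * cnj (O' n)))"
  have H: "H (Suc n) = Q * H n + 4 * w * R n" and R: "R (Suc n) = H n + Q * R n" for n
    unfolding H_def R_def Q(1) cmod_power2 by (simp_all add: E_def O'_def s power2_eq_square algebra_simps)
  have wt: "4 * w = t * Q * Q" using Q(2) by (simp add: t_def power2_eq_square)
  have "H n = Q ^ n * ev 1 t n \<and> Q * R n = Q ^ n * od 1 t n"
  proof (induction n)
    case 0
    show ?case by (simp add: H_def R_def E_def O'_def)
  next
    case (Suc n)
    have "H (Suc n) = Q * H n + t * Q * (Q * R n)" unfolding H wt by (simp add: algebra_simps)
    moreover have "Q * R (Suc n) = Q * H n + Q * (Q * R n)" unfolding R by (simp add: algebra_simps)
    ultimately show ?case using Suc by (simp add: algebra_simps)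
  qed
  then show "(cmod (ev s (of_real w) n))\<^sup>2 + w * (cmod (od s (of_real w) n))\<^sup>2 = Q ^ n * ev 1 (4 * w / Q\<^sup>2) n"
    "Q * Re (ev s (of_real w) n * cnj (od s (of_real w) n)) = Q ^ n * od 1 (4 * w / Q\<^sup>2) n"
    by (simp_all add: H_def R_def E_def O'_def t_def)
qed

text \<open>Cramer's rule for z = E x + i F y with real unknowns x and y; the determinant is Re (E
  cnj F).\<close>

lemma cspan2_solve:
  assumes "Re (E * cnj F) \<noteq> 0"
  shows "E * of_real (Re (cnj F * z) / Re (E * cnj F)) + \<i> * F * of_real (Im (cnj E * z) / Re (E * cnj F)) = z"
proof -
  have "E * of_real (Re (cnj F * z)) + \<i> * F * of_real (Im (cnj E * z)) = z * of_real (Re (E * cnj F))"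
    by (simp add: complex_eq_iff algebra_simps)
  moreover have "complex_of_real (Re (E * cnj F)) \<noteq> 0" using assms by (simp del: times_complex.sel)
  ultimately show ?thesis
    by (simp add: field_simps del: times_complex.sel)
qed

text \<open>Here a, b, e stand for the Gram entries of two real vectors combined with coefficients E
  and i F, and the hypotheses prescribe the bilinear and the Hermitian square of the combination.
  Adding cnj F times the first equation to F times the second eliminates b; since i F cnj F is
  purely imaginary, a real part then isolates a.\<close>

lemma gram_unique:
  fixes E F :: complex and a b e w :: real
  assumes ne: "Re (E * cnj F) \<noteq> 0"
    and 1: "E\<^sup>2 * of_real a + 2 * E * (\<i> * F) * of_real e + (\<i> * F)\<^sup>2 * of_real b = E\<^sup>2 - of_real w * F\<^sup>2"
    and 2: "(cmod E)\<^sup>2 * a + 2 * Re (E * cnj (\<i> * F)) * e + (cmod (\<i> * F))\<^sup>2 * b = (cmod E)\<^sup>2 + w * (cmod F)\<^sup>2"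
  shows "a = 1" "b = w" "e = 0"
proof -
  have "F \<noteq> 0" "E \<noteq> 0" using ne by auto
  define D where "D = Re (E * cnj F)"
  have D2: "2 * complex_of_real D = E * cnj F + F * cnj E"
    unfolding D_def by (simp add: complex_eq_iff)
  have 3: "E * cnj E * of_real a + \<i> * (F * cnj E - E * cnj F) * of_real e + F * cnj F * of_real b
      = E * cnj E + of_real w * (F * cnj F)"
    using 2 unfolding cmod_power2 by (simp add: complex_eq_iff power2_eq_square algebra_simps)
  have *: "2 * of_real D * (E * of_real (a - 1) + \<i> * F * of_real e) * F = 0"
  proof -
    have "cnj F * (E\<^sup>2 * of_real a + 2 * E * (\<i> * F) * of_real e + (\<i> * F)\<^sup>2 * of_real b) +
       F * (E * cnj E * of_real a + \<i> * (F * cnj E - E * cnj F) * of_real e + F * cnj F * of_real b) =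
       cnj F * (E\<^sup>2 - of_real w * F\<^sup>2) + F * (E * cnj E + of_real w * (F * cnj F))"
      unfolding 1 3 ..
    then have "(E * cnj F + F * cnj E) * (E * of_real (a - 1) + \<i> * F * of_real e) = 0"
      by (simp add: power2_eq_square algebra_simps)
    then show ?thesis unfolding D2 by simp
  qed
  then have 4: "E * of_real (a - 1) + \<i> * F * of_real e = 0"
  proof -
    have "complex_of_real D \<noteq> 0" using ne unfolding D_def of_real_eq_0_iff .
    with * \<open>F \<noteq> 0\<close> show ?thesis by simp
  qed
  then have "Re (cnj F * (E * of_real (a - 1) + \<i> * F * of_real e)) = 0"
    by (simp only: mult_zero_right zero_complex.sel)
  then have "Re (E * cnj F) * (a - 1) = 0" by (simp add: algebra_simps)
  then show a: "a = 1" using ne by simp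
  then show e: "e = 0" using 4 \<open>F \<noteq> 0\<close> by simp
  show "b = w" using 1 a e \<open>F \<noteq> 0\<close> by (simp add: power_mult_distrib)
qed

text \<open>One condition for both charts: for an imaginary unit v, Re (u v) = - (u \<bullet> v) and
  Re (u v^(-1)) = u \<bullet> v.\<close>

definition locus :: "(octonion \<times> octonion) set" where
  "locus = {(x, v). norm v = 1 \<and> v $ 0 = 0 \<and> x \<bullet> v = 0}"

lemma oim_zero [simp]: "oim x $ 0 = 0" by (simp add: oim_nth)

lemma inner_oim: "v $ 0 = 0 \<Longrightarrow> oim x \<bullet> v = x \<bullet> v"
  by (simp add: inner_8 oim_nth)

lemma locusD:
  assumes "(x, v) \<in> locus"
  shows "v $ 0 = 0" "v \<bullet> v = 1" "norm v = 1" "oim x \<bullet> v = 0" "x \<bullet> v = 0" "(oim x \<odot> v) $ 0 = 0"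
    "v \<bullet> (oim x \<odot> v) = 0" "(oim x \<odot> v) \<bullet> (oim x \<odot> v) = (norm (oim x))\<^sup>2"
proof -
  show v: "v $ 0 = 0" "norm v = 1" "x \<bullet> v = 0" using assms by (auto simp: locus_def)
  then show "v \<bullet> v = 1" by (simp add: dot_square_norm)
  show w: "oim x \<bullet> v = 0" using v by (simp add: inner_oim)
  show "(oim x \<odot> v) $ 0 = 0" "v \<bullet> (oim x \<odot> v) = 0"
    using imag_omul_orth[of "oim x" v] v w by (simp_all add: inner_commute)
  show "(oim x \<odot> v) \<bullet> (oim x \<odot> v) = (norm (oim x))\<^sup>2"
    using v by (simp add: dot_square_norm norm_omul)
qed

text \<open>This is N(1 + i x) / (1 + |x|^2), written out in real and imaginary parts.\<close>

definition cayley :: "octonion \<Rightarrow> complex" where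
  "cayley x = Complex ((1 - (norm x)\<^sup>2) / (1 + (norm x)\<^sup>2)) (2 * x $ 0 / (1 + (norm x)\<^sup>2))"

definition orbit_par :: "octonion \<Rightarrow> real" where
  "orbit_par x = 4 * (norm (oim x))\<^sup>2 / (1 + (norm x)\<^sup>2)\<^sup>2"

text \<open>\<open>clift n x v\<close> is \<open>(1 + i L\<^sub>x)\<^sup>n v\<close>, where \<open>L\<^sub>x\<close> is left multiplication by \<open>x\<close>.\<close>

definition clift :: "nat \<Rightarrow> octonion \<Rightarrow> octonion \<Rightarrow> complex ^ 8" where
  "clift n x v = (let s = Complex 1 (x $ 0); w = of_real ((norm (oim x))\<^sup>2)
     in cspan2 (ev s w n) (\<i> * od s w n) v (oim x \<odot> v))"

lemma one_plus_norm2_pos [simp]: "1 + (norm x)\<^sup>2 > 0" "1 + (norm x)\<^sup>2 \<noteq> 0"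
  by (simp_all add: add_pos_nonneg add_nonneg_eq_0_iff)

lemma cmod_cayley: "(cmod (cayley x))\<^sup>2 = 1 - orbit_par x"
proof -
  have "(1 - (norm x)\<^sup>2)\<^sup>2 + (2 * x $ 0)\<^sup>2 = (1 + (norm x)\<^sup>2)\<^sup>2 - 4 * (norm (oim x))\<^sup>2"
    unfolding norm2_oim[of x] by (simp add: power2_eq_square algebra_simps)
  moreover have "(cmod (cayley x))\<^sup>2 = ((1 - (norm x)\<^sup>2)\<^sup>2 + (2 * x $ 0)\<^sup>2) / (1 + (norm x)\<^sup>2)\<^sup>2"
    unfolding cayley_def cmod_power2 complex.sel power_divide add_divide_distrib ..
  ultimately show ?thesis
    by (simp add: orbit_par_def diff_divide_distrib)
qed

lemma orbit_par_bounds: "0 \<le> orbit_par x" "orbit_par x \<le> 1"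
  using cmod_cayley[of x] zero_le_power2[of "cmod (cayley x)"] by (auto simp: orbit_par_def)

lemma cayley_square:
  "(Complex 1 (x $ 0))\<^sup>2 - of_real ((norm (oim x))\<^sup>2) = of_real (1 + (norm x)\<^sup>2) * cayley x"
proof -
  have "of_real (1 + (norm x)\<^sup>2) * cayley x = Complex (1 - (norm x)\<^sup>2) (2 * x $ 0)"
    unfolding complex_eq_iff cayley_def by (simp del: of_real_add)
  then show ?thesis
    using norm2_oim[of x] by (simp add: complex_eq_iff power2_eq_square)
qed

text \<open>The vectors v and (Im x) v are orthogonal, of lengths 1 and |Im x|. The factor i in
  front of \<open>od\<close> turns the bilinear square into e^2 - w o^2 and the Hermitian one into
  |e|^2 + w |o|^2, which \<open>ev_od_norm\<close> and \<open>ev_od_hermitian\<close>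
  evaluate.\<close>

lemma clift_norms:
  assumes "(x, v) \<in> locus"
  shows "clift n x v $ 0 = 0"
    "(\<Sum>i\<in>UNIV. (clift n x v $ i)\<^sup>2) = (of_real (1 + (norm x)\<^sup>2) * cayley x) ^ n"
    "(\<Sum>i\<in>UNIV. (cmod (clift n x v $ i))\<^sup>2) = (1 + (norm x)\<^sup>2) ^ n * ev 1 (orbit_par x) n"
proof -
  note l = locusD[OF assms]
  show "clift n x v $ 0 = 0" using l by (simp add: clift_def cspan2_def Let_def)
  show "(\<Sum>i\<in>UNIV. (clift n x v $ i)\<^sup>2) = (of_real (1 + (norm x)\<^sup>2) * cayley x) ^ n"
    unfolding clift_def Let_def sum_cspan2_square l cayley_square[symmetric] ev_od_norm[symmetric]
    by (simp add: power_mult_distrib)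
  have "1 + (norm x)\<^sup>2 = (cmod (Complex 1 (x $ 0)))\<^sup>2 + (norm (oim x))\<^sup>2"
    unfolding norm2_oim[of x] by (simp add: cmod_power2)
  from ev_od_hermitian(1)[OF _ this, of n]
  show "(\<Sum>i\<in>UNIV. (cmod (clift n x v $ i))\<^sup>2) = (1 + (norm x)\<^sup>2) ^ n * ev 1 (orbit_par x) n"
    unfolding clift_def Let_def sum_cspan2_cmod l orbit_par_def
    by (simp add: norm_mult algebra_simps)
qed

section \<open>The map to the Brieskorn variety and its inverse\<close>

lemma sum_Compl_0: "(\<Sum>i\<in>-{0}. f (i::8)) = (\<Sum>i\<in>UNIV. f i) - (f 0 :: 'a::ab_group_add)"
  by (simp add: Compl_eq_Diff_UNIV sum_diff1)

lemma brieskorn_iff: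
  "z \<in> brieskorn d \<longleftrightarrow> (\<Sum>i\<in>-{0}. (z $ i)\<^sup>2) = - (z $ 0 ^ d) \<and> (\<Sum>i\<in>-{0}. (cmod (z $ i))\<^sup>2) = 1 - (cmod (z $ 0))\<^sup>2"
  unfolding brieskorn_def mem_Collect_eq sum_Compl_0
  by (auto simp: algebra_simps eq_neg_iff_add_eq_0)

lemma powr_half_square:
  assumes "q > (0::real)"
  shows "(q powr (real d / 2))\<^sup>2 = q ^ d"
  using assms by (simp add: powr_power powr_realpow)

text \<open>
  \<open>m t\<close> is the dilation factor \<open>\<mu>\<close> at the orbit parameter \<open>t\<close>; \<open>n\<close> and \<open>s\<close> recover \<open>\<mu>\<close> and \<open>t\<close> from
  \<open>|z\<^sub>0|\<^sup>2\<close> on the Brieskorn variety.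
\<close>

locale brieskorn_profile =
  fixes d :: nat and m n s :: "real \<Rightarrow> real" and T X :: "real set"
  assumes d_odd: "odd d"
    and T: "open T" "{0..1} \<subseteq> T" "smooth_on m T" "\<And>t. t \<in> T \<Longrightarrow> m t > 0"
    and X: "open X" "smooth_on n X" "\<And>A. A \<in> X \<Longrightarrow> n A > 0"
    and m_eq: "\<And>t. 0 \<le> t \<Longrightarrow> t \<le> 1 \<Longrightarrow> (m t)\<^sup>2 * (1 - t) + m t ^ d * ev 1 t d = 1"
    and n_m: "\<And>t. 0 \<le> t \<Longrightarrow> t \<le> 1 \<Longrightarrow> (m t)\<^sup>2 * (1 - t) \<in> X \<and> n ((m t)\<^sup>2 * (1 - t)) = m t"
    and n_eq: "\<And>A. 0 \<le> A \<Longrightarrow> A < 1 \<Longrightarrow> A ^ d \<le> (1 - A)\<^sup>2 \<Longrightarrow>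
       A \<in> X \<and> 0 \<le> s A \<and> s A \<le> 1 \<and> m (s A) = n A \<and> (n A)\<^sup>2 * (1 - s A) = A \<and> n A ^ d * ev 1 (s A) d = 1 - A"
begin

lemma d_pos: "d > 0"
  using d_odd by (rule odd_pos)

definition Phi :: "octonion \<times> octonion \<Rightarrow> complex ^ 8" where
  "Phi = (\<lambda>(x, v). \<chi> i. if i = 0 then - (of_real (m (orbit_par x)) * cayley x)
     else of_real ((m (orbit_par x) / (1 + (norm x)\<^sup>2)) powr (real d / 2)) * clift d x v $ i)"

text \<open>
  For \<open>z = Phi (x, v)\<close> the following quantities are \<open>den z = 2 \<mu> / (1 + |x|\<^sup>2)\<close>, \<open>re0 z = Re x\<close>,
  \<open>w0 z = |Im x|\<^sup>2\<close>, \<open>v0 z = v\<close> and \<open>y0 z = (Im x) v\<close>.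
\<close>

definition den :: "complex ^ 8 \<Rightarrow> real" where
  "den z = n ((cmod (z $ 0))\<^sup>2) - Re (z $ 0)"

definition re0 :: "complex ^ 8 \<Rightarrow> real" where
  "re0 z = - Im (z $ 0) / den z"

definition w0 :: "complex ^ 8 \<Rightarrow> real" where
  "w0 z = 2 * n ((cmod (z $ 0))\<^sup>2) / den z - 1 - (re0 z)\<^sup>2"

definition E0 :: "complex ^ 8 \<Rightarrow> complex" where
  "E0 z = ev (Complex 1 (re0 z)) (of_real (w0 z)) d"

definition F0 :: "complex ^ 8 \<Rightarrow> complex" where
  "F0 z = od (Complex 1 (re0 z)) (of_real (w0 z)) d"

text \<open>The determinant of the real 2 x 2 system that yields v and (Im x) v coordinate by
  coordinate.\<close>

definition D0 :: "complex ^ 8 \<Rightarrow> real" where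
  "D0 z = Re (E0 z * cnj (F0 z))"

definition v0 :: "complex ^ 8 \<Rightarrow> octonion" where
  "v0 z = (\<chi> i. if i = 0 then 0 else Re (cnj (F0 z) * (of_real ((2 / den z) powr (real d / 2)) * z $ i)) / D0 z)"

definition y0 :: "complex ^ 8 \<Rightarrow> octonion" where
  "y0 z = (\<chi> i. if i = 0 then 0 else Im (cnj (E0 z) * (of_real ((2 / den z) powr (real d / 2)) * z $ i)) / D0 z)"

definition Psi :: "complex ^ 8 \<Rightarrow> octonion \<times> octonion" where
  "Psi z = (re0 z *\<^sub>R oone - y0 z \<odot> v0 z, v0 z)"

text \<open>An open set of the whole ambient space, not only of the variety:
  \<open>smooth_map\<close> asks for a smooth extension, and the formulas of \<open>Psi\<close> are
  smooth here.\<close>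

definition Om :: "(complex ^ 8) set" where
  "Om = {z. (cmod (z $ 0))\<^sup>2 \<in> X \<and> den z > 0 \<and> D0 z \<noteq> 0}"

lemma m_orbit_par: "m (orbit_par x) > 0"
  using T(2,4) orbit_par_bounds[of x] by auto

text \<open>As d is odd, the affine equation would hold with any positive dilation factor in place
  of m; unit length is exactly \<open>m_eq\<close>.\<close>

lemma Phi_in_brieskorn:
  assumes "(x, v) \<in> locus"
  shows "Phi (x, v) \<in> brieskorn d"
proof -
  define t where "t = orbit_par x"
  define Q where "Q = 1 + (norm x)\<^sup>2"
  define r where "r = (m t / Q) powr (real d / 2)"
  have Q: "Q > 0" by (simp add: Q_def)
  have mt: "m t > 0" unfolding t_def by (rule m_orbit_par)
  have r2: "r\<^sup>2 = m t ^ d / Q ^ d"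
    unfolding r_def using Q mt by (subst powr_half_square) (auto simp: power_divide)
  have Z: "Phi (x, v) $ i = of_real r * clift d x v $ i" if "i \<noteq> 0" for i
    using that by (simp add: Phi_def r_def t_def Q_def)
  have z0: "Phi (x, v) $ 0 = - (of_real (m t) * cayley x)"
    by (simp add: Phi_def t_def)
  have "(\<Sum>i\<in>-{0}. (Phi (x, v) $ i)\<^sup>2) = (of_real r)\<^sup>2 * (\<Sum>i\<in>-{0}. (clift d x v $ i)\<^sup>2)"
    by (simp add: Z power_mult_distrib sum_distrib_left)
  also have "\<dots> = of_real (r\<^sup>2) * (of_real Q * cayley x) ^ d"
    unfolding sum_Compl_0 clift_norms[OF assms] by (simp add: Q_def)
  also have "\<dots> = - (Phi (x, v) $ 0 ^ d)"
    unfolding r2 z0 using Q d_odd by (simp add: power_mult_distrib)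
  finally have 1: "(\<Sum>i\<in>-{0}. (Phi (x, v) $ i)\<^sup>2) = - (Phi (x, v) $ 0 ^ d)" .
  have "(\<Sum>i\<in>-{0}. (cmod (Phi (x, v) $ i))\<^sup>2) = r\<^sup>2 * (\<Sum>i\<in>-{0}. (cmod (clift d x v $ i))\<^sup>2)"
    by (simp add: Z norm_mult power_mult_distrib sum_distrib_left)
  also have "\<dots> = r\<^sup>2 * (Q ^ d * ev 1 t d)"
    unfolding sum_Compl_0 clift_norms[OF assms] by (simp add: Q_def t_def)
  also have "\<dots> = m t ^ d * ev 1 t d"
    unfolding r2 using Q by simp
  also have "\<dots> = 1 - (m t)\<^sup>2 * (1 - t)"
    using m_eq[of t] orbit_par_bounds[of x] by (simp add: t_def)
  also have "\<dots> = 1 - (cmod (Phi (x, v) $ 0))\<^sup>2"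
    unfolding z0 by (simp add: norm_mult power_mult_distrib cmod_cayley t_def)
  finally show ?thesis using 1 by (simp add: brieskorn_iff)
qed

text \<open>By \<open>n_m\<close>, |z0|^2 determines m(t). Dividing it out of z0 gives
  \<open>cayley x\<close>, hence Re x and |x|; then E and F are known, and the linear system is
  solvable because \<open>od 1 t d\<close> is positive.\<close>

lemma Psi_Phi:
  assumes "(x, v) \<in> locus"
  shows "Phi (x, v) \<in> Om" "Psi (Phi (x, v)) = (x, v)"
proof -
  note l = locusD[OF assms]
  define z where "z = Phi (x, v)"
  define t where "t = orbit_par x"
  define Q where "Q = 1 + (norm x)\<^sup>2"
  define r where "r = (m t / Q) powr (real d / 2)"
  define w where "w = (norm (oim x))\<^sup>2"
  define y where "y = oim x \<odot> v"
  have Q: "Q > 0" by (simp add: Q_def)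
  have mt: "m t > 0" unfolding t_def by (rule m_orbit_par)
  have t: "0 \<le> t" "t \<le> 1" using orbit_par_bounds by (auto simp: t_def)
  have Z: "z $ i = of_real r * clift d x v $ i" if "i \<noteq> 0" for i
    using that by (simp add: z_def Phi_def r_def t_def Q_def)
  have z0: "z $ 0 = - (of_real (m t) * cayley x)"
    by (simp add: z_def Phi_def t_def)
  have A: "(cmod (z $ 0))\<^sup>2 = (m t)\<^sup>2 * (1 - t)"
    unfolding z0 by (simp add: norm_mult power_mult_distrib cmod_cayley t_def)
  have AX: "(cmod (z $ 0))\<^sup>2 \<in> X" and nA: "n ((cmod (z $ 0))\<^sup>2) = m t"
    using n_m[OF t] unfolding A by auto
  have rez: "Re (z $ 0) = - m t * (2 - Q) / Q" and imz: "Im (z $ 0) = - m t * (2 * x $ 0) / Q"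
    unfolding z0 by (simp_all add: cayley_def Q_def)
  have den: "den z = 2 * m t / Q"
    unfolding den_def nA rez using Q by (simp add: field_simps)
  have den_pos: "den z > 0" unfolding den using mt Q by simp
  have re0: "re0 z = x $ 0"
    unfolding re0_def den imz using mt Q by simp
  have w0: "w0 z = w"
    unfolding w0_def re0 nA den using mt Q norm2_oim[of x] by (simp add: w_def Q_def)
  have Qs: "Q = (cmod (Complex 1 (re0 z)))\<^sup>2 + w0 z"
    unfolding re0 w0 w_def Q_def norm2_oim[of x] by (simp add: cmod_power2)
  have tw: "t = 4 * w0 z / Q\<^sup>2" by (simp add: t_def orbit_par_def w0 w_def Q_def)
  have "Q * D0 z = Q ^ d * od 1 t d"
    using ev_od_hermitian(2)[OF _ Qs, of d] Q unfolding D0_def E0_def F0_def tw by simp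
  moreover have "Q ^ d * od 1 t d > 0"
    using Q ev_od_real_pos(3)[OF t(1) d_pos] by simp
  ultimately have "Q * D0 z > 0" by (simp only:)
  then have D0: "D0 z \<noteq> 0" by auto
  then show "Phi (x, v) \<in> Om"
    using AX den_pos by (simp add: Om_def z_def)
  have r1: "(2 / den z) powr (real d / 2) * r = 1"
    unfolding den r_def using Q mt by (simp flip: powr_mult)
  have Zi: "of_real ((2 / den z) powr (real d / 2)) * z $ i = E0 z * of_real (v $ i) + \<i> * F0 z * of_real (y $ i)" if "i \<noteq> 0" for i
  proof -
    have "of_real ((2 / den z) powr (real d / 2)) * z $ i = of_real ((2 / den z) powr (real d / 2) * r) * clift d x v $ i"
      unfolding Z[OF that] by simp
    also have "\<dots> = clift d x v $ i" unfolding r1 by simp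
    also have "\<dots> = E0 z * of_real (v $ i) + \<i> * F0 z * of_real (y $ i)"
      by (simp add: clift_def cspan2_def Let_def E0_def F0_def re0 w0 w_def y_def)
    finally show ?thesis .
  qed
  have v0: "v0 z = v"
  proof -
    have "Re (cnj (F0 z) * (E0 z * of_real (v $ i) + \<i> * F0 z * of_real (y $ i))) = D0 z * v $ i" for i
      by (simp add: D0_def algebra_simps)
    then show ?thesis using l(1) D0 by (auto simp: v0_def vec_eq_iff Zi)
  qed
  have y0: "y0 z = y"
  proof -
    have "Im (cnj (E0 z) * (E0 z * of_real (v $ i) + \<i> * F0 z * of_real (y $ i))) = D0 z * y $ i" for i
      by (simp add: D0_def algebra_simps)
    then show ?thesis using l(6) D0 by (auto simp: y0_def vec_eq_iff Zi y_def)
  qed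
  have "y \<odot> v = - oim x"
    unfolding y_def using imag_omul_imag(2)[of v "oim x"] l by simp
  then show "Psi (Phi (x, v)) = (x, v)"
    unfolding z_def[symmetric] Psi_def re0 v0 y0 by (simp add: oim_def)
qed

text \<open>The triangle inequality in z0^d = - Z \<bullet> Z gives |z0|^d \<le> |Z|^2 = 1 - |z0|^2.
  Squared, this is the hypothesis of \<open>n_eq\<close>, and it rules out |z0| = 1.\<close>

lemma brieskorn_cmod:
  assumes "z \<in> brieskorn d"
  shows "(cmod (z $ 0))\<^sup>2 < 1" "((cmod (z $ 0))\<^sup>2) ^ d \<le> (1 - (cmod (z $ 0))\<^sup>2)\<^sup>2"
proof -
  define B where "B = (\<Sum>i\<in>-{0}. (cmod (z $ i))\<^sup>2)"
  have z: "(\<Sum>i\<in>-{0}. (z $ i)\<^sup>2) = - (z $ 0 ^ d)" "B = 1 - (cmod (z $ 0))\<^sup>2"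
    using assms by (auto simp: brieskorn_iff B_def)
  have B: "B \<ge> 0" by (simp add: B_def sum_nonneg)
  have "cmod (z $ 0) ^ d = cmod (\<Sum>i\<in>-{0}. (z $ i)\<^sup>2)"
    unfolding z by (simp add: norm_power)
  also have "\<dots> \<le> B" unfolding B_def by (rule order_trans[OF norm_sum]) (simp add: norm_power)
  finally have le: "cmod (z $ 0) ^ d \<le> B" .
  have "((cmod (z $ 0))\<^sup>2) ^ d = (cmod (z $ 0) ^ d)\<^sup>2" by (simp add: power_mult[symmetric] mult.commute)
  also have "\<dots> \<le> B\<^sup>2" using le by (intro power_mono) auto
  finally show 2: "((cmod (z $ 0))\<^sup>2) ^ d \<le> (1 - (cmod (z $ 0))\<^sup>2)\<^sup>2" by (simp add: z)
  have "(cmod (z $ 0))\<^sup>2 \<noteq> 1" using 2 by auto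
  then show "(cmod (z $ 0))\<^sup>2 < 1" using B z by simp
qed

text \<open>A priori \<open>v0\<close> and \<open>y0\<close> only solve a linear system. The two
  equations of the variety determine their Gram matrix through \<open>gram_unique\<close>, so they
  are orthogonal of squared lengths 1 and \<open>w0\<close>, and x can be built from their
  product.\<close>

lemma Phi_Psi:
  assumes z: "z \<in> brieskorn d" and den_pos: "den z > 0"
  shows "Psi z \<in> locus" "Phi (Psi z) = z"
proof -
  define A where "A = (cmod (z $ 0))\<^sup>2"
  define t where "t = s A"
  define Q where "Q = 2 * n A / den z"
  define c where "c = - (z $ 0) / of_real (n A)"
  define q where "q = (2 / den z) powr (real d / 2)"
  define Z where "Z = (\<chi> i. if i = 0 then 0 else of_real q * z $ i)"
  have AX: "A \<in> X" and t: "0 \<le> t" "t \<le> 1" and mt: "m t = n A" and At: "(n A)\<^sup>2 * (1 - t) = A"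
    and nP: "n A ^ d * ev 1 t d = 1 - A"
    using n_eq[of A] brieskorn_cmod[OF z] by (auto simp: A_def t_def)
  have n_pos: "n A > 0" using X(3)[OF AX] .
  have Q: "Q > 0" using n_pos den_pos by (simp add: Q_def)
  have q2: "q\<^sup>2 = Q ^ d / n A ^ d"
    unfolding q_def using den_pos n_pos by (subst powr_half_square) (auto simp: Q_def power_divide power_mult_distrib)
  have den: "den z = 2 * n A / Q" using Q den_pos n_pos by (simp add: Q_def)
  have rez: "Re (z $ 0) = n A - den z" by (simp add: den_def A_def)
  have imz: "Im (z $ 0) = - re0 z * den z" using den_pos by (simp add: re0_def)
  have Rec: "Re c = 2 / Q - 1" unfolding c_def using n_pos by (simp add: rez den diff_divide_distrib)
  have Imc: "Im c = 2 * re0 z / Q" unfolding c_def using n_pos by (simp add: imz den)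
  have z0: "z $ 0 = - (of_real (n A) * c)" unfolding c_def using n_pos by simp
  have w0: "w0 z = Q - 1 - (re0 z)\<^sup>2" by (simp add: w0_def Q_def A_def)
  have cz: "cmod (z $ 0) = n A * cmod c" using n_pos by (subst z0) (simp add: norm_mult)
  have "A = (cmod (z $ 0))\<^sup>2" by (rule A_def)
  also have "\<dots> = (n A)\<^sup>2 * (cmod c)\<^sup>2" unfolding cz by (rule power_mult_distrib)
  finally have "A = (n A)\<^sup>2 * (cmod c)\<^sup>2" .
  with At have "(cmod c)\<^sup>2 = 1 - t" using n_pos by (metis mult_cancel_left power_not_zero less_irrefl)
  \<comment> \<open>As c will turn out to be \<open>cayley x\<close>, the relation |c|^2 = 1 - t has
    to become t Q^2 = 4 \<open>w0\<close>, the formula for the orbit parameter of the x still to be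
    constructed.\<close>
  then have "1 - t = (2 / Q - 1)\<^sup>2 + (2 * re0 z / Q)\<^sup>2" unfolding cmod_power2 Rec Imc by simp
  then have "(1 - t) * Q\<^sup>2 = (2 - Q)\<^sup>2 + (2 * re0 z)\<^sup>2"
    using Q by (simp add: power2_eq_square field_simps)
  then have "t * Q\<^sup>2 = 4 * w0 z"
    unfolding w0 by (simp add: power2_eq_square algebra_simps)
  then have tw: "t = 4 * w0 z / Q\<^sup>2" using Q by (simp add: field_simps)
  have w0_nn: "w0 z \<ge> 0" using \<open>t * Q\<^sup>2 = 4 * w0 z\<close> t mult_nonneg_nonneg[OF t(1), of "Q\<^sup>2"] by simp
  have Qs: "Q = (cmod (Complex 1 (re0 z)))\<^sup>2 + w0 z" unfolding w0 by (simp add: cmod_power2)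
  have Q0: "Q \<noteq> 0" using Q by simp
  have herm: "(cmod (E0 z))\<^sup>2 + w0 z * (cmod (F0 z))\<^sup>2 = Q ^ d * ev 1 t d" "Q * D0 z = Q ^ d * od 1 t d"
    using ev_od_hermitian[OF _ Qs Q0, of d] unfolding D0_def E0_def F0_def tw by simp_all
  have "Q ^ d * od 1 t d > 0"
    using Q ev_od_real_pos(3)[OF t(1) d_pos] by simp
  then have "Q * D0 z > 0" by (simp only: herm)
  then have D0: "D0 z \<noteq> 0" by auto
  have "(Complex 1 (re0 z))\<^sup>2 - of_real (w0 z) = of_real Q * c"
    unfolding w0 using Q by (simp add: complex_eq_iff Rec Imc power2_eq_square field_simps)
  then have EF: "(E0 z)\<^sup>2 - of_real (w0 z) * (F0 z)\<^sup>2 = (of_real Q * c) ^ d"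
    unfolding E0_def F0_def by (subst ev_od_norm) simp
  have Zc: "Z = cspan2 (E0 z) (\<i> * F0 z) (v0 z) (y0 z)"
  proof -
    have "Z $ i = cspan2 (E0 z) (\<i> * F0 z) (v0 z) (y0 z) $ i" for i
    proof (cases "i = 0")
      case False
      then have "cspan2 (E0 z) (\<i> * F0 z) (v0 z) (y0 z) $ i = of_real q * z $ i"
        using cspan2_solve[OF D0[unfolded D0_def], of "of_real q * z $ i"]
        by (simp add: cspan2_def v0_def y0_def q_def D0_def del: times_complex.sel)
      then show ?thesis using False by (simp add: Z_def)
    qed (simp add: Z_def cspan2_def v0_def y0_def)
    then show ?thesis by (simp add: vec_eq_iff)
  qed
  have "(\<Sum>i\<in>UNIV. (Z $ i)\<^sup>2) = (\<Sum>i\<in>-{0}. (Z $ i)\<^sup>2)" by (subst sum_Compl_0) (simp add: Z_def)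
  also have "\<dots> = of_real (q\<^sup>2) * (\<Sum>i\<in>-{0}. (z $ i)\<^sup>2)"
    by (simp add: Z_def power_mult_distrib sum_distrib_left)
  also have "\<dots> = of_real (q\<^sup>2) * (of_real (n A) * c) ^ d"
    using z d_odd by (simp add: brieskorn_iff z0)
  also have "\<dots> = (of_real Q * c) ^ d" unfolding q2 using n_pos by (simp add: power_mult_distrib)
  finally have ZZ: "(\<Sum>i\<in>UNIV. (Z $ i)\<^sup>2) = (E0 z)\<^sup>2 - of_real (w0 z) * (F0 z)\<^sup>2" unfolding EF .
  have "(\<Sum>i\<in>UNIV. (cmod (Z $ i))\<^sup>2) = (\<Sum>i\<in>-{0}. (cmod (Z $ i))\<^sup>2)" by (subst sum_Compl_0) (simp add: Z_def)
  also have "\<dots> = q\<^sup>2 * (\<Sum>i\<in>-{0}. (cmod (z $ i))\<^sup>2)"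
    by (simp add: Z_def norm_mult power_mult_distrib sum_distrib_left)
  also have "\<dots> = q\<^sup>2 * (n A ^ d * ev 1 t d)"
    using z nP by (simp add: brieskorn_iff A_def)
  also have "\<dots> = Q ^ d * ev 1 t d" unfolding q2 using n_pos by simp
  finally have ZH: "(\<Sum>i\<in>UNIV. (cmod (Z $ i))\<^sup>2) = (cmod (E0 z))\<^sup>2 + w0 z * (cmod (F0 z))\<^sup>2" unfolding herm .
  have gram: "v0 z \<bullet> v0 z = 1" "y0 z \<bullet> y0 z = w0 z" "v0 z \<bullet> y0 z = 0"
    using gram_unique[OF D0[unfolded D0_def] ZZ[unfolded Zc sum_cspan2_square] ZH[unfolded Zc sum_cspan2_cmod]]
    by auto
  have im: "v0 z $ 0 = 0" "y0 z $ 0 = 0" by (simp_all add: v0_def y0_def)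
  define x where "x = re0 z *\<^sub>R oone - y0 z \<odot> v0 z"
  have orth: "(y0 z \<odot> v0 z) $ 0 = 0" "(y0 z \<odot> v0 z) \<bullet> v0 z = 0"
    using imag_omul_orth[OF im(2,1)] gram(3) by (simp_all add: inner_commute)
  have x0: "x $ 0 = re0 z" using orth by (simp add: x_def oone_nth)
  have oimx: "oim x = - (y0 z \<odot> v0 z)" unfolding oim_def x0 by (simp add: x_def)
  have normv: "norm (v0 z) = 1" using gram(1) by (simp add: norm_eq_sqrt_inner)
  have "(norm (oim x))\<^sup>2 = w0 z" unfolding oimx using gram(2) normv by (simp add: norm_omul dot_square_norm)
  then have normx: "(norm (oim x))\<^sup>2 = w0 z" "1 + (norm x)\<^sup>2 = Q" using norm2_oim[of x] by (simp_all add: x0 w0)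
  have y: "oim x \<odot> v0 z = y0 z"
    unfolding oimx using imag_omul_imag(2)[OF im(1), of "y0 z"] normv by (simp add: omul.minus_left)
  have "x \<bullet> v0 z = 0" using orth im by (simp add: x_def inner_diff_left) (simp add: inner_8 oone_nth)
  then show "Psi z \<in> locus" using normv im by (simp add: Psi_def locus_def x_def)
  have tx: "orbit_par x = t" unfolding orbit_par_def normx tw ..
  have cx: "cayley x = c"
  proof -
    have "(norm x)\<^sup>2 = Q - 1" using normx by simp
    then show ?thesis using Q by (simp add: cayley_def complex_eq_iff Rec Imc x0 diff_divide_distrib)
  qed
  have clx: "clift d x (v0 z) = Z"
    unfolding Zc by (simp add: clift_def Let_def x0 normx y E0_def F0_def)
  have rq: "(n A / Q) powr (real d / 2) * q = 1"
    unfolding q_def den using Q n_pos by (simp flip: powr_mult)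
  have "Phi (x, v0 z) $ i = z $ i" for i
  proof (cases "i = 0")
    case True
    then show ?thesis by (simp add: Phi_def tx cx mt z0)
  next
    case False
    then have "Phi (x, v0 z) $ i = of_real ((n A / Q) powr (real d / 2) * q) * z $ i"
      by (simp add: Phi_def tx mt normx clx Z_def)
    then show ?thesis unfolding rq by simp
  qed
  then show "Phi (Psi z) = z" by (simp add: Psi_def vec_eq_iff x_def)
qed

end

section \<open>Smoothness of the map and of the inverse formula\<close>

lemma smooth_on_nth: "open S \<Longrightarrow> smooth_on f S \<Longrightarrow> smooth_on (\<lambda>x. f x $ i) S"
  by (rule smooth_on_linear_compose[OF bounded_linear_vec_nth])

lemma smooth_on_complex_intros:
  assumes "open S"
  shows "smooth_on f S \<Longrightarrow> smooth_on (\<lambda>x. complex_of_real (f x)) S"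
    "smooth_on g S \<Longrightarrow> smooth_on (\<lambda>x. Re (g x)) S"
    "smooth_on g S \<Longrightarrow> smooth_on (\<lambda>x. Im (g x)) S"
    "smooth_on g S \<Longrightarrow> smooth_on (\<lambda>x. cnj (g x)) S"
    "smooth_on g S \<Longrightarrow> smooth_on (\<lambda>x. (cmod (g x))\<^sup>2) S"
  unfolding power2_norm_eq_inner
  by (auto intro: smooth_on_linear_compose assms bounded_linear_of_real bounded_linear_Re bounded_linear_Im
      bounded_linear_cnj smooth_on_inner)

lemma smooth_on_norm2:
  "open S \<Longrightarrow> smooth_on f S \<Longrightarrow> smooth_on (\<lambda>x. (norm (f x))\<^sup>2) S"
  unfolding power2_norm_eq_inner by (rule smooth_on_inner)

lemma smooth_on_Complex:
  "open S \<Longrightarrow> smooth_on f S \<Longrightarrow> smooth_on g S \<Longrightarrow> smooth_on (\<lambda>x. Complex (f x) (g x)) S"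
  by (rule smooth_on_complex) auto

lemma smooth_on_omul: "open S \<Longrightarrow> smooth_on f S \<Longrightarrow> smooth_on g S \<Longrightarrow> smooth_on (\<lambda>x. f x \<odot> g x) S"
  by (rule smooth_on_bilinear[OF bounded_bilinear_omul])

lemma smooth_on_oim: "open S \<Longrightarrow> smooth_on f S \<Longrightarrow> smooth_on (\<lambda>x. oim (f x)) S"
  unfolding oim_def by (intro smooth_on_diff smooth_on_scaleR smooth_on_nth smooth_on_const)

lemma smooth_on_clift:
  assumes "open S" "smooth_on U S" "smooth_on V S"
  shows "smooth_on (\<lambda>y. clift k (U y) (V y) $ i) S"
  unfolding clift_def cspan2_def Let_def vec_lambda_beta
  by (intro smooth_on_add smooth_on_mult smooth_on_complex_intros smooth_on_nth smooth_on_omul smooth_on_oim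
      smooth_on_ev_od smooth_on_Complex smooth_on_const smooth_on_norm2 assms)

lemma smooth_on_orbit_par:
  assumes "open S" "smooth_on U S"
  shows "smooth_on (\<lambda>y. orbit_par (U y)) S"
  unfolding orbit_par_def
  by (intro smooth_on_divide smooth_on_mult smooth_on_power smooth_on_add smooth_on_norm2 smooth_on_oim smooth_on_const assms)
    (simp only: power_not_zero one_plus_norm2_pos not_False_eq_True)

lemma smooth_on_cayley:
  assumes "open S" "smooth_on U S"
  shows "smooth_on (\<lambda>y. cayley (U y)) S"
  unfolding cayley_def
  by (intro smooth_on_Complex smooth_on_divide smooth_on_diff smooth_on_add smooth_on_mult smooth_on_nth
      smooth_on_norm2 smooth_on_const assms) simp_all

context brieskorn_profile
begin

text \<open>The parameter \<open>orbit_par\<close> lies in [0, 1] for every octonion, so the formula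
  is smooth off the locus too and extends each chart expression globally.\<close>

lemma smooth_on_Phi:
  assumes S: "open S" and U: "smooth_on U S" and V: "smooth_on V S"
  shows "smooth_on (\<lambda>y. Phi (U y, V y)) S"
proof (rule smooth_on_vec[OF S])
  fix i :: 8
  have m: "smooth_on (\<lambda>y. m (orbit_par (U y))) S"
    by (rule smooth_on_compose_real[OF S T(1) T(3) smooth_on_orbit_par[OF S U]])
      (use T(2) orbit_par_bounds in force)
  have r: "smooth_on (\<lambda>y. (m (orbit_par (U y)) / (1 + (norm (U y))\<^sup>2)) powr (real d / 2)) S"
    by (intro smooth_on_powr smooth_on_divide m smooth_on_add smooth_on_const smooth_on_norm2 S U)
      (auto intro!: divide_pos_pos m_orbit_par)
  show "smooth_on (\<lambda>y. Phi (U y, V y) $ i) S"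
  proof (cases "i = 0")
    case True
    have "smooth_on (\<lambda>y. - (of_real (m (orbit_par (U y))) * cayley (U y))) S"
      by (intro smooth_on_minus smooth_on_mult smooth_on_complex_intros m smooth_on_cayley S U)
    with True show ?thesis by (simp add: Phi_def)
  next
    case False
    have "smooth_on (\<lambda>y. of_real ((m (orbit_par (U y)) / (1 + (norm (U y))\<^sup>2)) powr (real d / 2)) * clift d (U y) (V y) $ i) S"
      by (intro smooth_on_mult smooth_on_complex_intros r smooth_on_clift S U V)
    with False show ?thesis by (simp add: Phi_def)
  qed
qed

lemma smooth_on_den:
  assumes S: "open S" and U: "smooth_on U S" and "\<And>y. y \<in> S \<Longrightarrow> (cmod (U y $ 0))\<^sup>2 \<in> X"
  shows "smooth_on (\<lambda>y. n ((cmod (U y $ 0))\<^sup>2)) S" "smooth_on (\<lambda>y. den (U y)) S"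
proof -
  show n: "smooth_on (\<lambda>y. n ((cmod (U y $ 0))\<^sup>2)) S"
    by (rule smooth_on_compose_real[OF S X(1) X(2)])
      (use assms in \<open>auto intro: smooth_on_complex_intros smooth_on_nth\<close>)
  then show "smooth_on (\<lambda>y. den (U y)) S"
    unfolding den_def by (intro smooth_on_diff smooth_on_complex_intros smooth_on_nth S U)
qed

lemma smooth_on_EF:
  assumes S: "open S" and U: "smooth_on U S" and UX: "\<And>y. y \<in> S \<Longrightarrow> (cmod (U y $ 0))\<^sup>2 \<in> X"
    and pos: "\<And>y. y \<in> S \<Longrightarrow> den (U y) > 0"
  shows "smooth_on (\<lambda>y. re0 (U y)) S" "smooth_on (\<lambda>y. E0 (U y)) S" "smooth_on (\<lambda>y. F0 (U y)) S"
    "smooth_on (\<lambda>y. D0 (U y)) S"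
proof -
  note den = smooth_on_den[OF S U UX]
  have nz: "den (U y) \<noteq> 0" if "y \<in> S" for y using pos[OF that] by simp
  show re: "smooth_on (\<lambda>y. re0 (U y)) S"
    unfolding re0_def
    by (intro smooth_on_divide smooth_on_minus smooth_on_complex_intros smooth_on_nth den S U nz)
  have w: "smooth_on (\<lambda>y. w0 (U y)) S"
    unfolding w0_def
    by (intro smooth_on_diff smooth_on_divide smooth_on_mult smooth_on_power re den smooth_on_const S nz)
  show E: "smooth_on (\<lambda>y. E0 (U y)) S" and F: "smooth_on (\<lambda>y. F0 (U y)) S"
    unfolding E0_def F0_def
    by (intro smooth_on_ev_od smooth_on_Complex smooth_on_complex_intros re w smooth_on_const S)+
  show "smooth_on (\<lambda>y. D0 (U y)) S"
    unfolding D0_def by (intro smooth_on_complex_intros smooth_on_mult E F S)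
qed

lemma smooth_on_Psi:
  assumes S: "open S" and U: "smooth_on U S" and Om: "\<And>y. y \<in> S \<Longrightarrow> U y \<in> Om"
  shows "smooth_on (\<lambda>y. Psi (U y)) S"
proof -
  have UX: "(cmod (U y $ 0))\<^sup>2 \<in> X" and pos: "den (U y) > 0" and D: "D0 (U y) \<noteq> 0" if "y \<in> S" for y
    using Om[OF that] by (auto simp: Om_def)
  note den = smooth_on_den[OF S U UX]
  note EF = smooth_on_EF[OF S U UX pos]
  have nz: "den (U y) \<noteq> 0" "2 / den (U y) > 0" if "y \<in> S" for y using pos[OF that] by simp_all
  have q: "smooth_on (\<lambda>y. (2 / den (U y)) powr (real d / 2)) S"
    by (intro smooth_on_powr smooth_on_divide smooth_on_const den S nz)
  have v: "smooth_on (\<lambda>y. v0 (U y)) S"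
  proof (rule smooth_on_vec[OF S])
    fix i :: 8
    have "smooth_on (\<lambda>y. Re (cnj (F0 (U y)) * (of_real ((2 / den (U y)) powr (real d / 2)) * U y $ i)) / D0 (U y)) S"
      by (intro smooth_on_divide smooth_on_complex_intros smooth_on_mult smooth_on_nth EF q S U D)
    then show "smooth_on (\<lambda>y. v0 (U y) $ i) S"
      by (cases "i = 0") (simp_all add: v0_def smooth_on_const S)
  qed
  have y: "smooth_on (\<lambda>y. y0 (U y)) S"
  proof (rule smooth_on_vec[OF S])
    fix i :: 8
    have "smooth_on (\<lambda>y. Im (cnj (E0 (U y)) * (of_real ((2 / den (U y)) powr (real d / 2)) * U y $ i)) / D0 (U y)) S"
      by (intro smooth_on_divide smooth_on_complex_intros smooth_on_mult smooth_on_nth EF q S U D)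
    then show "smooth_on (\<lambda>y. y0 (U y) $ i) S"
      by (cases "i = 0") (simp_all add: y0_def smooth_on_const S)
  qed
  show ?thesis
    unfolding Psi_def by (intro smooth_on_Pair smooth_on_diff smooth_on_scaleR smooth_on_omul smooth_on_const EF v y S)
qed

text \<open>Two stages, because continuity of \<open>D0\<close> is available only where
  \<open>den\<close> is positive.\<close>

lemma open_Om: "open Om"
proof -
  define S0 where "S0 = {z :: complex ^ 8. (cmod (z $ 0))\<^sup>2 \<in> X}"
  have S0: "open S0"
  proof -
    have "continuous_on UNIV (\<lambda>z :: complex ^ 8. (cmod (z $ 0))\<^sup>2)" by (intro continuous_intros)
    from open_vimage[OF X(1) this] show ?thesis by (simp add: S0_def vimage_def)
  qed
  have id: "smooth_on (\<lambda>z::complex ^ 8. z) S" if "open S" for S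
    by (rule smooth_on_linear[OF bounded_linear_ident that])
  have "continuous_on S0 den"
    by (rule smooth_on_imp_continuous_on[OF smooth_on_den(2)[OF S0 id[OF S0]]]) (simp add: S0_def)
  from continuous_open_preimage[OF this S0 open_greaterThan[of 0]]
  have S1: "open {z \<in> S0. den z > 0}" by (simp add: Int_def vimage_def)
  have "continuous_on {z \<in> S0. den z > 0} D0"
    by (rule smooth_on_imp_continuous_on[OF smooth_on_EF(4)[OF S1 id[OF S1]]]) (auto simp: S0_def)
  from continuous_open_preimage[OF this S1, of "- {0}"]
  have "open ({z \<in> S0. den z > 0} \<inter> D0 -` (- {0}))" by auto
  also have "{z \<in> S0. den z > 0} \<inter> D0 -` (- {0}) = Om" by (auto simp: Om_def S0_def)
  finally show ?thesis .
qed

end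

section \<open>The twist and the Moebius action\<close>

definition kap :: "int \<Rightarrow> octonion \<Rightarrow> octonion" where
  "kap k u = (if k > 0 then u else ocnj u)"

text \<open>The imaginary v that anticommute with Im x. Unlike \<open>locus\<close> it does not fix
  the length, so it is stable under multiplication by the subalgebra of x.\<close>

definition normal_imag :: "octonion \<Rightarrow> octonion set" where
  "normal_imag x = {v. v $ 0 = 0 \<and> oim x \<bullet> v = 0}"

text \<open>The subalgebra generated by \<open>x\<close>, that is, the span of \<open>1\<close> and \<open>Im x\<close>.\<close>

definition gen_alg :: "octonion \<Rightarrow> octonion set" where
  "gen_alg x = {b. \<exists>c. oim b = c *\<^sub>R oim x}"

lemma oct_split: "x = (x $ 0) *\<^sub>R oone + oim x"
  by (simp add: oim_def)

lemma oim_linear: "oim (x + y) = oim x + oim y" "oim (c *\<^sub>R x) = c *\<^sub>R oim x" "oim (- x) = - oim x"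
  "oim (x - y) = oim x - oim y" "oim oone = 0" "oim (ocnj x) = - oim x"
  by (simp_all add: vec_eq_iff oim_nth ocnj_nth oone_nth)

lemma oim_oim [simp]: "oim (oim x) = oim x"
  by (simp add: vec_eq_iff oim_nth)

lemma gen_alg_intros:
  "x \<in> gen_alg x" "oone \<in> gen_alg x" "a \<in> gen_alg x \<Longrightarrow> b \<in> gen_alg x \<Longrightarrow> a + b \<in> gen_alg x"
  "a \<in> gen_alg x \<Longrightarrow> c *\<^sub>R a \<in> gen_alg x" "a \<in> gen_alg x \<Longrightarrow> ocnj a \<in> gen_alg x"
  "a \<in> gen_alg x \<Longrightarrow> oinv a \<in> gen_alg x" "a \<in> gen_alg x \<Longrightarrow> - a \<in> gen_alg x"
  "a \<in> gen_alg x \<Longrightarrow> b \<in> gen_alg x \<Longrightarrow> a - b \<in> gen_alg x"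
proof -
  show "x \<in> gen_alg x" unfolding gen_alg_def by (auto intro: exI[of _ 1])
  show "oone \<in> gen_alg x" unfolding gen_alg_def by (auto intro: exI[of _ 0] simp: oim_linear)
  show "a \<in> gen_alg x \<Longrightarrow> b \<in> gen_alg x \<Longrightarrow> a + b \<in> gen_alg x"
    unfolding gen_alg_def by (auto simp: oim_linear simp flip: scaleR_add_left)
  show sc: "a \<in> gen_alg x \<Longrightarrow> c *\<^sub>R a \<in> gen_alg x" for a c
    unfolding gen_alg_def by (auto simp: oim_linear intro: exI[of _ "c * _"])
  show cn: "a \<in> gen_alg x \<Longrightarrow> ocnj a \<in> gen_alg x" for a
    unfolding gen_alg_def by (auto simp: oim_linear simp flip: scaleR_minus_left)
  show "a \<in> gen_alg x \<Longrightarrow> oinv a \<in> gen_alg x"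
    unfolding oinv_def by (intro sc cn)
  show "a \<in> gen_alg x \<Longrightarrow> - a \<in> gen_alg x"
    using sc[of a "-1"] by simp
  show "a \<in> gen_alg x \<Longrightarrow> b \<in> gen_alg x \<Longrightarrow> a - b \<in> gen_alg x"
    unfolding gen_alg_def by (auto simp: oim_linear simp flip: scaleR_diff_left)
qed

lemma gen_algE:
  assumes "b \<in> gen_alg x"
  obtains c where "b = (b $ 0) *\<^sub>R oone + c *\<^sub>R oim x"
  using assms oct_split[of b] unfolding gen_alg_def by auto

lemma oim_omul_oim: "oim x \<odot> oim x = - ((norm (oim x))\<^sup>2 *\<^sub>R oone)"
  using omul_self[of "oim x"] by (simp add: oim_nth)

lemma gen_alg_mult:
  "(a *\<^sub>R oone + b *\<^sub>R oim x) \<odot> (a' *\<^sub>R oone + b' *\<^sub>R oim x) =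
     (a * a' - b * b' * (norm (oim x))\<^sup>2) *\<^sub>R oone + (a * b' + b * a') *\<^sub>R oim x"
  by (simp add: omul_linear oim_omul_oim algebra_simps)

lemma gen_alg_omul: "a \<in> gen_alg x \<Longrightarrow> b \<in> gen_alg x \<Longrightarrow> a \<odot> b \<in> gen_alg x"
proof (elim gen_algE)
  fix c c' assume "a = (a $ 0) *\<^sub>R oone + c *\<^sub>R oim x" "b = (b $ 0) *\<^sub>R oone + c' *\<^sub>R oim x"
  then have "a \<odot> b = (a $ 0 * b $ 0 - c * c' * (norm (oim x))\<^sup>2) *\<^sub>R oone + (a $ 0 * c' + c * b $ 0) *\<^sub>R oim x"
    using gen_alg_mult by metis
  then show ?thesis by (auto simp: gen_alg_def oim_linear)
qed

text \<open>A case of Artin's theorem: as a and b are combinations of 1 and w = Im x, everything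
  reduces to w (w v) = - |w|^2 v.\<close>

lemma gen_alg_assoc:
  assumes "a \<in> gen_alg x" "b \<in> gen_alg x"
  shows "(a \<odot> b) \<odot> v = a \<odot> (b \<odot> v)"
proof -
  obtain c c' where a: "a = (a $ 0) *\<^sub>R oone + c *\<^sub>R oim x" and b: "b = (b $ 0) *\<^sub>R oone + c' *\<^sub>R oim x"
    using assms by (metis gen_algE)
  have "((r *\<^sub>R oone + c *\<^sub>R oim x) \<odot> (r' *\<^sub>R oone + c' *\<^sub>R oim x)) \<odot> v
      = (r *\<^sub>R oone + c *\<^sub>R oim x) \<odot> ((r' *\<^sub>R oone + c' *\<^sub>R oim x) \<odot> v)" for r r'
    unfolding gen_alg_mult by (simp add: omul_linear omul.diff_left omul.minus_left imag_omul_imag(1) algebra_simps)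
  from this[of "a $ 0" "b $ 0"] show ?thesis using a b by metis
qed

lemma normal_imag_anticommute:
  assumes "v \<in> normal_imag x" "b \<in> gen_alg x"
  shows "v \<odot> b = ocnj b \<odot> v"
proof -
  obtain c where b: "b = (b $ 0) *\<^sub>R oone + c *\<^sub>R oim x" using assms(2) by (rule gen_algE)
  have "v \<odot> oim x = - (oim x \<odot> v)"
    using assms(1) imag_anticommute[of "oim x" v] by (simp add: normal_imag_def)
  then have "v \<odot> (r *\<^sub>R oone + c *\<^sub>R oim x) = ocnj (r *\<^sub>R oone + c *\<^sub>R oim x) \<odot> v" for r
    by (simp add: omul_linear ocnj_linear ocnj_imag omul.minus_left omul.diff_left)
  from this[of "b $ 0"] show ?thesis using b by metis
qed

lemma normal_imag_omul:
  assumes "v \<in> normal_imag x" "b \<in> gen_alg x"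
  shows "b \<odot> v \<in> normal_imag x"
proof -
  obtain c where b: "b = (b $ 0) *\<^sub>R oone + c *\<^sub>R oim x" using assms(2) by (rule gen_algE)
  have "oim x \<odot> v \<in> normal_imag x"
    using assms(1) imag_omul_orth[of "oim x" v] by (simp add: normal_imag_def inner_commute)
  then have "(r *\<^sub>R oone + c *\<^sub>R oim x) \<odot> v \<in> normal_imag x" for r
    using assms(1) by (simp add: normal_imag_def omul_linear inner_add_right)
  from this[of "b $ 0"] show ?thesis using b by metis
qed

lemma normal_imag_scaleR: "v \<in> normal_imag x \<Longrightarrow> c *\<^sub>R v \<in> normal_imag x"
  by (simp add: normal_imag_def)

lemma normal_imag_funpow:
  "v \<in> normal_imag x \<Longrightarrow> b \<in> gen_alg x \<Longrightarrow> ((\<odot>) b ^^ i) v \<in> normal_imag x"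
  by (induction i) (auto intro: normal_imag_omul)

lemma funpow_oone_gen_alg: "b \<in> gen_alg x \<Longrightarrow> ((\<odot>) b ^^ i) oone \<in> gen_alg x"
  by (induction i) (auto intro: gen_alg_omul gen_alg_intros)

lemma funpow_oone_left:
  assumes "b \<in> gen_alg x"
  shows "((\<odot>) b ^^ i) oone \<odot> v = ((\<odot>) b ^^ i) v"
  by (induction i) (auto simp: gen_alg_assoc[OF assms funpow_oone_gen_alg[OF assms]])

text \<open>The induction runs over all v because each step replaces v by conj(b) v, which is still
  imaginary and normal to Im x.\<close>

lemma funpow_oone_right:
  assumes "b \<in> gen_alg x" "v \<in> normal_imag x"
  shows "v \<odot> ((\<odot>) b ^^ i) oone = ((\<odot>) (ocnj b) ^^ i) v"
  using assms(2)
proof (induction i arbitrary: v)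
  case (Suc i)
  have "v \<odot> (b \<odot> ((\<odot>) b ^^ i) oone) = (ocnj (((\<odot>) b ^^ i) oone) \<odot> ocnj b) \<odot> v"
    using normal_imag_anticommute[OF Suc.prems gen_alg_omul[OF assms(1) funpow_oone_gen_alg[OF assms(1)]]]
    by (simp add: ocnj_omul)
  also have "\<dots> = ocnj (((\<odot>) b ^^ i) oone) \<odot> (ocnj b \<odot> v)"
    by (intro gen_alg_assoc[of _ x] gen_alg_intros funpow_oone_gen_alg assms)
  also have "\<dots> = (ocnj b \<odot> v) \<odot> ((\<odot>) b ^^ i) oone"
    by (intro normal_imag_anticommute[of _ x, symmetric] normal_imag_omul funpow_oone_gen_alg gen_alg_intros Suc.prems assms)
  also have "\<dots> = ((\<odot>) (ocnj b) ^^ Suc i) v"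
    unfolding Suc.IH[OF normal_imag_omul[OF Suc.prems gen_alg_intros(5)[OF assms(1)]]] by (simp add: funpow_swap1)
  finally show ?case by simp
qed simp

lemma funpow_scaleR_left: "((\<odot>) (c *\<^sub>R b) ^^ i) v = c ^ i *\<^sub>R ((\<odot>) b ^^ i) v"
  by (induction i) (auto simp: omul_linear)

lemma funpow_scaleR_right: "((\<odot>) b ^^ i) (c *\<^sub>R v) = c *\<^sub>R ((\<odot>) b ^^ i) v"
  by (induction i) (auto simp: omul_linear)

lemma norm_funpow: "norm (((\<odot>) b ^^ i) v) = norm b ^ i * norm v"
  by (induction i) (auto simp: norm_omul)

lemma opowi_nonneg: "0 \<le> i \<Longrightarrow> opowi x i = ((\<odot>) x ^^ nat i) oone"
  by (simp add: opowi_def)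

lemma opowi_nonpos: "i \<le> 0 \<Longrightarrow> opowi x i = ((\<odot>) (oinv x) ^^ nat (- i)) oone"
  by (auto simp: opowi_def)

lemma ocnj_oinv: "ocnj (oinv x) = (1 / (norm x)\<^sup>2) *\<^sub>R x"
  by (simp add: oinv_def ocnj_linear)

definition twist_act :: "nat \<Rightarrow> octonion \<Rightarrow> octonion \<Rightarrow> octonion" where
  "twist_act d x v = (1 / norm x ^ d) *\<^sub>R ((\<odot>) x ^^ d) v"

text \<open>Moving \<open>x\<^sup>n\<close> to the left past \<open>v\<close> conjugates it.\<close>

lemma twist_eq:
  assumes k: "odd k" and v: "v \<in> normal_imag x"
  shows "twist k x v = twist_act (nat \<bar>k\<bar>) (kap k x) v"
proof -
  define m n where "m = (k + 1) div 2" and "n = (- k + 1) div 2"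
  have mn: "m + n = 1" "m - n = k" using k unfolding m_def n_def by (auto elim!: oddE)
  have g: "x \<in> gen_alg x" "oinv x \<in> gen_alg x" by (intro gen_alg_intros)+
  have twist: "twist k x v = (1 / norm x) *\<^sub>R (opowi x m \<odot> v \<odot> opowi x n)"
    unfolding twist_def m_def[symmetric] n_def[symmetric] Let_def mn by simp
  show ?thesis
  proof (cases "k > 0")
    case True
    define i j where "i = nat m" and "j = nat (- n)"
    \<comment> \<open>The conjugate of the inverse of x is x / |x|^2. Moving x^n to the left thus
      adds j factors x and the scale |x|^(-2j); with 2 j + 1 = |k| the total scale is
      |x|^(-|k|).\<close>
    have ij: "m \<ge> 0" "n \<le> 0" "i + j = nat \<bar>k\<bar>" "2 * j + 1 = nat \<bar>k\<bar>"
      using mn True by (auto simp: i_def j_def)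
    have "opowi x m \<odot> v \<odot> opowi x n = ((\<odot>) (ocnj (oinv x)) ^^ j) (((\<odot>) x ^^ i) v)"
      unfolding opowi_nonneg[OF ij(1)] opowi_nonpos[OF ij(2)] funpow_oone_left[OF g(1)] i_def[symmetric] j_def[symmetric]
      by (intro funpow_oone_right[of _ x] g normal_imag_funpow v)
    also have "\<dots> = (1 / (norm x)\<^sup>2) ^ j *\<^sub>R ((\<odot>) x ^^ (i + j)) v"
      unfolding ocnj_oinv funpow_scaleR_left add.commute[of i j] funpow_add o_apply ..
    finally have tw: "opowi x m \<odot> v \<odot> opowi x n = (1 / (norm x)\<^sup>2) ^ j *\<^sub>R ((\<odot>) (x) ^^ nat \<bar>k\<bar>) v"
      unfolding ij(3) .
    have "1 / norm x * (1 / (norm x)\<^sup>2) ^ j = 1 / norm x ^ nat \<bar>k\<bar>"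
      unfolding ij(4)[symmetric] by (simp add: power_divide flip: power_mult)
    then show ?thesis
      using True unfolding twist tw scaleR_scaleR by (simp only: twist_act_def kap_def if_True if_False norm_ocnj)
  next
    case False
    define i j where "i = nat (- m)" and "j = nat n"
    have ij: "m \<le> 0" "n \<ge> 0" "i + j = nat \<bar>k\<bar>" "2 * i + 1 = nat \<bar>k\<bar>"
      using mn False k by (auto simp: i_def j_def)
    have "opowi x m \<odot> v \<odot> opowi x n = ((\<odot>) (ocnj x) ^^ j) (((\<odot>) (oinv x) ^^ i) v)"
      unfolding opowi_nonpos[OF ij(1)] opowi_nonneg[OF ij(2)] funpow_oone_left[OF g(2)] i_def[symmetric] j_def[symmetric]
      by (intro funpow_oone_right[of _ x] g normal_imag_funpow v)
    also have "\<dots> = (1 / (norm x)\<^sup>2) ^ i *\<^sub>R ((\<odot>) (ocnj x) ^^ (i + j)) v"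
      unfolding oinv_def funpow_scaleR_left funpow_scaleR_right add.commute[of i j] funpow_add o_apply ..
    finally have tw: "opowi x m \<odot> v \<odot> opowi x n = (1 / (norm x)\<^sup>2) ^ i *\<^sub>R ((\<odot>) (ocnj x) ^^ nat \<bar>k\<bar>) v"
      unfolding ij(3) .
    have "1 / norm x * (1 / (norm x)\<^sup>2) ^ i = 1 / norm x ^ nat \<bar>k\<bar>"
      unfolding ij(4)[symmetric] by (simp add: power_divide flip: power_mult)
    then show ?thesis
      using False unfolding twist tw scaleR_scaleR by (simp only: twist_act_def kap_def if_True if_False norm_ocnj)
  qed
qed

section \<open>Left multiplication on the complexified octonions\<close>

text \<open>The complexification of left multiplication by octonions \<open>\<alpha> + \<beta> w\<close> with complex \<open>\<alpha>\<close>, \<open>\<beta>\<close>.\<close>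

definition cleft :: "octonion \<Rightarrow> complex \<Rightarrow> complex \<Rightarrow> complex ^ 8 \<Rightarrow> complex ^ 8" where
  "cleft w a b Z = (\<chi> i. a * Z $ i + b * Complex ((w \<odot> (\<chi> j. Re (Z $ j))) $ i) ((w \<odot> (\<chi> j. Im (Z $ j))) $ i))"

definition complexify :: "octonion \<Rightarrow> complex ^ 8" where
  "complexify v = (\<chi> i. of_real (v $ i))"

text \<open>Since L_w^2 = - |w|^2, the operators a + b L_w with complex a, b multiply like
  polynomials modulo this relation; in particular they commute.\<close>

lemma cleft_cleft:
  assumes "w $ 0 = 0"
  shows "cleft w a b (cleft w a' b' Z) = cleft w (a * a' - b * b' * of_real ((norm w)\<^sup>2)) (a * b' + b * a') Z"
proof -
  define X Y where "X = (\<chi> j. Re (Z $ j))" and "Y = (\<chi> j. Im (Z $ j))"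
  have Z: "Z $ i = Complex (X $ i) (Y $ i)" for i by (simp add: X_def Y_def)
  have re: "(\<chi> j. Re (cleft w a' b' Z $ j)) = Re a' *\<^sub>R X - Im a' *\<^sub>R Y + Re b' *\<^sub>R (w \<odot> X) - Im b' *\<^sub>R (w \<odot> Y)"
    and im: "(\<chi> j. Im (cleft w a' b' Z $ j)) = Re a' *\<^sub>R Y + Im a' *\<^sub>R X + Re b' *\<^sub>R (w \<odot> Y) + Im b' *\<^sub>R (w \<odot> X)"
    unfolding cleft_def X_def[symmetric] Y_def[symmetric] by (simp_all add: vec_eq_iff Z)
  have ww: "w \<odot> (w \<odot> v) = - ((norm w)\<^sup>2 *\<^sub>R v)" for v using imag_omul_imag(1)[OF assms] .
  have L: "cleft w a b (cleft w a' b' Z) $ i = a * (a' * Z $ i + b' * Complex ((w \<odot> X) $ i) ((w \<odot> Y) $ i)) +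
     b * Complex ((w \<odot> (\<chi> j. Re (cleft w a' b' Z $ j))) $ i) ((w \<odot> (\<chi> j. Im (cleft w a' b' Z $ j))) $ i)" for i
    by (simp add: cleft_def X_def Y_def)
  show ?thesis
    unfolding vec_eq_iff L re im
    by (simp add: cleft_def X_def[symmetric] Y_def[symmetric] omul.add_right omul.diff_right omul_linear ww Z
        complex_eq_iff algebra_simps)
qed

lemma cleft_complexify: "cleft w a b (complexify v) = cspan2 a b v (w \<odot> v)"
proof -
  have ReIm: "(\<chi> j. Re (complexify v $ j)) = v" "(\<chi> j. Im (complexify v $ j)) = 0"
    by (simp_all add: complexify_def vec_eq_iff)
  show ?thesis
    unfolding cleft_def ReIm omul.zero_right by (simp add: cspan2_def complexify_def vec_eq_iff complex_eq_iff)
qed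

lemma complexify_cleft:
  "complexify ((r *\<^sub>R oone + c *\<^sub>R w) \<odot> v) = cleft w (of_real r) (of_real c) (complexify v)"
  unfolding cleft_complexify by (simp add: complexify_def cspan2_def vec_eq_iff omul_linear)

lemma complexify_funpow:
  "complexify (((\<odot>) (r *\<^sub>R oone + c *\<^sub>R w) ^^ i) v) = (cleft w (of_real r) (of_real c) ^^ i) (complexify v)"
  by (induction i) (auto simp: complexify_cleft)

lemma cleft_scale: "cleft w (c * a) (c * b) Z = c *s cleft w a b Z"
  by (simp add: cleft_def vec_eq_iff algebra_simps)

lemma cleft_vec_scale: "cleft w a b (c *s Z) = c *s cleft w a b Z"
proof -
  define X Y where "X = (\<chi> j. Re (Z $ j))" and "Y = (\<chi> j. Im (Z $ j))"
  have ReIm: "(\<chi> j. Re ((c *s Z) $ j)) = Re c *\<^sub>R X - Im c *\<^sub>R Y" "(\<chi> j. Im ((c *s Z) $ j)) = Re c *\<^sub>R Y + Im c *\<^sub>R X"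
    by (simp_all add: X_def Y_def vec_eq_iff)
  show ?thesis
    unfolding cleft_def ReIm X_def[symmetric] Y_def[symmetric]
    by (simp add: omul.add_right omul.diff_right omul_linear complex_eq_iff vec_eq_iff algebra_simps)
qed

text \<open>The operator form of the lift; in it the Moebius law becomes an identity between
  commuting operators, which may then be raised to the k-th power.\<close>

lemma clift_funpow: "clift k x v = (cleft (oim x) (Complex 1 (x $ 0)) \<i> ^^ k) (complexify v)"
proof -
  define w where "w = complex_of_real ((norm (oim x))\<^sup>2)"
  define s where "s = Complex 1 (x $ 0)"
  have "cleft (oim x) (ev s w k) (\<i> * od s w k) (complexify v) = (cleft (oim x) s \<i> ^^ k) (complexify v)"
  proof (induction k)
    case 0
    show ?case by (simp add: cleft_def vec_eq_iff)
  next
    case (Suc k)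
    have "(cleft (oim x) s \<i> ^^ Suc k) (complexify v) =
       cleft (oim x) s \<i> (cleft (oim x) (ev s w k) (\<i> * od s w k) (complexify v))"
      using Suc by simp
    also have "\<dots> = cleft (oim x) (ev s w (Suc k)) (\<i> * od s w (Suc k)) (complexify v)"
      unfolding cleft_cleft[OF oim_zero] w_def[symmetric] by (simp add: algebra_simps)
    finally show ?case ..
  qed
  then show ?thesis
    unfolding cleft_complexify by (simp add: clift_def Let_def s_def w_def)
qed

lemma funpow_commute_mult:
  assumes "\<And>z. f (g z) = g (f z)"
  shows "(f ^^ i) ((g ^^ i) z) = ((\<lambda>z. f (g z)) ^^ i) z"
proof (induction i)
  case (Suc i)
  have "f ((g ^^ j) y) = (g ^^ j) (f y)" for j y by (induction j) (simp_all add: assms)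
  then have "(f ^^ j) (g y) = g ((f ^^ j) y)" for j y by (induction j) (simp_all add: assms)
  then show ?case using Suc by simp
qed simp

lemma funpow_scale_vec:
  fixes f :: "complex ^ 8 \<Rightarrow> complex ^ 8"
  assumes "\<And>Z. f (c *s Z) = c *s f Z"
  shows "((\<lambda>Z. c *s f Z) ^^ i) Z = c ^ i *s (f ^^ i) Z"
proof (induction i)
  case (Suc i)
  have pull: "f (c ^ j *s Y) = c ^ j *s f Y" for j and Y :: "complex ^ 8"
  proof (induction j)
    case (Suc j)
    have "f (c ^ Suc j *s Y) = f (c *s (c ^ j *s Y))" by (simp only: vector_smult_assoc power_Suc)
    also have "\<dots> = c *s (c ^ j *s f Y)" unfolding assms Suc ..
    finally show ?case by (simp only: vector_smult_assoc power_Suc)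
  qed simp
  have "((\<lambda>Z. c *s f Z) ^^ Suc i) Z = c *s f (c ^ i *s (f ^^ i) Z)" using Suc by simp
  then show ?case by (simp add: pull vector_smult_assoc)
qed simp

text \<open>Everything takes place in the commutative algebra spanned by 1 and Im x. With q = a x +
  b one has |p|^2 + |q|^2 = 1 + |x|^2 and Im x' = Im x / |p|^2, which makes \<open>orbit_par\<close>
  invariant. In the last conclusion the p^k brought in by the twist cancels the denominators of (1 +
  i x')^k.\<close>

lemma mobius:
  fixes a b :: real and x v :: octonion
  assumes ab: "a\<^sup>2 + b\<^sup>2 = 1" and p: "p = a *\<^sub>R oone - b *\<^sub>R x" "p \<noteq> 0"
    and x': "x' = (a *\<^sub>R x + b *\<^sub>R oone) \<odot> oinv p"
  shows "x' = (((a * x $ 0 + b) * (a - b * x $ 0) - a * b * (norm (oim x))\<^sup>2) / (norm p)\<^sup>2) *\<^sub>R oone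
      + (1 / (norm p)\<^sup>2) *\<^sub>R oim x"
    "1 + (norm x')\<^sup>2 = (1 + (norm x)\<^sup>2) / (norm p)\<^sup>2"
    "cayley x' = (Complex a b)\<^sup>2 * cayley x"
    "orbit_par x' = orbit_par x"
    "clift k x' (twist_act k p v) = (Complex a b / of_real (norm p)) ^ k *s clift k x v"
proof -
  define u w N where "u = x $ 0" and "w = (norm (oim x))\<^sup>2" and "N = (norm p)\<^sup>2"
  have N0: "N > 0" using p(2) by (simp add: N_def)
  have ps: "p = (a - b * u) *\<^sub>R oone + (- b) *\<^sub>R oim x"
    unfolding p(1) u_def by (subst oct_split[of x]) (simp add: algebra_simps)
  have pim: "p $ 0 = a - b * u" "oim p = (- b) *\<^sub>R oim x"
    unfolding p(1) by (simp_all add: oone_nth u_def oim_linear)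
  have N: "N = (a - b * u)\<^sup>2 + b\<^sup>2 * w"
    unfolding N_def norm2_oim[of p] pim by (simp add: power_mult_distrib w_def)
  have inv_p: "oinv p = (1 / N) *\<^sub>R ((a - b * u) *\<^sub>R oone + b *\<^sub>R oim x)"
    unfolding oinv_def N_def ocnj_eq pim by simp
  have q: "a *\<^sub>R x + b *\<^sub>R oone = (a * u + b) *\<^sub>R oone + a *\<^sub>R oim x"
    unfolding u_def by (subst oct_split[of x]) (simp add: algebra_simps)
  have "x' = (1 / N) *\<^sub>R (((a * u + b) * (a - b * u) - a * b * w) *\<^sub>R oone + ((a * u + b) * b + a * (a - b * u)) *\<^sub>R oim x)"
    unfolding x' inv_p q omul_linear(4) gen_alg_mult w_def ..
  also have "(a * u + b) * b + a * (a - b * u) = 1"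
    using ab by (simp add: power2_eq_square algebra_simps)
  finally have x'_eq: "x' = (((a * u + b) * (a - b * u) - a * b * w) / N) *\<^sub>R oone + (1 / N) *\<^sub>R oim x"
    by (simp add: scaleR_add_right)
  then show "x' = (((a * x $ 0 + b) * (a - b * x $ 0) - a * b * (norm (oim x))\<^sup>2) / (norm p)\<^sup>2) *\<^sub>R oone
      + (1 / (norm p)\<^sup>2) *\<^sub>R oim x"
    by (simp add: u_def w_def N_def)
  define u' where "u' = ((a * u + b) * (a - b * u) - a * b * w) / N"
  have x'0: "x' $ 0 = u'" and oimx': "oim x' = (1 / N) *\<^sub>R oim x"
    unfolding x'_eq u'_def by (simp_all add: oone_nth oim_linear)
  have w': "(norm (oim x'))\<^sup>2 = w / N\<^sup>2" unfolding oimx' by (simp add: power_divide w_def)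
  have nx: "(norm x)\<^sup>2 = u\<^sup>2 + w" unfolding norm2_oim[of x] u_def w_def ..
  have nq: "(norm (a *\<^sub>R x + b *\<^sub>R oone))\<^sup>2 = (a * u + b)\<^sup>2 + a\<^sup>2 * w"
    unfolding norm2_oim[of "a *\<^sub>R x + b *\<^sub>R oone"] by (simp add: oone_nth oim_linear power_mult_distrib u_def w_def)
  have noi: "norm (oinv p) = 1 / norm p" using p(2) by (simp add: oinv_def power2_eq_square)
  have nx': "(norm x')\<^sup>2 = ((a * u + b)\<^sup>2 + a\<^sup>2 * w) / N"
    unfolding x' norm_omul noi by (simp add: power_divide nq N_def)
  have sumN: "N + ((a * u + b)\<^sup>2 + a\<^sup>2 * w) = 1 + (norm x)\<^sup>2"
  proof -
    have "N + ((a * u + b)\<^sup>2 + a\<^sup>2 * w) = (a\<^sup>2 + b\<^sup>2) * (1 + u\<^sup>2 + w)"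
      unfolding N by (simp add: power2_eq_square algebra_simps)
    then show ?thesis using ab nx by simp
  qed
  have Q': "1 + (norm x')\<^sup>2 = (1 + (norm x)\<^sup>2) / N"
    unfolding nx' sumN[symmetric] using N0 by (simp add: add_divide_distrib)
  then show "1 + (norm x')\<^sup>2 = (1 + (norm x)\<^sup>2) / (norm p)\<^sup>2" by (simp add: N_def)
  have Q'N: "N * (1 + (norm x')\<^sup>2) = 1 + (norm x)\<^sup>2" unfolding Q' using N0 by simp
  show "orbit_par x' = orbit_par x"
    unfolding orbit_par_def Q' w' w_def[symmetric] using N0 by (simp add: power_divide)
  have sq: "N * (1 - (norm x')\<^sup>2) = (a\<^sup>2 - b\<^sup>2) * (1 - (norm x)\<^sup>2) - 2 * a * b * (2 * u)"
  proof -
    have "N * (norm x')\<^sup>2 = (a * u + b)\<^sup>2 + a\<^sup>2 * w" unfolding nx' using N0 by simp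
    then have "N * (1 - (norm x')\<^sup>2) = N - ((a * u + b)\<^sup>2 + a\<^sup>2 * w)" by (simp add: right_diff_distrib)
    then show ?thesis unfolding N nx by (simp add: power2_eq_square algebra_simps)
  qed
  have Nu': "N * u' = (a * u + b) * (a - b * u) - a * b * w" unfolding u'_def using N0 by simp
  then have "N * u' = (a\<^sup>2 - b\<^sup>2) * u + a * b * (1 - (norm x)\<^sup>2)"
    unfolding nx by (simp add: power2_eq_square algebra_simps)
  then have su: "N * (2 * u') = (a\<^sup>2 - b\<^sup>2) * (2 * u) + 2 * a * b * (1 - (norm x)\<^sup>2)" by (simp add: algebra_simps)
  have "(1 - (norm x')\<^sup>2) / (1 + (norm x')\<^sup>2) = (N * (1 - (norm x')\<^sup>2)) / (N * (1 + (norm x')\<^sup>2))"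
    "2 * u' / (1 + (norm x')\<^sup>2) = (N * (2 * u')) / (N * (1 + (norm x')\<^sup>2))" using N0 by simp_all
  then show "cayley x' = (Complex a b)\<^sup>2 * cayley x"
    unfolding cayley_def x'0 sq su Q'N u_def[symmetric]
    by (simp add: complex_eq_iff power2_eq_square add_divide_distrib diff_divide_distrib algebra_simps)
  \<comment> \<open>\<open>f\<close> is 1 + i L_x' and \<open>g\<close> is L_p, both written over Im
    x so that \<open>cleft_cleft\<close> multiplies them; \<open>fgc\<close> is the identity (1 + i
    x') p = (a + i b)(1 + i x).\<close>
  define f where "f = cleft (oim x) (Complex 1 u') (\<i> / of_real N)"
  define g where "g = cleft (oim x) (of_real (a - b * u)) (of_real (- b))"
  have f: "cleft (oim x') (Complex 1 (x' $ 0)) \<i> = f"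
    unfolding f_def oimx' x'0 by (rule ext) (simp add: cleft_def omul_linear vec_eq_iff complex_eq_iff)
  have fg: "f (g Z) = g (f Z)" for Z
    unfolding f_def g_def cleft_cleft[OF oim_zero] by (simp add: algebra_simps)
  have fgc: "f (g Z) = Complex a b *s cleft (oim x) (Complex 1 u) \<i> Z" for Z
  proof -
    have 1: "Complex 1 u' * of_real (a - b * u) - \<i> / of_real N * of_real (- b) * of_real w = Complex a b * Complex 1 u"
    proof -
      have "N * (u' * (a - b * u) + b * w / N) = N * (b + a * u)"
      proof -
        have "(N * u') * (a - b * u) + b * w - N * (b + a * u) = b * w * (1 - (a\<^sup>2 + b\<^sup>2))"
          unfolding Nu' unfolding N by (simp add: power2_eq_square algebra_simps)
        then have "(N * u') * (a - b * u) + b * w = N * (b + a * u)" unfolding ab by simp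
        moreover have "N * (u' * (a - b * u) + b * w / N) = (N * u') * (a - b * u) + b * w"
          using N0 by (simp add: distrib_left)
        ultimately show ?thesis by simp
      qed
      then have "u' * (a - b * u) + b * w / N = b + a * u" using N0 by simp
      then show ?thesis by (simp add: complex_eq_iff algebra_simps)
    qed
    have 2: "Complex 1 u' * of_real (- b) + \<i> / of_real N * of_real (a - b * u) = Complex a b * \<i>"
    proof -
      have "a * N + (N * u') * b = (a\<^sup>2 + b\<^sup>2) * (a - b * u)"
        unfolding Nu' unfolding N by (simp add: power2_eq_square algebra_simps)
      then have "(a - b * u) / N - u' * b = a" using N0 ab by (simp add: field_simps)
      then show ?thesis by (simp add: complex_eq_iff diff_divide_distrib algebra_simps)
    qed
    show ?thesis
      unfolding f_def g_def cleft_cleft[OF oim_zero] w_def[symmetric] 1 2 cleft_scale ..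
  qed
  have "clift k x' (twist_act k p v) = (f ^^ k) (complexify (twist_act k p v))"
    unfolding clift_funpow f ..
  also have "complexify (twist_act k p v) = of_real (1 / norm p ^ k) *s (g ^^ k) (complexify v)"
  proof -
    have "complexify (c *\<^sub>R y) = of_real c *s complexify y" for c y
      by (simp add: complexify_def vec_eq_iff)
    moreover have "complexify (((\<odot>) p ^^ k) v) = (g ^^ k) (complexify v)"
      unfolding g_def complexify_funpow[symmetric] ps[symmetric] ..
    ultimately show ?thesis by (simp add: twist_act_def)
  qed
  also have "(f ^^ k) (c *s Z) = c *s (f ^^ k) Z" for c Z
    by (induction k) (simp_all add: f_def cleft_vec_scale)
  then have "(f ^^ k) (of_real (1 / norm p ^ k) *s (g ^^ k) (complexify v)) = of_real (1 / norm p ^ k) *s (f ^^ k) ((g ^^ k) (complexify v))" .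
  also have "(f ^^ k) ((g ^^ k) (complexify v)) = Complex a b ^ k *s clift k x v"
    unfolding funpow_commute_mult[of f g, OF fg] fgc clift_funpow u_def[symmetric]
    by (rule funpow_scale_vec) (rule cleft_vec_scale)
  finally show "clift k x' (twist_act k p v) = (Complex a b / of_real (norm p)) ^ k *s clift k x v"
    by (simp add: power_divide)
qed

section \<open>The sphere inside the Shimada bundle\<close>

lemma kap_simps [simp]:
  "kap k 0 = 0" "kap k oone = oone" "norm (kap k x) = norm x" "kap k (kap k x) = x"
  "kap k (ocnj x) = ocnj (kap k x)" "kap k (- x) = - kap k x"
  "kap k (x + y) = kap k x + kap k y" "kap k (x - y) = kap k x - kap k y" "kap k (c *\<^sub>R x) = c *\<^sub>R kap k x"
  "kap k x $ 0 = x $ 0"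
  by (auto simp: kap_def ocnj_linear ocnj_nth)

lemma kap_eq_0_iff [simp]: "kap k x = 0 \<longleftrightarrow> x = 0"
  using kap_simps(3)[of k x] by (metis norm_eq_zero)

lemma bounded_linear_kap: "bounded_linear (kap k)"
  by (intro linear_conv_bounded_linear[THEN iffD1] linearI) auto

lemma bounded_linear_ocnj: "bounded_linear ocnj"
  by (intro linear_conv_bounded_linear[THEN iffD1] linearI) (auto simp: ocnj_linear)

lemma oim_kap: "oim (kap k x) = (if k > 0 then 1 else -1) *\<^sub>R oim x"
  by (simp add: kap_def oim_linear)

lemma kap_gen_alg: "kap k x \<in> gen_alg x"
  by (simp add: kap_def gen_alg_intros)

lemma locus_iff: "(x, v) \<in> locus \<longleftrightarrow> norm v = 1 \<and> v \<in> normal_imag x"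
  by (auto simp: locus_def normal_imag_def inner_oim)

text \<open>Serves the gluing and the SO(2)-action alike: each replaces x by an element of its
  subalgebra and multiplies v by such elements.\<close>

lemma locus_gen_alg:
  assumes "(x, v) \<in> locus" "y \<in> gen_alg x" "b \<in> gen_alg x" "b \<noteq> 0"
  shows "(y, twist_act d b v) \<in> locus"
proof -
  have v: "norm v = 1" "v \<in> normal_imag x" using assms(1) by (auto simp: locus_iff)
  have 1: "norm (twist_act d b v) = 1" using assms(4) v by (simp add: twist_act_def norm_funpow)
  have 2: "twist_act d b v \<in> normal_imag x"
    unfolding twist_act_def by (intro normal_imag_scaleR normal_imag_funpow v assms)
  obtain c where "oim y = c *\<^sub>R oim x" using assms(2) by (auto simp: gen_alg_def)
  with 2 have "twist_act d b v \<in> normal_imag y" by (simp add: normal_imag_def)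
  with 1 show ?thesis by (simp add: locus_iff)
qed

lemma locus_change:
  assumes "(x, v) \<in> locus" "y \<in> gen_alg x"
  shows "(y, v) \<in> locus"
proof -
  \<comment> \<open>A zeroth power leaves v alone, so that only the first coordinate
    changes.\<close>
  have "twist_act 0 oone v = v" by (simp add: twist_act_def)
  moreover have "oone \<noteq> 0" using oone_nth[of 0] by (metis zero_index zero_neq_one)
  ultimately show ?thesis using locus_gen_alg[OF assms gen_alg_intros(2), of 0] by simp
qed

lemma locus_kap: "(kap k u, v) \<in> locus \<longleftrightarrow> (u, v) \<in> locus"
  using locus_change[of u v "kap k u"] locus_change[of "kap k u" v u] kap_gen_alg[of k u] kap_gen_alg[of k "kap k u"]
  by auto

lemma locus_neg_ocnj_kap: "(- ocnj (kap k u), v) \<in> locus \<longleftrightarrow> (u, v) \<in> locus"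
proof -
  have 1: "- ocnj (kap k u) \<in> gen_alg u" for u by (intro gen_alg_intros kap_gen_alg)
  from 1[of "- ocnj (kap k u)"] have 2: "u \<in> gen_alg (- ocnj (kap k u))" by (simp add: ocnj_linear)
  show ?thesis using locus_change[OF _ 1] locus_change[OF _ 2] by blast
qed

lemma locus_minus: "(x, - v) \<in> locus \<longleftrightarrow> (x, v) \<in> locus"
  by (simp add: locus_def)

lemma locus_oct_bundle: "x \<in> locus \<Longrightarrow> x \<in> oct_bundle"
  by (auto simp: locus_def oct_bundle_def)

lemma locus_chart1:
  "(u, v) \<in> oct_bundle \<Longrightarrow> (u, v) \<in> locus \<longleftrightarrow> ore v = 0 \<and> ore (u \<odot> v) = 0"
  using ore_omul_ocnj[of u "ocnj v"] by (auto simp: locus_def oct_bundle_def ore_def ocnj_imag)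

lemma locus_chart2:
  "(u, v) \<in> oct_bundle \<Longrightarrow> (u, v) \<in> locus \<longleftrightarrow> ore v = 0 \<and> ore (u \<odot> oinv v) = 0"
  using ore_omul_ocnj[of u v] by (auto simp: locus_def oct_bundle_def ore_def oinv_def)

lemma twist_locus:
  assumes "odd k" "(u, v) \<in> locus" "p \<in> gen_alg u"
  shows "twist k p v = twist_act (nat \<bar>k\<bar>) (kap k p) v"
proof (rule twist_eq[OF assms(1)])
  show "v \<in> normal_imag p" using locus_change[OF assms(2,3)] by (simp add: locus_iff)
qed

lemma transition_locus:
  assumes "odd k" "(u, v) \<in> locus" "u \<noteq> 0"
  shows "transition k (u, v) = ((1 / (norm u)\<^sup>2) *\<^sub>R u, twist_act (nat \<bar>k\<bar>) (kap k u) v)" "transition k (u, v) \<in> locus"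
proof -
  show *: "transition k (u, v) = ((1 / (norm u)\<^sup>2) *\<^sub>R u, twist_act (nat \<bar>k\<bar>) (kap k u) v)"
    by (simp add: transition_def twist_locus[OF assms(1,2) gen_alg_intros(1)])
  show "transition k (u, v) \<in> locus"
    unfolding * by (rule locus_gen_alg[OF assms(2)]) (use assms kap_gen_alg in \<open>auto intro: gen_alg_intros\<close>)
qed

lemma opowi_nonzero: "x \<noteq> 0 \<Longrightarrow> opowi x i \<noteq> 0"
proof -
  assume x: "x \<noteq> 0"
  have "norm oone = 1" by (simp add: norm_eq_sqrt_inner inner_8 oone_nth)
  moreover have "norm (oinv x) \<noteq> 0" using x by (simp add: oinv_def)
  moreover have "norm x \<noteq> 0" using x by simp
  ultimately have "norm (opowi x i) \<noteq> 0" by (simp add: opowi_def norm_funpow del: norm_eq_zero)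
  then show ?thesis by simp
qed

lemma twist_diff: "twist k x (v - v') = twist k x v - twist k x v'"
  by (simp add: twist_def Let_def omul.diff_left omul.diff_right scaleR_diff_right)

lemma twist_minus: "twist k x (- v) = - twist k x v"
  by (simp add: twist_def Let_def omul.minus_left omul.minus_right)

text \<open>The twist is linear in v and multiplicative on norms, so it has no kernel; no
  associativity is involved.\<close>

lemma twist_inj: "x \<noteq> 0 \<Longrightarrow> twist k x v = twist k x v' \<Longrightarrow> v = v'"
proof -
  assume x: "x \<noteq> 0" and "twist k x v = twist k x v'"
  then have "norm (twist k x (v - v')) = 0" by (simp add: twist_diff)
  then show "v = v'"
    using x opowi_nonzero[OF x] unfolding twist_def Let_def by (simp add: norm_omul)
qed

lemma inversion_inversion:
  fixes u :: octonion
  shows "u \<noteq> 0 \<Longrightarrow> (1 / (norm ((1 / (norm u)\<^sup>2) *\<^sub>R u))\<^sup>2) *\<^sub>R ((1 / (norm u)\<^sup>2) *\<^sub>R u) = u"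
  by (simp add: power2_eq_square)

lemma transition_inj:
  assumes "fst x \<noteq> 0" "fst x' \<noteq> 0" "transition k x = transition k x'"
  shows "x = x'"
proof -
  obtain u v u' v' where x: "x = (u, v)" "x' = (u', v')" by fastforce
  have eq: "(1 / (norm u)\<^sup>2) *\<^sub>R u = (1 / (norm u')\<^sup>2) *\<^sub>R u'" "twist k u v = twist k u' v'"
    using assms(3) by (auto simp: transition_def x)
  have u: "u = u'" using inversion_inversion[of u] inversion_inversion[of u'] assms eq(1) by (simp add: x)
  moreover have "v = v'" by (rule twist_inj[of u' k]) (use assms(2) eq(2) u in \<open>simp_all add: x\<close>)
  ultimately show ?thesis by (simp add: x)
qed

section \<open>Points of the glued space and their charts\<close>

lemma gluing_iff:
  "(Inl x, Inl x') \<in> gluing k \<longleftrightarrow> x \<in> oct_bundle \<and> x = x'"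
  "(Inl x, Inr y) \<in> gluing k \<longleftrightarrow> x \<in> oct_bundle \<and> fst x \<noteq> 0 \<and> y = transition k x"
  "(Inr y, Inr y') \<in> gluing k \<longleftrightarrow> y \<in> oct_bundle \<and> y = y'"
  "(Inr y, Inl x) \<in> gluing k \<longleftrightarrow> x \<in> oct_bundle \<and> fst x \<noteq> 0 \<and> y = transition k x"
  unfolding gluing_def Let_def Un_iff converse_iff mem_Collect_eq Id_on_iff Pair_inject
  by (simp_all add: Plus_def image_iff) blast+

lemma pt1_eq:
  assumes "x \<in> oct_bundle"
  shows "pt1 k x = insert (Inl x) (if fst x \<noteq> 0 then {Inr (transition k x)} else {})"
proof (rule set_eqI)
  fix q show "q \<in> pt1 k x \<longleftrightarrow> q \<in> insert (Inl x) (if fst x \<noteq> 0 then {Inr (transition k x)} else {})"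
    using assms by (cases q) (auto simp: pt1_def gluing_iff)
qed

lemma pt2_eq:
  assumes "y \<in> oct_bundle"
  shows "pt2 k y = insert (Inr y) {Inl x | x. x \<in> oct_bundle \<and> fst x \<noteq> 0 \<and> transition k x = y}"
proof (rule set_eqI)
  fix q show "q \<in> pt2 k y \<longleftrightarrow> q \<in> insert (Inr y) {Inl x | x. x \<in> oct_bundle \<and> fst x \<noteq> 0 \<and> transition k x = y}"
    using assms by (cases q) (auto simp: pt2_def gluing_iff)
qed

lemma pt2_zero:
  assumes "(0, v) \<in> oct_bundle"
  shows "pt2 k (0, v) = {Inr (0, v)}"
proof -
  have "fst (transition k x) \<noteq> 0" if "fst x \<noteq> 0" for x
    using that by (auto simp: transition_def split: prod.splits)
  then show ?thesis unfolding pt2_eq[OF assms] by (auto simp: prod_eq_iff)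
qed

lemma pt2_transition:
  assumes "x \<in> oct_bundle" "fst x \<noteq> 0" "transition k x \<in> oct_bundle"
  shows "pt2 k (transition k x) = pt1 k x"
proof -
  have *: "{Inl x' | x'. x' \<in> oct_bundle \<and> fst x' \<noteq> 0 \<and> transition k x' = transition k x} = {Inl x}"
    using assms(1,2) transition_inj[OF _ assms(2)] by blast
  show ?thesis
    unfolding pt2_eq[OF assms(3)] pt1_eq[OF assms(1)] * using assms(2) by (simp add: insert_commute)
qed

lemma inj_on_pt1: "inj_on (pt1 k) oct_bundle"
proof (rule inj_onI)
  fix x y assume *: "x \<in> oct_bundle" "y \<in> oct_bundle" "pt1 k x = pt1 k y"
  have "Inl x \<in> pt1 k y" unfolding *(3)[symmetric] pt1_eq[OF *(1)] by simp
  then show "x = y" using * by (auto simp: pt1_eq split: if_splits)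
qed

lemma inj_on_pt2: "inj_on (pt2 k) oct_bundle"
proof (rule inj_onI)
  fix x y assume *: "x \<in> oct_bundle" "y \<in> oct_bundle" "pt2 k x = pt2 k y"
  have "Inr x \<in> pt2 k y" unfolding *(3)[symmetric] pt2_eq[OF *(1)] by simp
  then show "x = y" using * by (auto simp: pt2_eq)
qed

lemma pt2_zero_notin: "(0, v) \<in> oct_bundle \<Longrightarrow> pt2 k (0, v) \<notin> pt1 k ` oct_bundle"
  by (auto simp: pt2_zero pt1_eq)

text \<open>For positive r the factor on the right is 1: twisting by any positive multiple of x
  undoes twisting by conj(x). This inverts the gluing.\<close>

lemma twist_act_cancel:
  assumes "x \<noteq> 0"
  shows "twist_act d (r *\<^sub>R x) (twist_act d (ocnj x) v) = (r / \<bar>r\<bar>) ^ d *\<^sub>R v"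
proof -
  have c: "x \<odot> (ocnj x \<odot> z) = (norm x)\<^sup>2 *\<^sub>R z" for z using omul_ocnj_cancel(1)[of "ocnj x" z] by simp
  have "((\<odot>) x ^^ d) (((\<odot>) (ocnj x) ^^ d) v) = ((\<lambda>z. x \<odot> (ocnj x \<odot> z)) ^^ d) v"
    by (rule funpow_commute_mult) (simp add: c omul_ocnj_cancel(1))
  also have "\<dots> = ((norm x)\<^sup>2) ^ d *\<^sub>R v"
    unfolding c by (induction d) auto
  finally have "((\<odot>) x ^^ d) (((\<odot>) (ocnj x) ^^ d) v) = ((norm x)\<^sup>2) ^ d *\<^sub>R v" .
  then show ?thesis
    using assms unfolding twist_act_def funpow_scaleR_left funpow_scaleR_right
    by (simp add: power_mult_distrib power_divide power2_eq_square)
qed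

lemma transition_surj:
  assumes "odd k" "(u', v') \<in> locus" "u' \<noteq> 0"
  obtains x where "x \<in> locus" "fst x \<noteq> 0" "transition k x = (u', v')"
proof -
  define u v where "u = (1 / (norm u')\<^sup>2) *\<^sub>R u'" and "v = twist_act (nat \<bar>k\<bar>) (ocnj (kap k u')) v'"
  have u: "u \<noteq> 0" using assms by (simp add: u_def)
  have nz: "ocnj (kap k u') \<noteq> 0" using assms(3) by (metis kap_simps(3) norm_ocnj norm_eq_zero)
  have loc: "(u, v) \<in> locus"
    unfolding u_def v_def
    by (rule locus_gen_alg[OF assms(2) _ _ nz]) (intro gen_alg_intros kap_gen_alg)+
  have "twist_act (nat \<bar>k\<bar>) (kap k u) v = v'"
    unfolding u_def v_def kap_simps using assms by (subst twist_act_cancel) auto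
  moreover have "(1 / (norm u)\<^sup>2) *\<^sub>R u = u'"
    unfolding u_def using assms(3) by (rule inversion_inversion)
  ultimately have "transition k (u, v) = (u', v')"
    using transition_locus(1)[OF assms(1) loc u] by simp
  then show ?thesis using that[of "(u, v)"] loc u by simp
qed

lemma S13_iff_locus:
  "p \<in> S13 k \<longleftrightarrow> p \<in> shimada_sphere k \<and> (\<forall>x\<in>oct_bundle. (Inl x \<in> p \<longrightarrow> x \<in> locus) \<and> (Inr x \<in> p \<longrightarrow> x \<in> locus))"
  unfolding S13_def using locus_chart1 locus_chart2 by fast

lemma pt_in_shimada_sphere:
  assumes "x \<in> oct_bundle"
  shows "pt1 k x \<in> shimada_sphere k" "pt2 k x \<in> shimada_sphere k"
  using assms unfolding shimada_sphere_def pt1_def pt2_def by (auto intro!: quotientI)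

text \<open>\<open>S13\<close> imposes its condition at every representative of a point;
  \<open>transition_locus\<close> carries it from the first chart to the second.\<close>

lemma pt1_in_S13:
  assumes "odd k" "x \<in> oct_bundle"
  shows "pt1 k x \<in> S13 k \<longleftrightarrow> x \<in> locus"
proof
  assume "pt1 k x \<in> S13 k"
  then show "x \<in> locus" using assms by (auto simp: S13_iff_locus pt1_eq)
next
  assume "x \<in> locus"
  then show "pt1 k x \<in> S13 k"
    using assms transition_locus(2)[OF assms(1)] pt_in_shimada_sphere(1)[OF assms(2)]
    by (cases x) (auto simp: S13_iff_locus pt1_eq split: if_splits)
qed

lemma pt2_pt1:
  assumes "odd k" "y \<in> locus" "fst y \<noteq> 0"
  obtains x where "x \<in> locus" "fst x \<noteq> 0" "transition k x = y" "pt2 k y = pt1 k x"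
proof -
  obtain x where "x \<in> locus" "fst x \<noteq> 0" "transition k x = y"
    using transition_surj[OF assms(1)] assms(2,3) by (metis prod.collapse)
  then show ?thesis using that pt2_transition[of x k] assms(2) locus_oct_bundle by metis
qed

lemma pt2_in_S13:
  assumes "odd k" "y \<in> oct_bundle"
  shows "pt2 k y \<in> S13 k \<longleftrightarrow> y \<in> locus"
proof
  assume "pt2 k y \<in> S13 k"
  then show "y \<in> locus" using assms by (auto simp: S13_iff_locus pt2_eq)
next
  assume y: "y \<in> locus"
  show "pt2 k y \<in> S13 k"
  proof (cases "fst y = 0")
    case True
    then obtain v where "y = (0, v)" by (cases y) auto
    then show ?thesis using pt2_zero assms y pt_in_shimada_sphere(2)[OF assms(2)] by (auto simp: S13_iff_locus)
  next
    case False
    then show ?thesis using pt2_pt1[OF assms(1) y] pt1_in_S13[OF assms(1)] locus_oct_bundle by metis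
  qed
qed

text \<open>Outside the first chart only the fibre over u' = 0 remains, where \<open>pt2\<close>
  gives a class with a single element. Pointwise claims are split in this way.\<close>

lemma S13_cases:
  assumes "odd k" "p \<in> S13 k"
  obtains (chart1) u v where "(u, v) \<in> locus" "p = pt1 k (u, v)"
  | (origin2) v where "(0, v) \<in> locus" "p = pt2 k (0, v)"
proof -
  have "p \<in> shimada_sphere k" using assms(2) by (simp add: S13_iff_locus)
  then consider x where "x \<in> oct_bundle" "p = pt1 k x" | y where "y \<in> oct_bundle" "p = pt2 k y"
    unfolding shimada_sphere_def quotient_def pt1_def pt2_def by auto
  then show ?thesis
  proof cases
    case 1
    then show ?thesis using chart1 assms pt1_in_S13 by (metis prod.collapse)
  next
    case 2
    then have y: "y \<in> locus" using assms pt2_in_S13 by blast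
    show ?thesis
    proof (cases "fst y = 0")
      case True
      then show ?thesis using origin2 y 2 by (metis prod.collapse)
    next
      case False
      then show ?thesis using pt2_pt1[OF assms(1) y False] chart1 2 by (metis prod.collapse)
    qed
  qed
qed

section \<open>Automorphisms and the antipodal involution on the glued space\<close>

lemma G2D:
  assumes "g \<in> G2"
  shows "linear g" "bij g" "g (x \<odot> y) = g x \<odot> g y" "g oone = oone" "g x $ 0 = x $ 0" "norm (g x) = norm x"
    "g (ocnj x) = ocnj (g x)" "g (oim x) = oim (g x)" "g x = 0 \<longleftrightarrow> x = 0"
proof -
  show lin: "linear g" and bij: "bij g" and mult: "g (x \<odot> y) = g x \<odot> g y" for x y
    using assms by (auto simp: G2_def)
  obtain e where "g e = oone" using bij by (metis bij_pointE)
  then show one: "g oone = oone" using mult[of oone e] by simp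
  \<comment> \<open>For imaginary x the square of g x is the real number - |x|^2. If Re (g x) were
    nonzero, the quadratic equation of g x would make it a real multiple of 1, hence x as well by
    injectivity; but x is imaginary, so x and g x would vanish.\<close>
  have imag: "g x $ 0 = 0 \<and> (norm (g x))\<^sup>2 = (norm x)\<^sup>2" if "x $ 0 = 0" for x
  proof -
    have "g x \<odot> g x = g (x \<odot> x)" by (rule mult[symmetric])
    also have "x \<odot> x = (- (norm x)\<^sup>2) *\<^sub>R oone" using that by (simp add: omul_self)
    finally have "g x \<odot> g x = (- (norm x)\<^sup>2) *\<^sub>R oone" unfolding linear_cmul[OF lin] one .
    then have eq: "(2 * g x $ 0) *\<^sub>R g x = ((norm (g x))\<^sup>2 - (norm x)\<^sup>2) *\<^sub>R oone"
      unfolding omul_self by (simp add: algebra_simps)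
    have "g x $ 0 = 0"
    proof (rule ccontr)
      assume ne: "g x $ 0 \<noteq> 0"
      define c where "c = ((norm (g x))\<^sup>2 - (norm x)\<^sup>2) / (2 * g x $ 0)"
      have "g x = (1 / (2 * g x $ 0)) *\<^sub>R ((2 * g x $ 0) *\<^sub>R g x)" using ne by simp
      also have "\<dots> = c *\<^sub>R oone" unfolding eq by (simp add: c_def)
      finally have "g x = g (c *\<^sub>R oone)" by (simp add: linear_cmul[OF lin] one)
      then have x: "x = c *\<^sub>R oone" using bij by (metis bij_is_inj injD)
      with that have "c = 0" by (simp add: oone_nth)
      with x have "g x = 0" by (simp add: linear_0[OF lin])
      with ne show False by simp
    qed
    moreover from this eq have "(norm (g x))\<^sup>2 - (norm x)\<^sup>2 = 0" by (simp add: oct_eq_iff oone_nth)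
    ultimately show ?thesis by simp
  qed
  have gx: "g x = (x $ 0) *\<^sub>R oone + g (oim x)" for x
    by (subst oct_split[of x]) (simp add: linear_add[OF lin] linear_cmul[OF lin] one)
  show re: "g x $ 0 = x $ 0" for x
    using imag[of "oim x"] by (subst gx) (simp add: oone_nth)
  show im: "g (oim x) = oim (g x)" for x
    unfolding oim_def[of "g x"] re by (subst gx) simp
  have "(norm (g x))\<^sup>2 = (norm x)\<^sup>2"
    unfolding norm2_oim[of "g x"] norm2_oim[of x] re im[symmetric] using imag[of "oim x"] by simp
  then show nrm: "norm (g x) = norm x" by (simp add: power2_eq_iff_nonneg)
  show "g (ocnj x) = ocnj (g x)"
    unfolding ocnj_eq re im[symmetric] by (simp add: linear_diff[OF lin] linear_cmul[OF lin] one)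
  show "g x = 0 \<longleftrightarrow> x = 0" using nrm by (metis norm_eq_zero)
qed

lemma G2_kap: "g \<in> G2 \<Longrightarrow> g (kap k x) = kap k (g x)"
  by (simp add: kap_def G2D)

lemma G2_funpow: "g \<in> G2 \<Longrightarrow> g (((\<odot>) x ^^ i) v) = ((\<odot>) (g x) ^^ i) (g v)"
  by (induction i) (auto simp: G2D)

lemma G2_twist:
  assumes "g \<in> G2"
  shows "g (twist k x v) = twist k (g x) (g v)"
proof -
  have "g (oinv x) = oinv (g x)" for x
    using assms by (simp add: oinv_def G2D linear_cmul[OF G2D(1)[OF assms]])
  then have "g (opowi x i) = opowi (g x) i" for x i
    unfolding opowi_def using assms by (simp add: G2_funpow G2D)
  then show ?thesis
    unfolding twist_def Let_def using assms by (simp add: G2D linear_cmul[OF G2D(1)[OF assms]])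
qed

lemma G2_locus:
  assumes "g \<in> G2" "(x, v) \<in> locus"
  shows "(g x, g v) \<in> locus"
proof -
  have "g x \<bullet> g v = ore (g (x \<odot> ocnj v))"
    using assms(1) by (simp add: ore_omul_ocnj[symmetric] G2D)
  also have "\<dots> = x \<bullet> v" unfolding ore_omul_ocnj[symmetric] ore_def G2D(5)[OF assms(1)] ..
  finally show ?thesis using assms by (simp add: locus_def G2D)
qed

text \<open>Common to \<open>G2\<close> and the involution: maps compatible with inversion and with
  the twist act on both elements of a class at once.\<close>

lemma image_pt1:
  assumes "h \<in> {map_sum (\<lambda>(u, v). (f u, g v)) (\<lambda>(u', v'). (f u', g v'))}"
    and f: "\<And>u c. f (c *\<^sub>R u) = c *\<^sub>R f u" "\<And>u. norm (f u) = norm u" and g: "\<And>u v. twist k (f u) (g v) = g (twist k u v)"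
    and b: "(u, v) \<in> oct_bundle" "(f u, g v) \<in> oct_bundle"
  shows "h ` pt1 k (u, v) = pt1 k (f u, g v)"
proof -
  have "f u \<noteq> 0 \<longleftrightarrow> u \<noteq> 0" using f(2)[of u] by (metis norm_eq_zero)
  then show ?thesis
    using assms(1) f(2) by (auto simp: pt1_eq[OF b(1)] pt1_eq[OF b(2)] transition_def f(1) g)
qed

lemma G2_act_pt:
  assumes "g \<in> G2" "(u, v) \<in> locus"
  shows "G2_act g (pt1 k (u, v)) = pt1 k (g u, g v)" "u = 0 \<Longrightarrow> G2_act g (pt2 k (u, v)) = pt2 k (0, g v)"
proof -
  have b: "(u, v) \<in> oct_bundle" "(g u, g v) \<in> oct_bundle"
    using locus_oct_bundle G2_locus assms by blast+
  show "G2_act g (pt1 k (u, v)) = pt1 k (g u, g v)"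
    unfolding G2_act_def
    by (rule image_pt1) (use assms b in \<open>auto simp: G2D linear_cmul[OF G2D(1)] G2_twist\<close>)
  have "g 0 = 0" using G2D(9)[OF assms(1)] by simp
  then show "u = 0 \<Longrightarrow> G2_act g (pt2 k (u, v)) = pt2 k (0, g v)"
    using b by (simp add: pt2_zero G2_act_def)
qed

lemma T_involution_pt:
  assumes "(u, v) \<in> locus"
  shows "T_involution (pt1 k (u, v)) = pt1 k (u, - v)" "u = 0 \<Longrightarrow> T_involution (pt2 k (u, v)) = pt2 k (0, - v)"
proof -
  have b: "(u, v) \<in> oct_bundle" "(u, - v) \<in> oct_bundle"
    using locus_oct_bundle locus_minus assms by blast+
  show "T_involution (pt1 k (u, v)) = pt1 k (u, - v)"
    unfolding T_involution_def
    by (rule image_pt1[where f = "\<lambda>u. u" and g = uminus]) (use b in \<open>auto simp: twist_minus\<close>)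
  show "u = 0 \<Longrightarrow> T_involution (pt2 k (u, v)) = pt2 k (0, - v)"
    using b by (simp add: pt2_zero T_involution_def)
qed

section \<open>Quotients by free involutions\<close>

text \<open>Freeness made local: it provides a chart of \<open>quotient_atlas\<close> around every
  orbit.\<close>

definition separated_by :: "('a \<Rightarrow> 'a) \<Rightarrow> ('a, 'e::euclidean_space) atlas \<Rightarrow> bool" where
  "separated_by \<tau> A \<longleftrightarrow> (\<forall>U \<phi>. (U, \<phi>) \<in> A \<longrightarrow> (\<forall>x\<in>U. \<exists>W. open W \<and> \<phi> x \<in> W \<and> {y \<in> U. \<phi> y \<in> W} \<inter> \<tau> ` {y \<in> U. \<phi> y \<in> W} = {}))"

lemma smooth_map_iff:
  "smooth_map A B f \<longleftrightarrow> (\<forall>x\<in>atlas_carrier A. \<exists>U \<phi> V \<psi> W H. (U, \<phi>) \<in> A \<and> (V, \<psi>) \<in> B \<and> x \<in> U \<and> f x \<in> V \<and>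
     open W \<and> \<phi> x \<in> W \<and> smooth_on H W \<and> (\<forall>y\<in>U. \<phi> y \<in> W \<longrightarrow> f y \<in> V \<and> \<psi> (f y) = H (\<phi> y)))"
  unfolding smooth_map_def Bex_def split_paired_Ex case_prod_conv by (intro ball_cong refl) blast

lemma atlas_carrierI: "(U, \<phi>) \<in> A \<Longrightarrow> x \<in> U \<Longrightarrow> x \<in> atlas_carrier A"
  by (auto simp: atlas_carrier_def)

lemma quotient_atlasI:
  assumes "(U, \<phi>) \<in> A" "open W" "V = {x \<in> U. \<phi> x \<in> W}" "V \<inter> \<tau> ` V = {}"
  shows "((\<lambda>x. {x, \<tau> x}) ` V, \<lambda>q. \<phi> (the_elem (q \<inter> V))) \<in> quotient_atlas \<tau> A"
  unfolding quotient_atlas_def using assms by blast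

lemma atlas_carrier_quotient:
  assumes "separated_by \<tau> A"
  shows "atlas_carrier (quotient_atlas \<tau> A) = (\<lambda>x. {x, \<tau> x}) ` atlas_carrier A"
proof
  show "atlas_carrier (quotient_atlas \<tau> A) \<subseteq> (\<lambda>x. {x, \<tau> x}) ` atlas_carrier A"
    unfolding quotient_atlas_def atlas_carrier_def by fastforce
next
  show "(\<lambda>x. {x, \<tau> x}) ` atlas_carrier A \<subseteq> atlas_carrier (quotient_atlas \<tau> A)"
  proof
    fix q assume "q \<in> (\<lambda>x. {x, \<tau> x}) ` atlas_carrier A"
    then obtain x U \<phi> where x: "q = {x, \<tau> x}" "(U, \<phi>) \<in> A" "x \<in> U" by (auto simp: atlas_carrier_def)
    then obtain W where W: "open W" "\<phi> x \<in> W" "{y \<in> U. \<phi> y \<in> W} \<inter> \<tau> ` {y \<in> U. \<phi> y \<in> W} = {}"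
      using assms[unfolded separated_by_def, rule_format, OF x(2,3)] by blast
    show "q \<in> atlas_carrier (quotient_atlas \<tau> A)"
      by (rule atlas_carrierI[OF quotient_atlasI[OF x(2) W(1) refl W(3)]]) (use x W in auto)
  qed
qed

lemma the_elem_orbit:
  assumes "V \<inter> \<tau> ` V = {}" "y \<in> V"
  shows "the_elem ({y, \<tau> y} \<inter> V) = y"
proof -
  have "{y, \<tau> y} \<inter> V = {y}" using assms by auto
  then show ?thesis by simp
qed

text \<open>The local representative \<open>H\<close> is kept. Its domain is only shrunk until the
  source piece misses its image under \<sigma> and \<open>H\<close> maps into a piece of the target
  that misses its image under \<tau>.\<close>

lemma smooth_map_quotient:
  assumes f: "smooth_map A B f" and sep: "separated_by \<sigma> A" "separated_by \<tau> B"
    and F: "\<And>x. x \<in> atlas_carrier A \<Longrightarrow> F {x, \<sigma> x} = {f x, \<tau> (f x)}"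
  shows "smooth_map (quotient_atlas \<sigma> A) (quotient_atlas \<tau> B) F"
  unfolding smooth_map_iff
proof
  fix q assume "q \<in> atlas_carrier (quotient_atlas \<sigma> A)"
  then obtain x where q: "q = {x, \<sigma> x}" and x: "x \<in> atlas_carrier A"
    unfolding atlas_carrier_quotient[OF sep(1)] by auto
  obtain U \<phi> V \<psi> W H where U: "(U, \<phi>) \<in> A" "x \<in> U" and V: "(V, \<psi>) \<in> B" "f x \<in> V"
    and W: "open W" "\<phi> x \<in> W" and H: "smooth_on H W"
    and eq: "\<And>y. y \<in> U \<Longrightarrow> \<phi> y \<in> W \<Longrightarrow> f y \<in> V \<and> \<psi> (f y) = H (\<phi> y)"
    using f[unfolded smooth_map_iff, THEN bspec, OF x] by (elim exE conjE) (rule that, auto)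
  obtain W1 where W1: "open W1" "\<phi> x \<in> W1" "{y \<in> U. \<phi> y \<in> W1} \<inter> \<sigma> ` {y \<in> U. \<phi> y \<in> W1} = {}"
    using sep(1)[unfolded separated_by_def, rule_format, OF U] by blast
  obtain W2 where W2: "open W2" "\<psi> (f x) \<in> W2" "{y \<in> V. \<psi> y \<in> W2} \<inter> \<tau> ` {y \<in> V. \<psi> y \<in> W2} = {}"
    using sep(2)[unfolded separated_by_def, rule_format, OF V] by blast
  define W' where "W' = W1 \<inter> (W \<inter> H -` W2)"
  have W': "open W'" "\<phi> x \<in> W'" "W' \<subseteq> W"
    using W W1 W2 eq[OF U(2) W(2)] smooth_on_imp_continuous_on[OF H]
    by (auto simp: W'_def intro!: open_Int[OF W1(1)] continuous_open_preimage)
  define V1 V2 where "V1 = {y \<in> U. \<phi> y \<in> W'}" and "V2 = {y \<in> V. \<psi> y \<in> W2}"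
  have V1: "V1 \<inter> \<sigma> ` V1 = {}" using W1(3) unfolding V1_def W'_def by blast
  have V2: "V2 \<inter> \<tau> ` V2 = {}" using W2(3) unfolding V2_def .
  have fV: "f y \<in> V2 \<and> \<psi> (f y) = H (\<phi> y) \<and> F {y, \<sigma> y} = {f y, \<tau> (f y)}" if "y \<in> V1" for y
    using that eq[of y] F[OF atlas_carrierI[OF U(1)]] by (auto simp: V1_def V2_def W'_def)
  have xV: "x \<in> V1" using U W' by (simp add: V1_def)
  show "\<exists>U \<phi> V \<psi> W F'. (U, \<phi>) \<in> quotient_atlas \<sigma> A \<and> (V, \<psi>) \<in> quotient_atlas \<tau> B \<and> q \<in> U \<and> F q \<in> V \<and>
      open W \<and> \<phi> q \<in> W \<and> smooth_on F' W \<and> (\<forall>y\<in>U. \<phi> y \<in> W \<longrightarrow> F y \<in> V \<and> \<psi> (F y) = F' (\<phi> y))"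
  proof (intro exI conjI)
    show "q \<in> (\<lambda>x. {x, \<sigma> x}) ` V1" using xV q by auto
    show "F q \<in> (\<lambda>x. {x, \<tau> x}) ` V2" using fV[OF xV] q by auto
    show "open W'" by fact
    show "\<phi> (the_elem (q \<inter> V1)) \<in> W'" unfolding q the_elem_orbit[where \<tau> = \<sigma>, OF V1 xV] by fact
    show "smooth_on H W'" by (rule smooth_on_subset[OF H W'(3)])
    show "\<forall>q\<in>(\<lambda>x. {x, \<sigma> x}) ` V1. \<phi> (the_elem (q \<inter> V1)) \<in> W' \<longrightarrow> F q \<in> (\<lambda>x. {x, \<tau> x}) ` V2 \<and>
        \<psi> (the_elem (F q \<inter> V2)) = H (\<phi> (the_elem (q \<inter> V1)))"
    proof (intro ballI impI, elim imageE, hypsubst)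
      fix y assume y: "y \<in> V1"
      have f: "f y \<in> V2" "\<psi> (f y) = H (\<phi> y)" "F {y, \<sigma> y} = {f y, \<tau> (f y)}" using fV[OF y] by auto
      show "F {y, \<sigma> y} \<in> (\<lambda>x. {x, \<tau> x}) ` V2 \<and>
        \<psi> (the_elem (F {y, \<sigma> y} \<inter> V2)) = H (\<phi> (the_elem ({y, \<sigma> y} \<inter> V1)))"
        unfolding the_elem_orbit[where \<tau> = \<sigma>, OF V1 y] f(3) the_elem_orbit[where \<tau> = \<tau>, OF V2 f(1)]
        using f by auto
    qed
  qed (rule quotient_atlasI[OF U(1) W'(1) V1_def V1] quotient_atlasI[OF V(1) W2(1) V2_def V2])+
qed

text \<open>Points of the quotient are sets, so the induced map is the image map of f, which
  inherits injectivity from f.\<close>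

lemma equivariantly_diffeomorphic_quotient:
  assumes f: "diffeomorphism A B f"
    and equiv: "\<And>h x. h \<in> G \<Longrightarrow> x \<in> atlas_carrier A \<Longrightarrow> \<alpha> h x \<in> atlas_carrier A \<and> f (\<alpha> h x) = \<beta> h (f x)"
    and \<sigma>: "\<And>x. x \<in> atlas_carrier A \<Longrightarrow> \<sigma> x \<in> atlas_carrier A \<and> f (\<sigma> x) = \<tau> (f x)"
    and comm: "\<And>h y. h \<in> G \<Longrightarrow> \<beta> h (\<tau> y) = \<tau> (\<beta> h y)"
    and sep: "separated_by \<sigma> A" "separated_by \<tau> B"
  shows "equivariantly_diffeomorphic G (quotient_atlas \<sigma> A) (quotient_action \<alpha>) (quotient_atlas \<tau> B) (quotient_action \<beta>)"
proof -
  define CA CB where "CA = atlas_carrier A" and "CB = atlas_carrier B"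
  define g where "g = inv_into CA f"
  have bij: "bij_betw f CA CB" and smf: "smooth_map A B f" and smg: "smooth_map B A g"
    using f by (auto simp: diffeomorphism_def CA_def CB_def g_def)
  have inj: "inj_on f CA" using bij by (rule bij_betw_imp_inj_on)
  have fCA: "f x \<in> CB" if "x \<in> CA" for x using bij that by (rule bij_betwE[rule_format])
  have g: "g y \<in> CA" "f (g y) = y" if "y \<in> CB" for y
    using bij that unfolding g_def by (auto simp: bij_betw_def inv_into_into f_inv_into_f)
  note \<sigma> = \<sigma>[folded CA_def]
  note equiv = equiv[folded CA_def]
  note carA = atlas_carrier_quotient[OF sep(1), folded CA_def]
  note carB = atlas_carrier_quotient[OF sep(2), folded CB_def]
  define F where "F = (\<lambda>q. f ` q)"
  have F: "F {x, \<sigma> x} = {f x, \<tau> (f x)}" if "x \<in> CA" for x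
    using \<sigma>[OF that] by (simp add: F_def)
  have injF: "inj_on F (atlas_carrier (quotient_atlas \<sigma> A))"
    unfolding carA F_def
  proof (rule inj_onI)
    fix q q' assume "q \<in> (\<lambda>x. {x, \<sigma> x}) ` CA" "q' \<in> (\<lambda>x. {x, \<sigma> x}) ` CA" "f ` q = f ` q'"
    then show "q = q'" using \<sigma> inj_on_image_eq_iff[OF inj, of q q'] by auto
  qed
  have imF: "F ` atlas_carrier (quotient_atlas \<sigma> A) = atlas_carrier (quotient_atlas \<tau> B)"
  proof -
    have "F ` (\<lambda>x. {x, \<sigma> x}) ` CA = (\<lambda>x. {f x, \<tau> (f x)}) ` CA"
      unfolding image_image by (rule image_cong) (use F in auto)
    also have "\<dots> = (\<lambda>y. {y, \<tau> y}) ` f ` CA" by (simp add: image_image)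
    also have "f ` CA = CB" using bij by (rule bij_betw_imp_surj_on)
    finally show ?thesis unfolding carA carB .
  qed
  have Fi: "inv_into (atlas_carrier (quotient_atlas \<sigma> A)) F {y, \<tau> y} = {g y, \<sigma> (g y)}" if "y \<in> CB" for y
    by (rule inv_into_f_eq[OF injF]) (use g[OF that] F[of "g y"] in \<open>auto simp: carA\<close>)
  have diff: "diffeomorphism (quotient_atlas \<sigma> A) (quotient_atlas \<tau> B) F"
    unfolding diffeomorphism_def bij_betw_def
    using injF imF smooth_map_quotient[OF smf sep, of F] smooth_map_quotient[OF smg sep(2,1)] F Fi
    by (simp add: CA_def CB_def)
  have "quotient_action \<alpha> h q \<in> atlas_carrier (quotient_atlas \<sigma> A) \<and> F (quotient_action \<alpha> h q) = quotient_action \<beta> h (F q)"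
    if h: "h \<in> G" and q: "q \<in> atlas_carrier (quotient_atlas \<sigma> A)" for h q
  proof -
    obtain x where x: "x \<in> CA" "q = {x, \<sigma> x}" using q unfolding carA by auto
    \<comment> \<open>That \<alpha> commutes with \<sigma> is pulled back along the injective f from
      the corresponding property of \<beta> and \<tau>.\<close>
    have "f (\<alpha> h (\<sigma> x)) = f (\<sigma> (\<alpha> h x))"
      using equiv[OF h x(1)] equiv[OF h, of "\<sigma> x"] \<sigma>[OF x(1)] \<sigma>[of "\<alpha> h x"] comm[OF h] by simp
    then have "\<alpha> h (\<sigma> x) = \<sigma> (\<alpha> h x)"
      using inj_onD[OF inj] equiv[OF h x(1)] equiv[OF h, of "\<sigma> x"] \<sigma>[OF x(1)] \<sigma>[of "\<alpha> h x"] by simp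
    then have 1: "quotient_action \<alpha> h q = {\<alpha> h x, \<sigma> (\<alpha> h x)}" by (simp add: quotient_action_def x)
    have "F (quotient_action \<alpha> h q) = {f (\<alpha> h x), \<tau> (f (\<alpha> h x))}"
      unfolding 1 using F equiv[OF h x(1)] by simp
    also have "\<dots> = quotient_action \<beta> h (F q)"
      unfolding x(2) F[OF x(1)] quotient_action_def using equiv[OF h x(1)] comm[OF h] by simp
    finally show ?thesis using 1 equiv[OF h x(1)] by (auto simp: carA)
  qed
  then show ?thesis unfolding equivariantly_diffeomorphic_def using diff by blast
qed

section \<open>Equivariance\<close>

text \<open>For \<zeta> = a - i b on the unit circle, \<zeta>^(-2) and \<zeta>^(-d) are (a + i b)^2
  and (a + i b)^d; this form of the action has no negative powers.\<close>

definition rot :: "nat \<Rightarrow> real \<Rightarrow> real \<Rightarrow> complex ^ 8 \<Rightarrow> complex ^ 8" where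
  "rot d a b z = (\<chi> i. (if i = 0 then (Complex a b)\<^sup>2 else Complex a b ^ d) * z $ i)"

definition oct_complexified :: "(octonion \<Rightarrow> octonion) \<Rightarrow> complex ^ 8 \<Rightarrow> complex ^ 8" where
  "oct_complexified g z = (\<chi> i. if i = 0 then z $ 0 else (\<Sum>j\<in>-{0}. of_real (g (axis j 1) $ i) * z $ j))"

lemma rot_rot: "rot d a b (rot d a' b' z) = rot d (a * a' - b * b') (a * b' + b * a') z"
proof -
  have "Complex (a * a' - b * b') (a * b' + b * a') = Complex a b * Complex a' b'"
    by (simp add: complex_eq_iff)
  then show ?thesis
    unfolding rot_def by (simp add: vec_eq_iff power_mult_distrib)
qed

lemma rot_1_0 [simp]: "rot d 1 0 z = z"
proof -
  have "Complex 1 0 = 1" by (simp add: complex_eq_iff)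
  then show ?thesis by (simp add: rot_def vec_eq_iff)
qed

lemma rot_I_involution: "rot d a b (I_involution z) = I_involution (rot d a b z)"
  by (simp add: rot_def I_involution_def vec_eq_iff)

lemma rot_oct_complexified: "rot d a b (oct_complexified g z) = oct_complexified g (rot d a b z)"
  by (simp add: rot_def oct_complexified_def vec_eq_iff sum_distrib_left mult.left_commute)

lemma oct_complexified_I_involution: "oct_complexified g (I_involution z) = I_involution (oct_complexified g z)"
  by (simp add: I_involution_def oct_complexified_def vec_eq_iff sum_negf)

lemma rot_brieskorn:
  assumes "a\<^sup>2 + b\<^sup>2 = 1" "z \<in> brieskorn d"
  shows "rot d a b z \<in> brieskorn d"
proof -
  define c where "c = Complex a b"
  have c: "cmod c = 1" using assms(1) by (simp add: c_def cmod_def)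
  have "(\<Sum>i\<in>-{0}. (rot d a b z $ i)\<^sup>2) = (c ^ d)\<^sup>2 * (\<Sum>i\<in>-{0}. (z $ i)\<^sup>2)"
    unfolding sum_distrib_left by (rule sum.cong) (auto simp: rot_def c_def power_mult_distrib)
  moreover have "(\<Sum>i\<in>-{0}. (cmod (rot d a b z $ i))\<^sup>2) = (\<Sum>i\<in>-{0}. (cmod (z $ i))\<^sup>2)"
    by (rule sum.cong) (auto simp: rot_def c norm_mult norm_power simp flip: c_def)
  moreover have "rot d a b z $ 0 = c\<^sup>2 * z $ 0" by (simp add: rot_def c_def)
  ultimately show ?thesis
    using assms(2) by (simp add: brieskorn_iff c norm_mult norm_power power_mult_distrib mult.commute flip: power_mult)
qed

lemma bounded_linear_rot: "bounded_linear (rot d a b)"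
  by (intro linear_conv_bounded_linear[THEN iffD1] linearI) (auto simp: rot_def vec_eq_iff algebra_simps)

lemma SO2D:
  assumes "\<gamma> \<in> SO2"
  shows "(\<gamma> $ 1 $ 1)\<^sup>2 + (\<gamma> $ 1 $ 2)\<^sup>2 = 1"
proof -
  have "(\<gamma> ** transpose \<gamma>) $ 1 $ 1 = (mat 1 :: real ^ 2 ^ 2) $ 1 $ 1"
    using assms by (simp add: SO2_def rotation_matrix_def orthogonal_matrix_def)
  then show ?thesis
    by (simp add: matrix_matrix_mult_def transpose_def mat_def sum_2 power2_eq_square)
qed

lemma brieskorn_action_eq:
  assumes "\<gamma> \<in> SO2"
  shows "brieskorn_action d (\<gamma>, g) z = rot d (\<gamma> $ 1 $ 1) (\<gamma> $ 1 $ 2) (oct_complexified g z)"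
proof -
  define a b where "a = \<gamma> $ 1 $ 1" and "b = \<gamma> $ 1 $ 2"
  have "Complex a (- b) * Complex a b = 1"
    using SO2D[OF assms] by (simp add: complex_eq_iff a_def b_def power2_eq_square)
  then have inv: "inverse (Complex a (- b)) = Complex a b" by (rule inverse_unique)
  have "Complex a (- b) powi (- int e) = Complex a b ^ e" for e
    by (simp add: power_int_minus inv flip: power_inverse)
  from this[of 2] this[of d]
  show ?thesis
    by (simp add: brieskorn_action_def rot_def oct_complexified_def Let_def vec_eq_iff flip: a_def b_def)
qed

text \<open>A Moebius map with real coefficients commutes with conjugation: in the explicit form
  from \<open>mobius\<close> only the sign of Im u changes.\<close>

lemma kap_mobius:
  assumes ab: "a\<^sup>2 + b\<^sup>2 = 1" and p: "a *\<^sub>R oone - b *\<^sub>R u \<noteq> 0"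
  shows "kap k ((a *\<^sub>R u + b *\<^sub>R oone) \<odot> oinv (a *\<^sub>R oone - b *\<^sub>R u))
    = (a *\<^sub>R kap k u + b *\<^sub>R oone) \<odot> oinv (a *\<^sub>R oone - b *\<^sub>R kap k u)"
proof -
  have kp: "a *\<^sub>R oone - b *\<^sub>R kap k u = kap k (a *\<^sub>R oone - b *\<^sub>R u)" by simp
  have im: "kap k (oim u) = oim (kap k u)" by (simp add: kap_def ocnj_imag oim_linear)
  have "norm (oim (kap k u)) = norm (oim u)" by (simp add: oim_kap)
  then show ?thesis
    unfolding mobius(1)[OF ab refl p refl] using p
    by (subst mobius(1)[OF ab refl _ refl]) (simp_all add: kp im del: kap_simps(6-9), simp_all add: im)
qed

context brieskorn_profile
begin

text \<open>The dilation factor depends on the invariant t alone. The factor |p|^d that (1 +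
  |x'|^2)^(-d/2) gains cancels the |p|^(-d) in the law for \<open>clift\<close>.\<close>

lemma Phi_mobius:
  assumes ab: "a\<^sup>2 + b\<^sup>2 = 1" and p: "p = a *\<^sub>R oone - b *\<^sub>R x" "p \<noteq> 0"
    and x': "x' = (a *\<^sub>R x + b *\<^sub>R oone) \<odot> oinv p"
  shows "Phi (x', twist_act d p v) = rot d a b (Phi (x, v))"
proof -
  note mob = mobius[OF ab p x']
  define M where "M = m (orbit_par x)"
  define Q where "Q = 1 + (norm x)\<^sup>2"
  have pos: "norm p > 0" "Q > 0" "M > 0" using p(2) by (simp_all add: Q_def M_def m_orbit_par)
  have "((norm p)\<^sup>2) powr (real d / 2) = norm p ^ d"
  proof -
    have "(norm p)\<^sup>2 = norm p powr 2" using pos by simp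
    then have "((norm p)\<^sup>2) powr (real d / 2) = norm p powr real d" by (simp only: powr_powr) simp
    then show ?thesis using pos by (simp add: powr_realpow)
  qed
  then have r: "(M / (Q / (norm p)\<^sup>2)) powr (real d / 2) = (M / Q) powr (real d / 2) * norm p ^ d"
    by (simp add: powr_mult powr_divide)
  have "Phi (x', twist_act d p v) $ i = rot d a b (Phi (x, v)) $ i" for i
  proof (cases "i = 0")
    case True
    then show ?thesis by (simp add: Phi_def rot_def mob(3,4))
  next
    case False
    then have "Phi (x', twist_act d p v) $ i =
        of_real ((M / Q) powr (real d / 2) * norm p ^ d) * ((Complex a b / of_real (norm p)) ^ d * clift d x v $ i)"
      by (simp only: Phi_def case_prod_conv vec_lambda_beta if_False mob(2,4,5) vector_smult_component M_def[symmetric]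
          Q_def[symmetric] r)
    also have "\<dots> = Complex a b ^ d * (of_real ((M / Q) powr (real d / 2)) * clift d x v $ i)"
      using pos by (simp add: power_divide)
    also have "\<dots> = rot d a b (Phi (x, v)) $ i"
      using False by (simp add: Phi_def rot_def M_def Q_def)
    finally show ?thesis .
  qed
  then show ?thesis by (simp add: vec_eq_iff)
qed

lemma Phi_minus: "Phi (x, - v) = I_involution (Phi (x, v))"
  by (simp add: Phi_def I_involution_def vec_eq_iff clift_def cspan2_def Let_def omul.minus_right algebra_simps)

lemma Phi_G2:
  assumes g: "g \<in> G2" and "(x, v) \<in> locus"
  shows "Phi (g x, g v) = oct_complexified g (Phi (x, v))"
proof -
  note l = locusD[OF assms(2)]
  note lin = G2D(1)[OF g]
  \<comment> \<open>For imaginary y the index 0 contributes nothing, so the 7 x 7 block of g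
    suffices; v and (Im x) v are both imaginary.\<close>
  have gy: "complex_of_real (g y $ i) = (\<Sum>j\<in>-{0}. of_real (g (axis j 1) $ i) * of_real (y $ j))"
    if "y $ 0 = 0" for y i
  proof -
    have "y = (\<Sum>j\<in>UNIV. y $ j *\<^sub>R axis j 1)"
      by (simp add: vec_eq_iff axis_def if_distrib[of "\<lambda>c. _ * c"] cong: if_cong)
    then have "g y = (\<Sum>j\<in>UNIV. y $ j *\<^sub>R g (axis j 1))"
      by (metis (no_types, lifting) linear_sum[OF lin] linear_cmul[OF lin] sum.cong)
    then have "g y $ i = (\<Sum>j\<in>UNIV. g (axis j 1) $ i * y $ j)" by (simp add: mult.commute)
    then show ?thesis using that by (simp add: sum_Compl_0)
  qed
  have op: "orbit_par (g x) = orbit_par x" and nx: "norm (g x) = norm x" and cay: "cayley (g x) = cayley x"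
    by (simp_all add: orbit_par_def cayley_def G2D[OF g] flip: G2D(8)[OF g])
  have "clift d (g x) (g v) $ i = (\<Sum>j\<in>-{0}. of_real (g (axis j 1) $ i) * clift d x v $ j)" for i
  proof -
    have "oim (g x) \<odot> g v = g (oim x \<odot> v)" by (simp add: G2D[OF g])
    moreover have "norm (oim (g x)) = norm (oim x)" by (simp add: G2D(6)[OF g] flip: G2D(8)[OF g])
    ultimately show ?thesis
      by (simp add: clift_def Let_def cspan2_def G2D(5)[OF g] gy[OF l(1)] gy[OF l(6)] sum_distrib_left sum.distrib algebra_simps)
  qed
  then show ?thesis
    by (simp add: Phi_def oct_complexified_def vec_eq_iff op nx cay sum_distrib_left mult.left_commute)
qed

end

section \<open>The equivariant map on the glued sphere\<close>

locale shimada_brieskorn = brieskorn_profile +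
  fixes k :: int
  assumes k_odd: "odd k" and d_eq: "d = nat \<bar>k\<bar>"
begin

definition sphere_map :: "shimada_point \<Rightarrow> complex ^ 8" where
  "sphere_map p = (if p \<in> pt1 k ` oct_bundle
     then (\<lambda>(u, v). Phi (kap k u, v)) (inv_into oct_bundle (pt1 k) p)
     else (\<lambda>(u, v). rot d 0 1 (Phi (- ocnj (kap k u), v))) (inv_into oct_bundle (pt2 k) p))"

lemma sphere_map_pt1: "(u, v) \<in> locus \<Longrightarrow> sphere_map (pt1 k (u, v)) = Phi (kap k u, v)"
  using locus_oct_bundle by (auto simp: sphere_map_def inv_into_f_f[OF inj_on_pt1])

text \<open>On the overlap, with x the coordinate \<open>kap k u1\<close> of the first chart, the
  argument of \<open>Phi\<close> is - x^(-1), the image of x under \<gamma>(0, -1). The denominator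
  there is p = x, which produces exactly the twist of the gluing; \<gamma>(0, 1) moves x to the same
  point but has p = - x and would differ by the sign (-1)^d.\<close>

lemma sphere_map_pt2:
  assumes "(u, v) \<in> locus"
  shows "sphere_map (pt2 k (u, v)) = rot d 0 1 (Phi (- ocnj (kap k u), v))"
proof (cases "u = 0")
  case True
  then have "(0, v) \<in> oct_bundle" using assms locus_oct_bundle by blast
  then show ?thesis
    using True pt2_zero_notin[of v k] by (simp add: sphere_map_def inv_into_f_f[OF inj_on_pt2])
next
  case False
  then obtain x where x: "x \<in> locus" "fst x \<noteq> 0" "transition k x = (u, v)" "pt2 k (u, v) = pt1 k x"
    using pt2_pt1[OF k_odd assms] by auto
  obtain u1 v1 where x1: "x = (u1, v1)" by fastforce
  define y where "y = kap k u1"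
  have u1: "u1 \<noteq> 0" "y \<noteq> 0" and l1: "(u1, v1) \<in> locus" using x x1 by (auto simp: y_def)
  have uv: "u = (1 / (norm u1)\<^sup>2) *\<^sub>R u1" "v = twist_act d y v1"
    using transition_locus(1)[OF k_odd l1 u1(1)] x x1 by (auto simp: d_eq y_def)
  have "Phi (- ocnj (kap k u), v) = rot d 0 (- 1) (Phi (y, v1))"
    unfolding uv(2)
    by (rule Phi_mobius) (use u1 in \<open>simp_all add: uv(1) y_def oinv_def omul.minus_left ocnj_linear\<close>)
  then show ?thesis
    unfolding x(4) x1 sphere_map_pt1[OF l1] by (simp add: rot_rot y_def)
qed

lemma Phi_kap_in_brieskorn:
  assumes "(u, v) \<in> locus"
  shows "Phi (kap k u, v) \<in> brieskorn d" "rot d 0 1 (Phi (- ocnj (kap k u), v)) \<in> brieskorn d"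
  using assms by (auto intro!: rot_brieskorn Phi_in_brieskorn simp: locus_kap locus_neg_ocnj_kap)

lemma sphere_map_in_brieskorn: "p \<in> S13 k \<Longrightarrow> sphere_map p \<in> brieskorn d"
  by (erule S13_cases[OF k_odd]) (use Phi_kap_in_brieskorn in \<open>simp_all add: sphere_map_pt1 sphere_map_pt2 del: kap_simps(1)\<close>)

text \<open>In each combination of source and target chart, the octonion by which the action twists
  v is, up to \<open>kap\<close>, the denominator of a Moebius map for which
  \<open>Phi_mobius\<close> applies. A second chart on either side contributes a factor \<gamma>(0,
  1).\<close>

lemma SO2_act_sphere_map:
  assumes \<gamma>: "\<gamma> \<in> SO2" and q: "q \<in> S13 k"
  shows "SO2_act k \<gamma> q \<in> S13 k \<and> sphere_map (SO2_act k \<gamma> q) = rot d (\<gamma> $ 1 $ 1) (\<gamma> $ 1 $ 2) (sphere_map q)"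
proof -
  define a b where "a = \<gamma> $ 1 $ 1" and "b = \<gamma> $ 1 $ 2"
  have ab: "a\<^sup>2 + b\<^sup>2 = 1" using SO2D[OF \<gamma>] by (simp add: a_def b_def)
  have in1: "pt1 k (u, v) \<in> S13 k" and in2: "pt2 k (u, v) \<in> S13 k" if "(u, v) \<in> locus" for u v
    using that pt1_in_S13[OF k_odd] pt2_in_S13[OF k_odd] locus_oct_bundle by blast+
  have zero_gen: "0 \<in> gen_alg x" for x by (simp add: gen_alg_def oim_def exI[of _ 0])
  have one0: "oone \<noteq> 0" using oone_nth[of 0] by (metis zero_index zero_neq_one)
  show ?thesis
  proof (cases rule: S13_cases[OF k_odd q, case_names chart1 origin2])
    case (chart1 u v)
    have fq: "sphere_map q = Phi (kap k u, v)" using sphere_map_pt1[OF chart1(1)] by (simp only: chart1(2))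
    define p w where "p = a *\<^sub>R oone - b *\<^sub>R u" and "w = a *\<^sub>R u + b *\<^sub>R oone"
    have act: "SO2_act k \<gamma> q = (if p \<noteq> 0 then pt1 k (w \<odot> oinv p, twist k p v) else pt2 k (0, twist k w v))"
      using locus_oct_bundle[OF chart1(1)]
      by (simp add: chart1 SO2_act_def inv_into_f_f[OF inj_on_pt1] SO2_act1_def Let_def p_def w_def flip: a_def b_def)
    have gen: "p \<in> gen_alg u" "w \<in> gen_alg u" unfolding p_def w_def by (intro gen_alg_intros)+
    have tw: "twist k p v = twist_act d (kap k p) v" "twist k w v = twist_act d (kap k w) v"
      using twist_locus[OF k_odd chart1(1)] gen by (simp_all add: d_eq)
    have kgen: "kap k y \<in> gen_alg u" if "y \<in> gen_alg u" for y
      using that by (auto simp: kap_def intro: gen_alg_intros)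
    show ?thesis
    proof (cases "p = 0")
      case False
      have "kap k (w \<odot> oinv p) = (a *\<^sub>R kap k u + b *\<^sub>R oone) \<odot> oinv (kap k p)"
        using kap_mobius[OF ab, of u k] False by (simp add: w_def p_def)
      then have "Phi (kap k (w \<odot> oinv p), twist k p v) = rot d a b (Phi (kap k u, v))"
        unfolding tw using False by (intro Phi_mobius[OF ab]) (simp_all, simp add: p_def)
      moreover have loc: "(w \<odot> oinv p, twist k p v) \<in> locus"
        unfolding tw using False by (intro locus_gen_alg[OF chart1(1)] gen_alg_omul gen_alg_intros(6) gen kgen) simp
      ultimately show ?thesis
        unfolding act fq a_def[symmetric] b_def[symmetric] using False in1[OF loc] by (simp add: sphere_map_pt1[OF loc])
    next
      case True
      then have bu: "b *\<^sub>R u = a *\<^sub>R oone" by (simp add: p_def)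
      have "b *\<^sub>R w = (a\<^sup>2 + b\<^sup>2) *\<^sub>R oone"
      proof -
        have "b *\<^sub>R w = a *\<^sub>R (b *\<^sub>R u) + b\<^sup>2 *\<^sub>R oone" by (simp add: w_def algebra_simps power2_eq_square)
        then show ?thesis unfolding bu by (simp add: algebra_simps power2_eq_square)
      qed
      then have w0: "w \<noteq> 0" using ab one0 by auto
      have loc: "(0, twist k w v) \<in> locus"
        unfolding tw using w0 by (intro locus_gen_alg[OF chart1(1)] zero_gen gen kgen) simp
      have "b *\<^sub>R kap k u = a *\<^sub>R oone"
        using arg_cong[OF bu, of "kap k"] by simp
      then have x0: "0 = (b *\<^sub>R kap k u + (- a) *\<^sub>R oone) \<odot> oinv (kap k w)"
        by (simp add: omul.zero_left)
      txt \<open>As \<open>\<gamma>(a, b) = \<gamma>(0, 1) \<gamma>(b, -a)\<close>, the image in the second chart is the image of \<open>\<gamma>(b, -a)\<close> in the first.\<close>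
      have kw: "kap k w = b *\<^sub>R oone - (- a) *\<^sub>R kap k u" by (simp add: w_def)
      have "Phi (0, twist k w v) = rot d b (- a) (Phi (kap k u, v))"
        unfolding tw by (rule Phi_mobius[OF _ kw _ x0]) (use ab w0 in \<open>simp_all add: add.commute\<close>)
      then have "sphere_map (SO2_act k \<gamma> q) = rot d 0 1 (rot d b (- a) (Phi (kap k u, v)))"
        using True by (simp add: act sphere_map_pt2[OF loc] ocnj_linear)
      then show ?thesis
        unfolding fq a_def[symmetric] b_def[symmetric] using True in2[OF loc] by (simp add: act rot_rot)
    qed
  next
    case (origin2 v)
    have q: "q \<notin> pt1 k ` oct_bundle" "inv_into oct_bundle (pt2 k) q = (0, v)"
      using locus_oct_bundle[OF origin2(1)] pt2_zero_notin by (auto simp: origin2 inv_into_f_f[OF inj_on_pt2])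
    have act: "SO2_act k \<gamma> q = (if a \<noteq> 0 then pt2 k ((- b *\<^sub>R oone) \<odot> oinv (a *\<^sub>R oone), twist k (a *\<^sub>R oone) v)
        else pt1 k (0, twist k (- b *\<^sub>R oone) v))"
      using q one0 by (simp add: SO2_act_def SO2_act2_def Let_def ocnj_linear flip: a_def b_def)
    have gen: "c *\<^sub>R oone \<in> gen_alg 0" for c by (intro gen_alg_intros)
    have tw: "twist k (c *\<^sub>R oone) v = twist_act d (c *\<^sub>R oone) v" for c
      using twist_locus[OF k_odd origin2(1) gen, of c] by (simp add: d_eq)
    have fq: "sphere_map q = rot d 0 1 (Phi (0, v))" using sphere_map_pt2[OF origin2(1)] by (simp add: origin2 ocnj_linear)
    show ?thesis
    proof (cases "a = 0")
      case False
      define u where "u = (- b *\<^sub>R oone) \<odot> oinv (a *\<^sub>R oone)"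
      have loc: "(u, twist k (a *\<^sub>R oone) v) \<in> locus"
        unfolding tw u_def using False one0
        by (intro locus_gen_alg[OF origin2(1)] gen_alg_omul gen_alg_intros(6) gen) simp
      have "oinv (a *\<^sub>R oone) = (1 / a) *\<^sub>R oone"
      proof -
        have "norm oone = 1" by (simp add: norm_eq_sqrt_inner inner_8 oone_nth)
        then show ?thesis using False by (simp add: oinv_def ocnj_linear power2_eq_square)
      qed
      then have "- ocnj (kap k u) = (b *\<^sub>R oone) \<odot> oinv (a *\<^sub>R oone)"
        by (simp add: u_def omul_linear ocnj_linear omul.minus_left)
      then have "Phi (- ocnj (kap k u), twist k (a *\<^sub>R oone) v) = rot d a b (Phi (0, v))"
        unfolding tw using False one0 by (intro Phi_mobius[OF ab]) simp_all
      then show ?thesis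
        unfolding act fq a_def[symmetric] b_def[symmetric] u_def[symmetric]
        using False in2[OF loc] by (simp add: sphere_map_pt2[OF loc] rot_rot)
    next
      case True
      have b0: "b \<noteq> 0" using True ab by auto
      have loc: "(0, twist k (- b *\<^sub>R oone) v) \<in> locus"
        unfolding tw using b0 one0 by (intro locus_gen_alg[OF origin2(1)] zero_gen gen) simp
      \<comment> \<open>Since a = 0, the product \<gamma>(0, b) \<gamma>(0, 1) is \<gamma>(-b, 0),
        whose denominator is the constant - b.\<close>
      have "Phi (0, twist k (- b *\<^sub>R oone) v) = rot d (- b) 0 (Phi (0, v))"
        unfolding tw using b0 one0 ab True by (intro Phi_mobius) (simp_all add: omul.zero_left)
      then show ?thesis
        unfolding act fq a_def[symmetric] b_def[symmetric]
        using True in1[OF loc] sphere_map_pt1[OF loc] by (simp add: rot_rot)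
    qed
  qed
qed

lemma G2_act_sphere_map:
  assumes g: "g \<in> G2" and q: "q \<in> S13 k"
  shows "G2_act g q \<in> S13 k \<and> sphere_map (G2_act g q) = oct_complexified g (sphere_map q)"
proof (cases rule: S13_cases[OF k_odd q, case_names chart1 origin2])
  case (chart1 u v)
  note l = G2_locus[OF g chart1(1)]
  have "(kap k u, v) \<in> locus" using chart1 locus_kap by blast
  then show ?thesis
    using Phi_G2[OF g, of "kap k u" v] l pt1_in_S13[OF k_odd locus_oct_bundle[OF l]]
    by (simp add: G2_act_pt[OF g] chart1 sphere_map_pt1 G2_kap[OF g])
next
  case (origin2 v)
  have g0: "g 0 = 0" using G2D(9)[OF g] by simp
  have l: "(0, g v) \<in> locus" using G2_locus[OF g origin2(1)] by (simp add: g0)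
  show ?thesis
    using Phi_G2[OF g origin2(1)] pt2_in_S13[OF k_odd locus_oct_bundle[OF l]] l g0
    by (simp add: G2_act_pt[OF g] origin2 sphere_map_pt2 ocnj_linear rot_oct_complexified)
qed

lemma T_involution_sphere_map:
  assumes q: "q \<in> S13 k"
  shows "T_involution q \<in> S13 k \<and> sphere_map (T_involution q) = I_involution (sphere_map q)"
proof (cases rule: S13_cases[OF k_odd q, case_names chart1 origin2])
  case (chart1 u v)
  have l: "(u, - v) \<in> locus" using chart1 by (simp add: locus_minus)
  show ?thesis
    using l pt1_in_S13[OF k_odd locus_oct_bundle[OF l]]
    by (simp add: T_involution_pt chart1 sphere_map_pt1 Phi_minus)
next
  case (origin2 v)
  have l: "(0, - v) \<in> locus" using origin2 by (simp add: locus_minus)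
  show ?thesis
    using l pt2_in_S13[OF k_odd locus_oct_bundle[OF l]]
    by (simp add: T_involution_pt origin2 sphere_map_pt2 Phi_minus rot_I_involution)
qed

lemma davis_action_sphere_map:
  assumes h: "h \<in> SO2_G2" and q: "q \<in> S13 k"
  shows "davis_action k h q \<in> S13 k \<and> sphere_map (davis_action k h q) = M13_action k h (sphere_map q)"
proof -
  obtain \<gamma> g where h: "h = (\<gamma>, g)" "\<gamma> \<in> SO2" "g \<in> G2" using h by (auto simp: SO2_G2_def)
  show ?thesis
    using G2_act_sphere_map[OF h(3) q] SO2_act_sphere_map[OF h(2), of "G2_act g q"]
    by (simp add: h(1) davis_action_def M13_action_def brieskorn_action_eq[OF h(2)] flip: d_eq)
qed

end

section \<open>The diffeomorphism\<close>

context shimada_brieskorn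
begin

text \<open>The rotation negates z0 and turns n - Re z0 into n + Re z0; the two add up to 2 n > 0.
  Hence the two inverse formulas cover the variety.\<close>

lemma den_pos_dichotomy:
  assumes "z \<in> brieskorn d"
  shows "den z > 0 \<or> den (rot d 0 (- 1) z) > 0"
proof -
  have "(cmod (z $ 0))\<^sup>2 \<in> X" using n_eq brieskorn_cmod[OF assms] by simp
  then have n: "n ((cmod (z $ 0))\<^sup>2) > 0" by (rule X(3))
  have "(Complex 0 (- 1))\<^sup>2 = - 1" by (simp add: complex_eq_iff power2_eq_square)
  then have "rot d 0 (- 1) z $ 0 = - (z $ 0)" by (simp add: rot_def)
  with n show ?thesis by (auto simp: den_def)
qed

lemma Psi_kap_locus:
  assumes "z \<in> brieskorn d" "den z > 0"
  shows "(kap k (fst (Psi z)), snd (Psi z)) \<in> locus" "(- ocnj (kap k (fst (Psi z))), snd (Psi z)) \<in> locus"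
  using Phi_Psi(1)[OF assms] by (simp_all add: locus_kap locus_neg_ocnj_kap)

lemma sphere_map_preimage1:
  assumes "z \<in> brieskorn d" "den z > 0"
  shows "sphere_map (pt1 k (kap k (fst (Psi z)), snd (Psi z))) = z"
  unfolding sphere_map_pt1[OF Psi_kap_locus(1)[OF assms]] using Phi_Psi(2)[OF assms] by simp

lemma sphere_map_preimage2:
  assumes "rot d 0 (- 1) z \<in> brieskorn d" "den (rot d 0 (- 1) z) > 0"
  shows "sphere_map (pt2 k (- ocnj (kap k (fst (Psi (rot d 0 (- 1) z)))), snd (Psi (rot d 0 (- 1) z)))) = z"
  unfolding sphere_map_pt2[OF Psi_kap_locus(2)[OF assms]] using Phi_Psi(2)[OF assms] by (simp add: rot_rot ocnj_linear)

lemma den_sphere_map_pt1: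
  assumes "(u, v) \<in> locus"
  shows "den (sphere_map (pt1 k (u, v))) > 0" "Psi (sphere_map (pt1 k (u, v))) = (kap k u, v)"
proof -
  have "(kap k u, v) \<in> locus" using assms by (simp add: locus_kap)
  from Psi_Phi[OF this] show "den (sphere_map (pt1 k (u, v))) > 0" "Psi (sphere_map (pt1 k (u, v))) = (kap k u, v)"
    by (simp_all add: sphere_map_pt1[OF assms] Om_def)
qed

text \<open>The value \<open>den\<close> = 0 marks the fibre missing from the first chart, where
  \<open>den\<close> is positive; injectivity tells the two kinds of points apart by it.\<close>

lemma den_sphere_map_pt2:
  assumes "(0, v) \<in> locus"
  shows "den (sphere_map (pt2 k (0, v))) = 0" "Psi (rot d 0 (- 1) (sphere_map (pt2 k (0, v)))) = (0, v)"
proof -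
  have f: "sphere_map (pt2 k (0, v)) = rot d 0 1 (Phi (0, v))"
    using sphere_map_pt2[OF assms] by (simp add: ocnj_linear)
  have "orbit_par 0 = 0" "cayley 0 = 1"
    by (simp_all add: orbit_par_def cayley_def oim_def complex_eq_iff)
  moreover have "(Complex 0 1)\<^sup>2 = - 1" by (simp add: complex_eq_iff power2_eq_square)
  ultimately have z0: "sphere_map (pt2 k (0, v)) $ 0 = of_real (m 0)"
    unfolding f by (simp add: rot_def Phi_def)
  then show "den (sphere_map (pt2 k (0, v))) = 0"
    using n_m[of 0] by (simp add: den_def)
  show "Psi (rot d 0 (- 1) (sphere_map (pt2 k (0, v)))) = (0, v)"
    unfolding f using Psi_Phi(2)[OF assms] by (simp add: rot_rot)
qed

lemma inj_on_sphere_map: "inj_on sphere_map (S13 k)"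
proof (rule inj_onI)
  fix p q assume "p \<in> S13 k" "q \<in> S13 k" and eq: "sphere_map p = sphere_map q"
  then show "p = q"
  proof (cases rule: S13_cases[OF k_odd \<open>p \<in> S13 k\<close>, case_names p1 p2])
    case p1
    show ?thesis
    proof (cases rule: S13_cases[OF k_odd \<open>q \<in> S13 k\<close>, case_names q1 q2])
      case (q1 u v)
      then show ?thesis using den_sphere_map_pt1[OF p1(1)] den_sphere_map_pt1[OF q1(1)] p1(2) eq
        by (metis Pair_inject kap_simps(4))
    next
      case (q2 v)
      then show ?thesis using den_sphere_map_pt1[OF p1(1)] den_sphere_map_pt2[OF q2(1)] p1(2) eq by simp
    qed
  next
    case p2
    show ?thesis
    proof (cases rule: S13_cases[OF k_odd \<open>q \<in> S13 k\<close>, case_names q1 q2])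
      case (q1 u v)
      then show ?thesis using den_sphere_map_pt2[OF p2(1)] den_sphere_map_pt1[OF q1(1)] p2(2) eq by simp
    next
      case (q2 v)
      then show ?thesis using den_sphere_map_pt2[OF p2(1)] den_sphere_map_pt2[OF q2(1)] p2(2) eq by (metis Pair_inject)
    qed
  qed
qed

lemma pt_in_S13: "(u, v) \<in> locus \<Longrightarrow> pt1 k (u, v) \<in> S13 k" "(u, v) \<in> locus \<Longrightarrow> pt2 k (u, v) \<in> S13 k"
  using pt1_in_S13[OF k_odd] pt2_in_S13[OF k_odd] locus_oct_bundle by blast+

lemma sphere_map_image: "sphere_map ` S13 k = brieskorn d"
proof
  show "sphere_map ` S13 k \<subseteq> brieskorn d" using sphere_map_in_brieskorn by auto
  show "brieskorn d \<subseteq> sphere_map ` S13 k"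
  proof
    fix z assume z: "z \<in> brieskorn d"
    have z': "rot d 0 (- 1) z \<in> brieskorn d" by (rule rot_brieskorn[OF _ z]) simp
    show "z \<in> sphere_map ` S13 k"
    proof (cases "den z > 0")
      case True
      then show ?thesis
        using sphere_map_preimage1[OF z True] pt_in_S13(1)[OF Psi_kap_locus(1)[OF z True]] by (metis imageI)
    next
      case False
      then have "den (rot d 0 (- 1) z) > 0" using den_pos_dichotomy[OF z] by auto
      then show ?thesis
        using sphere_map_preimage2[OF z'] pt_in_S13(2)[OF Psi_kap_locus(2)[OF z']] by (metis imageI)
    qed
  qed
qed

lemma S13_atlas_eq:
  "S13_atlas k = {(pt1 k ` oct_bundle \<inter> S13 k, inv_into oct_bundle (pt1 k)),
     (pt2 k ` oct_bundle \<inter> S13 k, inv_into oct_bundle (pt2 k))}"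
  by (simp add: S13_atlas_def subspace_atlas_def shimada_atlas_def)

lemma chart_locus:
  "p \<in> pt1 k ` oct_bundle \<inter> S13 k \<longleftrightarrow> p \<in> pt1 k ` locus" "p \<in> pt2 k ` oct_bundle \<inter> S13 k \<longleftrightarrow> p \<in> pt2 k ` locus"
  using pt1_in_S13[OF k_odd] pt2_in_S13[OF k_odd] locus_oct_bundle by blast+

lemma inv_into_pt:
  "x \<in> locus \<Longrightarrow> inv_into oct_bundle (pt1 k) (pt1 k x) = x" "x \<in> locus \<Longrightarrow> inv_into oct_bundle (pt2 k) (pt2 k x) = x"
  using locus_oct_bundle by (auto simp: inv_into_f_f[OF inj_on_pt1] inv_into_f_f[OF inj_on_pt2])

lemma atlas_carrier_S13: "atlas_carrier (S13_atlas k) = S13 k"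
proof -
  have "p \<in> pt1 k ` oct_bundle \<union> pt2 k ` oct_bundle" if "p \<in> S13 k" for p
    by (cases rule: S13_cases[OF k_odd that]) (use locus_oct_bundle in blast)+
  then show ?thesis by (auto simp: atlas_carrier_def S13_atlas_eq)
qed

lemma M13_atlas_eq: "M13_atlas k = {(brieskorn d, \<lambda>z. z)}"
  by (simp add: M13_atlas_def d_eq)

lemma atlas_carrier_M13: "atlas_carrier (M13_atlas k) = brieskorn d"
  by (simp add: M13_atlas_eq atlas_carrier_def)

lemma smooth_map_sphere_map: "smooth_map (S13_atlas k) (M13_atlas k) sphere_map"
  unfolding smooth_map_iff atlas_carrier_S13
proof
  fix p assume p: "p \<in> S13 k"
  have lin: "smooth_on (\<lambda>y::octonion \<times> octonion. L (fst y)) UNIV" if "bounded_linear L" for L :: "octonion \<Rightarrow> octonion"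
    by (intro smooth_on_linear_compose[OF that] smooth_on_linear bounded_linear_fst open_UNIV)
  have snd: "smooth_on (snd :: octonion \<times> octonion \<Rightarrow> octonion) UNIV"
    by (intro smooth_on_linear bounded_linear_snd open_UNIV)
  show "\<exists>U \<phi> V \<psi> W H. (U, \<phi>) \<in> S13_atlas k \<and> (V, \<psi>) \<in> M13_atlas k \<and> p \<in> U \<and> sphere_map p \<in> V \<and> open W \<and> \<phi> p \<in> W \<and>
      smooth_on H W \<and> (\<forall>y\<in>U. \<phi> y \<in> W \<longrightarrow> sphere_map y \<in> V \<and> \<psi> (sphere_map y) = H (\<phi> y))"
  proof (cases rule: S13_cases[OF k_odd p, case_names chart1 origin2])
    case (chart1 u v)
    define H where "H = (\<lambda>y. Phi (kap k (fst y), snd y))"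
    have "smooth_on H UNIV"
      unfolding H_def by (intro smooth_on_Phi open_UNIV lin snd bounded_linear_kap)
    moreover have "\<forall>y\<in>pt1 k ` oct_bundle \<inter> S13 k. H (inv_into oct_bundle (pt1 k) y) = sphere_map y"
      unfolding Ball_def chart_locus by (auto simp: inv_into_pt sphere_map_pt1 H_def)
    moreover have "p \<in> pt1 k ` oct_bundle \<inter> S13 k" unfolding chart_locus using chart1 by auto
    ultimately show ?thesis
      using sphere_map_in_brieskorn p
      by (intro exI[of _ "pt1 k ` oct_bundle \<inter> S13 k"] exI[of _ "inv_into oct_bundle (pt1 k)"]
        exI[of _ "brieskorn d"] exI[of _ "\<lambda>z. z"] exI[of _ UNIV] exI[of _ H]) (simp add: S13_atlas_eq M13_atlas_eq)
  next
    case (origin2 v)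
    define H where "H = (\<lambda>y. rot d 0 1 (Phi (- ocnj (kap k (fst y)), snd y)))"
    have "smooth_on H UNIV"
      unfolding H_def
      by (intro smooth_on_linear_compose[OF bounded_linear_rot] smooth_on_Phi open_UNIV lin snd
          bounded_linear_minus bounded_linear_compose[OF bounded_linear_ocnj] bounded_linear_kap)
    moreover have "\<forall>y\<in>pt2 k ` oct_bundle \<inter> S13 k. H (inv_into oct_bundle (pt2 k) y) = sphere_map y"
      unfolding Ball_def chart_locus by (auto simp: inv_into_pt sphere_map_pt2 H_def)
    moreover have "p \<in> pt2 k ` oct_bundle \<inter> S13 k" unfolding chart_locus using origin2 by auto
    ultimately show ?thesis
      using sphere_map_in_brieskorn p
      by (intro exI[of _ "pt2 k ` oct_bundle \<inter> S13 k"] exI[of _ "inv_into oct_bundle (pt2 k)"]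
        exI[of _ "brieskorn d"] exI[of _ "\<lambda>z. z"] exI[of _ UNIV] exI[of _ H]) (simp add: S13_atlas_eq M13_atlas_eq)
  qed
qed

text \<open>On the variety, positivity of \<open>den\<close> already forces \<open>D0\<close> to be
  nonzero, since z then lies in the image of \<open>Phi\<close>.\<close>

lemma Om_if_den_pos: "z \<in> brieskorn d \<Longrightarrow> den z > 0 \<Longrightarrow> z \<in> Om"
  using Phi_Psi[of z] Psi_Phi(1)[of "fst (Psi z)" "snd (Psi z)"] by simp

lemma inv_into_sphere_map:
  assumes "z \<in> brieskorn d"
  shows "den z > 0 \<Longrightarrow> inv_into (S13 k) sphere_map z = pt1 k (kap k (fst (Psi z)), snd (Psi z))"
    "den (rot d 0 (- 1) z) > 0 \<Longrightarrow> inv_into (S13 k) sphere_map z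
       = pt2 k (- ocnj (kap k (fst (Psi (rot d 0 (- 1) z)))), snd (Psi (rot d 0 (- 1) z)))"
proof -
  have z': "rot d 0 (- 1) z \<in> brieskorn d" by (rule rot_brieskorn[OF _ assms]) simp
  show "den z > 0 \<Longrightarrow> inv_into (S13 k) sphere_map z = pt1 k (kap k (fst (Psi z)), snd (Psi z))"
    by (intro inv_into_f_eq[OF inj_on_sphere_map] pt_in_S13 Psi_kap_locus sphere_map_preimage1 assms)
  show "den (rot d 0 (- 1) z) > 0 \<Longrightarrow> inv_into (S13 k) sphere_map z
       = pt2 k (- ocnj (kap k (fst (Psi (rot d 0 (- 1) z)))), snd (Psi (rot d 0 (- 1) z)))"
    by (intro inv_into_f_eq[OF inj_on_sphere_map] pt_in_S13 Psi_kap_locus sphere_map_preimage2 z')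
qed

text \<open>The two formulas live on \<open>Om\<close> and on its preimage under the rotation by
  \<gamma>(0, -1), which together contain the variety.\<close>

lemma smooth_map_inv_sphere_map: "smooth_map (M13_atlas k) (S13_atlas k) (inv_into (S13 k) sphere_map)"
  unfolding smooth_map_iff atlas_carrier_M13
proof
  fix z assume z: "z \<in> brieskorn d"
  let ?g = "inv_into (S13 k) sphere_map"
  have id: "smooth_on (\<lambda>y::complex ^ 8. y) W" if "open W" for W
    by (rule smooth_on_linear[OF bounded_linear_ident that])
  show "\<exists>U \<phi> V \<psi> W H. (U, \<phi>) \<in> M13_atlas k \<and> (V, \<psi>) \<in> S13_atlas k \<and> z \<in> U \<and> ?g z \<in> V \<and> open W \<and> \<phi> z \<in> W \<and>
      smooth_on H W \<and> (\<forall>y\<in>U. \<phi> y \<in> W \<longrightarrow> ?g y \<in> V \<and> \<psi> (?g y) = H (\<phi> y))"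
  proof (cases "den z > 0")
    case True
    define H where "H = (\<lambda>y. (kap k (fst (Psi y)), snd (Psi y)))"
    have Psi: "smooth_on Psi Om" using smooth_on_Psi[OF open_Om id[OF open_Om]] by simp
    have "smooth_on H Om"
      unfolding H_def
      by (intro smooth_on_Pair open_Om smooth_on_linear_compose[OF bounded_linear_kap]
          smooth_on_linear_compose[OF bounded_linear_fst] smooth_on_linear_compose[OF bounded_linear_snd] Psi)
    moreover have "?g y \<in> pt1 k ` oct_bundle \<inter> S13 k \<and> inv_into oct_bundle (pt1 k) (?g y) = H y"
      if y: "y \<in> brieskorn d" "y \<in> Om" for y
    proof -
      have pos: "den y > 0" using y by (simp add: Om_def)
      show ?thesis
        unfolding chart_locus inv_into_sphere_map(1)[OF y(1) pos] inv_into_pt(1)[OF Psi_kap_locus(1)[OF y(1) pos]] H_def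
        using Psi_kap_locus(1)[OF y(1) pos] by simp
    qed
    ultimately show ?thesis
      using z open_Om Om_if_den_pos[OF z True]
      by (intro exI[of _ "brieskorn d"] exI[of _ "\<lambda>z. z"] exI[of _ "pt1 k ` oct_bundle \<inter> S13 k"]
        exI[of _ "inv_into oct_bundle (pt1 k)"] exI[of _ Om] exI[of _ H]) (simp add: S13_atlas_eq M13_atlas_eq)
  next
    case False
    define R where "R = rot d 0 (- 1)"
    have R: "R y \<in> brieskorn d" if "y \<in> brieskorn d" for y
      unfolding R_def by (rule rot_brieskorn[OF _ that]) simp
    define W where "W = R -` Om"
    have blR: "bounded_linear R" unfolding R_def by (rule bounded_linear_rot)
    have W: "open W" unfolding W_def
      by (rule open_vimage[OF open_Om]) (rule linear_continuous_on[OF blR])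
    have pos: "den (R z) > 0" using den_pos_dichotomy[OF z] False by (simp add: R_def)
    define H where "H = (\<lambda>y. (- ocnj (kap k (fst (Psi (R y)))), snd (Psi (R y))))"
    have Psi: "smooth_on (\<lambda>y. Psi (R y)) W"
      by (rule smooth_on_Psi[OF W smooth_on_linear[OF blR W]]) (simp add: W_def)
    have "smooth_on H W"
      unfolding H_def
      by (intro smooth_on_Pair W smooth_on_minus smooth_on_linear_compose[OF bounded_linear_ocnj]
          smooth_on_linear_compose[OF bounded_linear_kap]
          smooth_on_linear_compose[OF bounded_linear_fst] smooth_on_linear_compose[OF bounded_linear_snd] Psi)
    moreover have "?g y \<in> pt2 k ` oct_bundle \<inter> S13 k \<and> inv_into oct_bundle (pt2 k) (?g y) = H y"
      if y: "y \<in> brieskorn d" "y \<in> W" for y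
    proof -
      have pos: "den (R y) > 0" using y by (simp add: W_def Om_def)
      note loc = Psi_kap_locus(2)[OF R[OF y(1)] pos]
      show ?thesis
        unfolding chart_locus inv_into_sphere_map(2)[OF y(1) pos[unfolded R_def], folded R_def] inv_into_pt(2)[OF loc] H_def
        using loc by simp
    qed
    moreover have "z \<in> W" unfolding W_def using Om_if_den_pos[OF R[OF z] pos] by simp
    ultimately show ?thesis
      using z W
      by (intro exI[of _ "brieskorn d"] exI[of _ "\<lambda>z. z"] exI[of _ "pt2 k ` oct_bundle \<inter> S13 k"]
        exI[of _ "inv_into oct_bundle (pt2 k)"] exI[of _ W] exI[of _ H]) (simp add: S13_atlas_eq M13_atlas_eq)
  qed
qed

lemma diffeomorphism_sphere_map: "diffeomorphism (S13_atlas k) (M13_atlas k) sphere_map"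
  unfolding diffeomorphism_def atlas_carrier_S13 atlas_carrier_M13
  using inj_on_sphere_map sphere_map_image smooth_map_sphere_map smooth_map_inv_sphere_map by (simp add: bij_betw_def)

section \<open>Local freeness of the two involutions\<close>

lemma T_involution_pt2:
  assumes "(u, v) \<in> locus"
  shows "T_involution (pt2 k (u, v)) = pt2 k (u, - v)"
proof (cases "u = 0")
  case False
  then obtain x where x: "x \<in> locus" "fst x \<noteq> 0" "transition k x = (u, v)" "pt2 k (u, v) = pt1 k x"
    using pt2_pt1[OF k_odd assms] by auto
  obtain u1 v1 where x1: "x = (u1, v1)" by fastforce
  have t: "transition k (u1, - v1) = (u, - v)" using x(3) by (simp add: x1 transition_def twist_minus)
  have "pt2 k (u, - v) = pt1 k (u1, - v1)"
    unfolding t[symmetric] using x assms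
    by (intro pt2_transition) (auto simp: x1 t locus_minus intro: locus_oct_bundle)
  then show ?thesis using T_involution_pt(1) x by (simp add: x1)
qed (use assms T_involution_pt(2) in simp)

text \<open>The midpoint of v and -v is 0, at distance |c| from c, so the open ball of that radius
  about c, being convex, cannot contain both.\<close>

lemma antipode_far:
  fixes c v :: "'a::real_normed_vector"
  assumes "dist c v < norm c" "dist c (- v) < norm c"
  shows False
proof -
  have "2 * norm c = norm ((c - v) + (c - - v))" by (simp flip: scaleR_2)
  also have "\<dots> \<le> norm (c - v) + norm (c - - v)" by (rule norm_triangle_ineq)
  finally show False using assms by (simp add: dist_norm)
qed

lemma separated_by_T_involution: "separated_by T_involution (S13_atlas k)"
proof -
  have "\<exists>W. open W \<and> inv_into oct_bundle pt p \<in> W \<and>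
      {y \<in> U. inv_into oct_bundle pt y \<in> W} \<inter> T_involution ` {y \<in> U. inv_into oct_bundle pt y \<in> W} = {}"
    if U: "\<And>y. y \<in> U \<longleftrightarrow> y \<in> pt ` locus" and p: "p \<in> U"
      and inv: "\<And>x. x \<in> locus \<Longrightarrow> inv_into oct_bundle pt (pt x) = x"
      and T: "\<And>u v. (u, v) \<in> locus \<Longrightarrow> T_involution (pt (u, v)) = pt (u, - v)" for pt p U
  proof -
    obtain u v where uv: "(u, v) \<in> locus" "p = pt (u, v)" using p U by auto
    define W where "W = (UNIV :: octonion set) \<times> ball v 1"
    have "norm v = 1" using uv by (simp add: locus_def)
    have "T_involution y \<notin> {y \<in> U. inv_into oct_bundle pt y \<in> W}" if y: "y \<in> U" "inv_into oct_bundle pt y \<in> W" for y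
    proof
      assume T': "T_involution y \<in> {y \<in> U. inv_into oct_bundle pt y \<in> W}"
      obtain u1 v1 where y1: "(u1, v1) \<in> locus" "y = pt (u1, v1)" using y U by auto
      then have "(u1, - v1) \<in> locus" by (simp add: locus_minus)
      then have "dist v v1 < norm v" "dist v (- v1) < norm v"
        using y(2) T' inv y1 \<open>norm v = 1\<close> by (auto simp: T W_def)
      then show False by (rule antipode_far)
    qed
    moreover have "open W" "inv_into oct_bundle pt p \<in> W" by (simp_all add: W_def open_Times uv inv)
    ultimately show ?thesis by (intro exI[of _ W]) blast
  qed
  from this[of _ "pt1 k", OF chart_locus(1) _ inv_into_pt(1) T_involution_pt(1)]
    this[of _ "pt2 k", OF chart_locus(2) _ inv_into_pt(2) T_involution_pt2]
  show ?thesis unfolding separated_by_def S13_atlas_eq by simp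
qed

lemma separated_by_I_involution: "separated_by I_involution (M13_atlas k)"
proof -
  have "\<exists>W. open W \<and> z \<in> W \<and> {y \<in> brieskorn d. y \<in> W} \<inter> I_involution ` {y \<in> brieskorn d. y \<in> W} = {}"
    if z: "z \<in> brieskorn d" for z
  proof -
    have "\<exists>i. i \<noteq> 0 \<and> z $ i \<noteq> 0"
    proof (rule ccontr)
      assume "\<not> ?thesis"
      then have "(\<Sum>i\<in>-{0}. (cmod (z $ i))\<^sup>2) = 0" by (intro sum.neutral) auto
      then show False using z brieskorn_cmod(1)[OF z] by (simp add: brieskorn_iff)
    qed
    then obtain i where i: "i \<noteq> 0" "z $ i \<noteq> 0" by blast
    define W where "W = {y :: complex ^ 8. dist (z $ i) (y $ i) < norm (z $ i)}"
    have "open W" unfolding W_def by (intro open_Collect_less continuous_intros)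
    moreover have "I_involution y \<notin> W" if "y \<in> W" for y
      using that antipode_far[of "z $ i" "y $ i"] i by (auto simp: W_def I_involution_def)
    ultimately show ?thesis using i by (intro exI[of _ W]) (auto simp: W_def)
  qed
  then show ?thesis unfolding separated_by_def M13_atlas_eq by simp
qed

lemma M13_action_I_involution:
  "h \<in> SO2_G2 \<Longrightarrow> M13_action k h (I_involution z) = I_involution (M13_action k h z)"
  by (auto simp: SO2_G2_def M13_action_def brieskorn_action_eq oct_complexified_I_involution rot_I_involution)

end

theorem theorem1p3:
  fixes k :: int
  assumes "odd k"
  shows "equivariantly_diffeomorphic SO2_G2
           (S13_atlas k) (davis_action k)
           (M13_atlas k) (M13_action k)
       \<and> equivariantly_diffeomorphic SO2_G2
           (P13_atlas k) (quotient_action (davis_action k))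
           (N13_atlas k) (quotient_action (M13_action k))"
proof -
  have d: "nat \<bar>k\<bar> > 0" "odd (nat \<bar>k\<bar>)" using assms by (auto simp: even_nat_iff)
  obtain m n s :: "real \<Rightarrow> real" and T X where prof: "open T" "{0..1} \<subseteq> T" "smooth_on m T" "\<And>t. t \<in> T \<Longrightarrow> m t > 0"
    "open X" "smooth_on n X" "\<And>A. A \<in> X \<Longrightarrow> n A > 0"
    "\<And>t. 0 \<le> t \<Longrightarrow> t \<le> 1 \<Longrightarrow> (m t)\<^sup>2 * (1 - t) + m t ^ nat \<bar>k\<bar> * ev 1 t (nat \<bar>k\<bar>) = 1"
    "\<And>t. 0 \<le> t \<Longrightarrow> t \<le> 1 \<Longrightarrow> (m t)\<^sup>2 * (1 - t) \<in> X \<and> n ((m t)\<^sup>2 * (1 - t)) = m t"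
    "\<And>A. 0 \<le> A \<Longrightarrow> A < 1 \<Longrightarrow> A ^ nat \<bar>k\<bar> \<le> (1 - A)\<^sup>2 \<Longrightarrow>
       A \<in> X \<and> 0 \<le> s A \<and> s A \<le> 1 \<and> m (s A) = n A \<and> (n A)\<^sup>2 * (1 - s A) = A \<and> n A ^ nat \<bar>k\<bar> * ev 1 (s A) (nat \<bar>k\<bar>) = 1 - A"
    by (rule profile_exists[OF d(1)]) blast
  interpret shimada_brieskorn "nat \<bar>k\<bar>" m n s T X k
    by unfold_locales (use prof d assms in simp_all)
  note carrier = atlas_carrier_S13
  have "equivariantly_diffeomorphic SO2_G2 (S13_atlas k) (davis_action k) (M13_atlas k) (M13_action k)"
    unfolding equivariantly_diffeomorphic_def carrier using diffeomorphism_sphere_map davis_action_sphere_map by blast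
  moreover have "equivariantly_diffeomorphic SO2_G2 (P13_atlas k) (quotient_action (davis_action k))
      (N13_atlas k) (quotient_action (M13_action k))"
    unfolding P13_atlas_def N13_atlas_def
    by (rule equivariantly_diffeomorphic_quotient[OF diffeomorphism_sphere_map])
      (simp_all add: carrier davis_action_sphere_map T_involution_sphere_map M13_action_I_involution
        separated_by_T_involution separated_by_I_involution)
  ultimately show ?thesis ..
qed

end
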